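(* Let $\mathbf{Y}=(Y_i)_{i\in\mathbb{Z}}$, $Y_i=Y_0\circ T^i$, be the stationary sequence described in the context, denote by $P_{Y_0}$ the distribution of $Y_0$, and let $Q$ be a quantile function in $\mathbb{L}^1$. Let $X_i=f(Y_i)-\mathbb{E}(f(Y_i))$, where $f$ belongs to $\widetilde{\mathcal{F}}(Q,P_{Y_0})$, and let $S_n=\sum_{k=1}^nX_k$. Given a positive integer $n$, define $$R_n(u)=\big(\alpha_{2,\mathbf{Y}}^{-1}(u)\wedge n\big)Q(u),\quad u\in[0,1],\qquad L_n(x)=R_n^{-1}(x)=\inf\{u\in[0,1]:R_n(u)\le x\},\quad x\ge0 .$$ For $x>0$ let $$s_n^2(x)=n\int_{L_n(x)}^1(\alpha_{1,\mathbf{Y}}^{-1}(u)\wedge n)Q^2(u)\,du .$$ Then for any $r>2$ and any $\beta\in(r-2,r)$ there is a positive constant $C$, not depending on $n$ nor on $x$, such that for all positive integers $n$ and all $x>0$, $$\mathbb{P}\Big(\max_{1\le k\le n}|S_k|\ge x\Big)\le C\Big\{\frac{s_n^r(x)}{x^r}+\frac nx\int_0^{L_n(x)}Q(u)\,du+\frac n{x^{1+\beta/2}}\int_0^{L_n(x)}R_n^{\beta/2}(u)Q(u)\,du+\frac n{x^{1+r/2}}\int_{L_n(x)}^1R_n^{r/2}(u)Q(u)\,du\Big\}.$$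
   Context: Stationary sequence. $(\Omega,\mathcal{A},\mathbb{P})$ is a probability space, $T:\Omega\to\Omega$ is a bijective bi-measurable transformation preserving $\mathbb{P}$, and $\mathcal{F}_0\subseteq\mathcal{A}$ is a sub-$\sigma$-algebra with $\mathcal{F}_0\subseteq T^{-1}(\mathcal{F}_0)$. $Y_0$ is an $\mathcal{F}_0$-measurable integrable real-valued random variable with distribution $P_{Y_0}$, and $Y_i=Y_0\circ T^i$ for $i\in\mathbb{Z}$. Dependency coefficients. For an integrable random variable $Z$ put $Z^{(0)}=Z-\mathbb{E}(Z)$. For a random vector $V=(V_1,\dots,V_k)$ in $\mathbb{R}^k$ and a $\sigma$-algebra $\mathcal{F}$ let $$\alpha(\mathcal{F},V)=\sup_{(x_1,\dots,x_k)\in\mathbb{R}^k}\Big\|\mathbb{E}\Big(\prod_{j=1}^k(\mathbf{1}_{V_j\le x_j})^{(0)}\Big|\mathcal{F}\Big)-\mathbb{E}\Big(\prod_{j=1}^k(\mathbf{1}_{V_j\le x_j})^{(0)}\Big)\Big\|_1 .$$ For $k\ge1$ let $\alpha_{k,\mathbf{Y}}(0)=1/2$ and, for $n>0$, $\alpha_{k,\mathbf{Y}}(n)=\max_{1\le l\le k}\ \sup_{n\le i_1\le\dots\le i_l}\alpha(\mathcal{F}_0,(Y_{i_1},\dots,Y_{i_l}))$. For $u\in[0,1]$ let $\alpha_{k,\mathbf{Y}}^{-1}(u)=\min\{q\in\mathbb{N}:\alpha_{k,\mathbf{Y}}(q)\le u\}=\sum_{n=0}^\infty\mathbf{1}_{u<\alpha_{k,\mathbf{Y}}(n)}$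 (possibly $+\infty$; here $\mathbb{N}$ contains $0$). Quantile functions. A tail function is a function $H:\mathbb{R}^+\to[0,1]$ that is non-increasing, right-continuous and converges to $0$ at infinity. The associated quantile function is $Q=H^{-1}$, $Q(u)=\inf\{t\ge0:H(t)\le u\}$ for $u\in[0,1]$, with $\inf\emptyset=\infty$. $Q$ belongs to $\mathbb{L}^1$ (is integrable) if $\int_0^1Q(u)\,du<\infty$. Function classes. For a probability measure $\mu$ on $\mathbb{R}$ and an integrable quantile function $Q=H^{-1}$, $\widetilde{\mathrm{Mon}}(Q,\mu)$ is the set of functions $g$ which are monotonic on some open interval of $\mathbb{R}$ and null elsewhere and such that $\mu(|g|>t)\le H(t)$ for all $t\in\mathbb{R}^+$. $\widetilde{\mathcal{F}}(Q,\mu)$ is the closure in $\mathbb{L}^1(\mu)$ of the set of functions of the form $\sum_{\ell=1}^L a_\ell f_\ell$ with $\sum_{\ell=1}^L|a_\ell|\le1$ and $f_\ell\in\widetilde{\mathrm{Mon}}(Q,\mu)$. Notation: $a\wedge b=\min(a,b)$; $s_n^r(x)=(s_n^2(x))^{r/2}$. *)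

theory Defs
  imports "HOL-Probability.Probability"
begin

definition int_iterate :: "'a set \<Rightarrow> ('a \<Rightarrow> 'a) \<Rightarrow> int \<Rightarrow> 'a \<Rightarrow> 'a" where
  "int_iterate A T i =
     (if 0 \<le> i then T ^^ nat i else the_inv_into A T ^^ nat (- i))"

definition centered :: "'a measure \<Rightarrow> ('a \<Rightarrow> real) \<Rightarrow> 'a \<Rightarrow> real" where
  "centered M Z = (\<lambda>\<omega>. Z \<omega> - (\<integral>\<omega>'. Z \<omega>' \<partial>M))"

(* A random vector (V_1,...,V_k) is given by V :: nat => _, read only at the indices 1..k;
   likewise for the point x in R^k.  The coefficients take values in ennreal, so that no
   boundedness is needed for the suprema to be meaningful. *)

definition centered_indicator_prod ::
    "'a measure \<Rightarrow> nat \<Rightarrow> (nat \<Rightarrow> 'a \<Rightarrow> real) \<Rightarrow> (nat \<Rightarrow> real) \<Rightarrow> 'a \<Rightarrow> real" where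
  "centered_indicator_prod M k V x =
     (\<lambda>\<omega>. \<Prod>j\<in>{1..k}. centered M (\<lambda>\<omega>'. indicator {..x j} (V j \<omega>')) \<omega>)"

definition alpha_vec ::
    "'a measure \<Rightarrow> 'a measure \<Rightarrow> nat \<Rightarrow> (nat \<Rightarrow> 'a \<Rightarrow> real) \<Rightarrow> ennreal" where
  "alpha_vec M F k V =
     (SUP x. \<integral>\<^sup>+\<omega>. ennreal \<bar>real_cond_exp M F (centered_indicator_prod M k V x) \<omega>
                 - (\<integral>\<omega>'. centered_indicator_prod M k V x \<omega>' \<partial>M)\<bar> \<partial>M)"

definition alpha_coeff ::
    "'a measure \<Rightarrow> 'a measure \<Rightarrow> (int \<Rightarrow> 'a \<Rightarrow> real) \<Rightarrow> nat \<Rightarrow> nat \<Rightarrow> ennreal" where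
  "alpha_coeff M F Y k n =
     (if n = 0 then ennreal (1/2)
      else MAX l\<in>{1..k}. SUP i\<in>{i :: nat \<Rightarrow> int. int n \<le> i 1 \<and> mono_on {1..l} i}.
             alpha_vec M F l (\<lambda>j. Y (i j)))"

(* The infimum in enat is the minimum, or \<infinity> if the set is empty. *)
definition coeff_inv :: "(nat \<Rightarrow> ennreal) \<Rightarrow> real \<Rightarrow> enat" where
  "coeff_inv a u = Inf {enat q | q. a q \<le> ennreal u}"

(* Functions on the nonnegative reals are functions on real, constrained only there. *)
definition tail_function :: "(real \<Rightarrow> real) \<Rightarrow> bool" where
  "tail_function H \<longleftrightarrow>
     (\<forall>t\<ge>0. H t \<in> {0..1}) \<and> antimono_on {0..} H \<and>
     (\<forall>t\<ge>0. continuous (at_right t) H) \<and> (H \<longlongrightarrow> 0) at_top"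

definition quantile_fun :: "(real \<Rightarrow> real) \<Rightarrow> real \<Rightarrow> ennreal" where
  "quantile_fun H u = Inf {ennreal t | t. 0 \<le> t \<and> H t \<le> u}"

(* Parametrised by the tail function H rather than by Q = quantile_fun H: on the nonnegative
   reals a tail function and its quantile function determine each other. *)
definition Mon_class :: "(real \<Rightarrow> real) \<Rightarrow> real measure \<Rightarrow> (real \<Rightarrow> real) set" where
  "Mon_class H \<mu> =
     {g. (\<exists>I. open I \<and> is_interval I \<and> (mono_on I g \<or> antimono_on I g) \<and> (\<forall>y. y \<notin> I \<longrightarrow> g y = 0))
         \<and> (\<forall>t\<ge>0. measure \<mu> {y. t < \<bar>g y\<bar>} \<le> H t)}"

definition Mon_combinations :: "(real \<Rightarrow> real) \<Rightarrow> real measure \<Rightarrow> (real \<Rightarrow> real) set" where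
  "Mon_combinations H \<mu> =
     {(\<lambda>y. \<Sum>l=1..L. a l * g l y) | (L::nat) a g.
        (\<Sum>l=1..L. \<bar>a l\<bar>) \<le> 1 \<and> (\<forall>l\<in>{1..L}. g l \<in> Mon_class H \<mu>)}"

(* Closure in L^1(mu), as a set of functions rather than of classes. *)
definition F_class :: "(real \<Rightarrow> real) \<Rightarrow> real measure \<Rightarrow> (real \<Rightarrow> real) set" where
  "F_class H \<mu> =
     {f. integrable \<mu> f \<and>
         (\<forall>\<epsilon>>0. \<exists>h\<in>Mon_combinations H \<mu>. (\<integral>\<^sup>+y. ennreal \<bar>f y - h y\<bar> \<partial>\<mu>) < ennreal \<epsilon>)}"

(* In the following a1 and a2 stand for the inverses of the first and second order coefficients. *)

definition R_fun :: "(real \<Rightarrow> enat) \<Rightarrow> (real \<Rightarrow> ennreal) \<Rightarrow> nat \<Rightarrow> real \<Rightarrow> ennreal" where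
  "R_fun a2 Q n u = ennreal_of_enat (min (a2 u) (enat n)) * Q u"

definition L_fun :: "(real \<Rightarrow> enat) \<Rightarrow> (real \<Rightarrow> ennreal) \<Rightarrow> nat \<Rightarrow> real \<Rightarrow> real" where
  "L_fun a2 Q n x = Inf {u \<in> {0..1}. R_fun a2 Q n u \<le> ennreal x}"

definition s_sq ::
    "(real \<Rightarrow> enat) \<Rightarrow> (real \<Rightarrow> enat) \<Rightarrow> (real \<Rightarrow> ennreal) \<Rightarrow> nat \<Rightarrow> real \<Rightarrow> ennreal" where
  "s_sq a1 a2 Q n x =
     of_nat n * (\<integral>\<^sup>+u\<in>{L_fun a2 Q n x..1}. ennreal_of_enat (min (a1 u) (enat n)) * (Q u)\<^sup>2 \<partial>lborel)"

(* Only used with positive exponents. *)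
definition ennreal_powr :: "ennreal \<Rightarrow> real \<Rightarrow> ennreal" where
  "ennreal_powr y p = (if y = \<infinity> then \<infinity> else ennreal (enn2real y powr p))"

end

theory Submission
  imports Defs
begin

text \<open>The estimate is an inequality of Fuk-Nagaev type. Fix an integer \<open>J\<close> with \<open>J \<ge> r/2\<close>, put
\<open>y = x / (64 J)\<close> and \<open>L = L\<^sub>n(y)\<close>. The core is
\<open>P (max \<bar>S\<^sub>k\<bar> \<ge> x) \<le> C (s\<^sub>n(y)^r / x^r + n/x \<cdot> \<integral> Q over [0, L])\<close>, which is \<open>fuk_nagaev\<close>. It
implies the theorem: \<open>s\<^sub>n(y) \<le> s\<^sub>n(x)\<close> because \<open>L\<^sub>n\<close> is non-increasing, and on the interval
between \<open>L\<^sub>n(x)\<close> and \<open>L\<^sub>n(y)\<close> one has \<open>R\<^sub>n > y\<close>, so there \<open>Q \<le> (R\<^sub>n / y)^(r/2) Q\<close> and that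
part of the integral of \<open>Q\<close> is absorbed by the last summand.

Let \<open>K = Q(L)\<close> and let \<open>q\<close> be the smaller of \<open>n\<close> and of the inverse of the second order
coefficients at \<open>L\<close>. As \<open>R\<^sub>n\<close> is right-continuous the infimum defining \<open>L\<close> is attained, so
\<open>q K \<le> y\<close> (\<open>L_fun_properties\<close>). Two ideas give the core.

Truncation. A combination of monotone functions is replaced by a combination of indicators
of intervals, obtained by discretising each monotone function on a grid of the interval from
\<open>-K\<close> to \<open>K\<close> (\<open>Mon_combination_step_approximation\<close>). This truncates at \<open>K\<close> and produces
exactly the functions that the dependency coefficients control. The error is, up to an
arbitrarily small amount, at most the integral of the positive part of \<open>Q - K\<close>, hence of \<open>Q\<close>
over \<open>[0, L]\<close>; Markov's inequality disposes of it (\<open>deviation_by_step_functions\<close>).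

Level crossings of block sums. This part concerns \<open>1 \<le> q < n\<close>; otherwise crude bounds
suffice. The truncated sum is cut into blocks of length \<open>q\<close>, whose sums are at most
\<open>2 q K \<le> 2 y\<close> in absolute value. Blocks with even and with odd number are treated
separately. Between a block and its predecessor of the same parity there is a gap of length
\<open>q\<close>, and at lag \<open>q\<close> the second order coefficient is at most \<open>L\<close>. So, in \<open>L\<^sup>1\<close>, the
conditional mean of a block sum given the past is at most of order \<open>q K L\<close>, and its
conditional second moment differs from the unconditional one by at most order \<open>q\<^sup>2 K\<^sup>2 L\<close>.
Let \<open>p\<^sub>j\<close> be the probability that the partial sums reach the level \<open>8 j y\<close>. Chebyshev's
inequality for the increment between two consecutive levels yields \<open>p\<^sub>j\<^sub>+\<^sub>1 \<le> a p\<^sub>j + b\<close>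
(\<open>exit_level_recursion\<close>), where \<open>a\<close> is of order \<open>s\<^sub>n\<^sup>2(y) / y\<^sup>2\<close> and \<open>b\<close> is of order
\<open>n K L / y\<close>. After \<open>J\<close> steps \<open>p\<^sub>J \<le> a\<^sup>J + J b\<close>: the errors enter only linearly, and \<open>K L\<close> is
at most the integral of \<open>Q\<close> over \<open>[0, L]\<close>.\<close>

section \<open>Level crossings of sums with small conditional moments\<close>

text \<open>The sum \<open>w\<close> collects the increments of \<open>s\<close> only while the running maximum of \<open>\<bar>s\<bar>\<close> lies in
\<open>[j z, (j + 1) z)\<close>, so it equals \<open>s\<close> stopped at the passage of \<open>(j + 1) z\<close> minus \<open>s\<close> stopped
at the passage of \<open>j z\<close>. An increment is at most \<open>z / 2\<close>, hence \<open>s\<close> overshoots \<open>j z\<close> by at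
most \<open>z / 2\<close>, and reaching the next level costs \<open>w\<close> at least the remaining \<open>z / 2\<close>. The
three cases (below the lower level, between the levels, above the upper level) form the
invariant of an induction on time.\<close>

lemma crossing_increment:
  fixes u :: "nat \<Rightarrow> real" and z :: real and j :: nat
  defines "s \<equiv> \<lambda>k. \<Sum>i<k. u i"
  defines "a \<equiv> \<lambda>i. (\<exists>k\<le>i. \<bar>s k\<bar> \<ge> real j * z) \<and> (\<forall>k\<le>i. \<bar>s k\<bar> < (real j + 1) * z)"
  defines "w \<equiv> \<lambda>k. \<Sum>i<k. (if a i then u i else 0)"
  assumes z: "z > 0" and u: "\<And>i. i < N \<Longrightarrow> \<bar>u i\<bar> \<le> z / 2" and k: "k \<le> N"
  shows "((\<forall>i\<le>k. \<bar>s i\<bar> < real j * z) \<longrightarrow> w k = 0) \<and>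
         (a k \<longrightarrow> (\<exists>t\<le>k. \<bar>s t\<bar> \<le> real j * z + z / 2 \<and> w k = s k - s t)) \<and>
         ((\<exists>i\<le>k. \<bar>s i\<bar> \<ge> (real j + 1) * z) \<longrightarrow> \<bar>w k\<bar> \<ge> z / 2)"
  using k
proof (induction k)
  case 0
  then show ?case
    using z by (auto simp: s_def w_def a_def mult_le_0_iff)
next
  case (Suc k)
  have IH: "(\<forall>i\<le>k. \<bar>s i\<bar> < real j * z) \<Longrightarrow> w k = 0"
    "a k \<Longrightarrow> (\<exists>t\<le>k. \<bar>s t\<bar> \<le> real j * z + z / 2 \<and> w k = s k - s t)"
    "(\<exists>i\<le>k. \<bar>s i\<bar> \<ge> (real j + 1) * z) \<Longrightarrow> \<bar>w k\<bar> \<ge> z / 2"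
    using Suc by auto
  have uk: "\<bar>u k\<bar> \<le> z / 2" using u Suc.prems by simp
  have ss: "s (Suc k) = s k + u k" by (simp add: s_def)
  have ws: "w (Suc k) = w k + (if a k then u k else 0)" by (simp add: w_def)
  have jz: "(real j + 1) * z = real j * z + z" by (simp add: algebra_simps)
  consider (low) "\<forall>i\<le>k. \<bar>s i\<bar> < real j * z" | (mid) "a k" | (high) "\<exists>i\<le>k. \<bar>s i\<bar> \<ge> (real j + 1) * z"
    unfolding a_def by (metis not_le)
  then show ?case
  proof cases
    case low
    have na: "\<not> a k" using low unfolding a_def by (metis not_le)
    have w0: "w (Suc k) = 0" using IH(1)[OF low] na ws by simp
    have sk: "\<bar>s (Suc k)\<bar> < real j * z + z / 2" using low[rule_format, of k] uk ss by linarith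
    have lt: "\<bar>s i\<bar> < (real j + 1) * z" if "i \<le> Suc k" for i
    proof (cases "i \<le> k")
      case True
      then have "\<bar>s i\<bar> < real j * z" using low by blast
      then show ?thesis using z jz by linarith
    next
      case False
      then have "i = Suc k" using that by simp
      then show ?thesis using sk z jz by simp
    qed
    have "\<not> (\<exists>i\<le>Suc k. \<bar>s i\<bar> \<ge> (real j + 1) * z)"
      using lt by (meson not_le)
    moreover have "\<exists>t\<le>Suc k. \<bar>s t\<bar> \<le> real j * z + z / 2 \<and> w (Suc k) = s (Suc k) - s t"
      using sk w0 by (intro exI[of _ "Suc k"]) auto
    ultimately show ?thesis using w0 by blast
  next
    case mid
    obtain t where t: "t \<le> k" "\<bar>s t\<bar> \<le> real j * z + z / 2" "w k = s k - s t" using IH(2)[OF mid] by blast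
    have w1: "w (Suc k) = s (Suc k) - s t" using t mid ws ss by simp
    obtain i where i: "i \<le> k" "\<bar>s i\<bar> \<ge> real j * z" using mid unfolding a_def by blast
    have nl: "\<not> (\<forall>i\<le>Suc k. \<bar>s i\<bar> < real j * z)"
    proof
      assume "\<forall>i\<le>Suc k. \<bar>s i\<bar> < real j * z"
      then have "\<bar>s i\<bar> < real j * z" using i(1) by simp
      then show False using i(2) by simp
    qed
    have up: "\<bar>w (Suc k)\<bar> \<ge> z / 2" if ex: "\<exists>i\<le>Suc k. \<bar>s i\<bar> \<ge> (real j + 1) * z"
    proof -
      obtain i where i: "i \<le> Suc k" "\<bar>s i\<bar> \<ge> (real j + 1) * z" using ex by blast
      have "\<not> i \<le> k"
      proof
        assume "i \<le> k"
        then have "\<bar>s i\<bar> < (real j + 1) * z" using mid unfolding a_def by blast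
        then show False using i(2) by simp
      qed
      then have "i = Suc k" using i(1) by simp
      then have "\<bar>s (Suc k)\<bar> \<ge> (real j + 1) * z" using i(2) by simp
      then show ?thesis using t(2) w1 jz by linarith
    qed
    have "\<exists>t\<le>Suc k. \<bar>s t\<bar> \<le> real j * z + z / 2 \<and> w (Suc k) = s (Suc k) - s t"
      using t(1,2) w1 by (intro exI[of _ t]) simp
    then show ?thesis using nl up by (intro conjI impI) simp_all
  next
    case high
    have na: "\<not> a k" using high unfolding a_def by (metis not_le)
    have na': "\<not> a (Suc k)" using high unfolding a_def by (metis not_le le_SucI)
    obtain i where i: "i \<le> k" "\<bar>s i\<bar> \<ge> (real j + 1) * z" using high by blast
    then have "\<not> \<bar>s i\<bar> < real j * z" using z jz by linarith
    then have nl: "\<not> (\<forall>i\<le>Suc k. \<bar>s i\<bar> < real j * z)"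
      using i(1) le_SucI by blast
    have "\<bar>w (Suc k)\<bar> \<ge> z / 2" using IH(3)[OF high] na ws by simp
    then show ?thesis using nl na' by (simp only: simp_thms)
  qed
qed

text \<open>Chebyshev's inequality for the sum \<open>w\<close> of the previous lemma. The event that switches an
increment on depends on earlier variables only and is contained in the event of reaching
\<open>j z\<close>. Expanding the square, the diagonal terms are at most \<open>\<sigma>2 * p j + \<delta>2\<close>; in the cross
terms the factor \<open>w\<close> is at most \<open>2 (j + 1) z\<close> as long as it is switched on, so they are of
size \<open>z \<delta>1\<close>. Only \<open>\<sigma>2\<close> is multiplied by \<open>p j\<close>, which keeps the errors \<open>\<delta>1\<close> and \<open>\<delta>2\<close> linear
when the recursion is iterated. No maximal inequality is involved, since \<open>w\<close> is already
stopped.\<close>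

lemma (in prob_space) exit_level_recursion:
  fixes U :: "nat \<Rightarrow> 'a \<Rightarrow> real" and G :: "nat \<Rightarrow> 'a measure" and z \<sigma>2 \<delta>1 \<delta>2 :: real and j N :: nat
  defines "s \<equiv> \<lambda>k \<omega>. \<Sum>i<k. U i \<omega>"
  defines "p \<equiv> \<lambda>j::nat. prob {\<omega>\<in>space M. \<exists>k\<le>N. \<bar>s k \<omega>\<bar> \<ge> real j * z}"
  assumes z: "z > 0"
    and UM [measurable]: "\<And>i. U i \<in> borel_measurable M"
    and spG: "\<And>i. space (G i) = space M"
    and UG: "\<And>i k. k < i \<Longrightarrow> U k \<in> borel_measurable (G i)"
    and bnd: "\<And>i \<omega>. i < N \<Longrightarrow> \<omega> \<in> space M \<Longrightarrow> \<bar>U i \<omega>\<bar> \<le> z / 2"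
    and d1: "\<And>i \<xi>. i < N \<Longrightarrow> \<xi> \<in> borel_measurable (G i) \<Longrightarrow> (\<And>\<omega>. \<bar>\<xi> \<omega>\<bar> \<le> 1) \<Longrightarrow>
               \<bar>\<integral>\<omega>. \<xi> \<omega> * U i \<omega> \<partial>M\<bar> \<le> \<delta>1"
    and d2: "\<And>i \<xi>. i < N \<Longrightarrow> \<xi> \<in> borel_measurable (G i) \<Longrightarrow> (\<And>\<omega>. 0 \<le> \<xi> \<omega> \<and> \<xi> \<omega> \<le> 1) \<Longrightarrow>
               (\<integral>\<omega>. \<xi> \<omega> * (U i \<omega>)\<^sup>2 \<partial>M) \<le> \<sigma>2 * (\<integral>\<omega>. \<xi> \<omega> \<partial>M) + \<delta>2"
    and s0: "\<sigma>2 \<ge> 0"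
  shows "p (Suc j) \<le> 4 / z\<^sup>2 * (real N * (\<sigma>2 * p j + \<delta>2 + 4 * (real j + 1) * z * \<delta>1))"
proof -
  define A where "A = (\<lambda>i \<omega>. (\<exists>k\<le>i. \<bar>s k \<omega>\<bar> \<ge> real j * z) \<and> (\<forall>k\<le>i. \<bar>s k \<omega>\<bar> < (real j + 1) * z))"
  define ind :: "nat \<Rightarrow> 'a \<Rightarrow> real" where "ind = (\<lambda>i \<omega>. if \<omega> \<in> space M \<and> A i \<omega> then 1 else 0)"
  define w where "w = (\<lambda>k \<omega>. \<Sum>i<k. ind i \<omega> * U i \<omega>)"
  have path: "(A k \<omega> \<longrightarrow> (\<exists>t\<le>k. \<bar>s t \<omega>\<bar> \<le> real j * z + z / 2 \<and> w k \<omega> = s k \<omega> - s t \<omega>)) \<and>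
         ((\<exists>i\<le>k. \<bar>s i \<omega>\<bar> \<ge> (real j + 1) * z) \<longrightarrow> \<bar>w k \<omega>\<bar> \<ge> z / 2)"
    if "\<omega> \<in> space M" "k \<le> N" for k \<omega>
  proof -
    have "w k \<omega> = (\<Sum>i<k. (if A i \<omega> then U i \<omega> else 0))" for k
      unfolding w_def using that by (intro sum.cong) (auto simp: ind_def)
    then show ?thesis
      using crossing_increment[of z N "\<lambda>i. U i \<omega>" k j] z bnd that unfolding s_def A_def by auto
  qed
  have sG: "s k \<in> borel_measurable (G i)" if "k \<le> i" for k i
    unfolding s_def using UG that by (intro borel_measurable_sum) auto
  have sM [measurable]: "s k \<in> borel_measurable M" for k
    unfolding s_def by measurable
  have A_sets: "{\<omega>\<in>space N'. A k \<omega>} \<in> sets N'" if "\<And>l. l \<le> k \<Longrightarrow> s l \<in> borel_measurable N'" for N' k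
  proof -
    have [measurable]: "s l \<in> borel_measurable N'" if "l \<in> {..k}" for l using that \<open>\<And>l. l \<le> k \<Longrightarrow> s l \<in> borel_measurable N'\<close> by auto
    have "{\<omega>\<in>space N'. (\<exists>l\<in>{..k}. \<bar>s l \<omega>\<bar> \<ge> real j * z) \<and> (\<forall>l\<in>{..k}. \<bar>s l \<omega>\<bar> < (real j + 1) * z)} \<in> sets N'"
      by measurable
    then show ?thesis unfolding A_def by (simp add: atMost_iff Ball_def Bex_def)
  qed
  have ind_meas: "ind k \<in> borel_measurable N'"
    if "space N' = space M" "\<And>l. l \<le> k \<Longrightarrow> s l \<in> borel_measurable N'" for N' k
  proof -
    have "ind k \<in> borel_measurable N' \<longleftrightarrow> (indicator {\<omega>\<in>space N'. A k \<omega>} :: _ \<Rightarrow> real) \<in> borel_measurable N'"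
      by (intro measurable_cong) (auto simp: ind_def indicator_def that(1))
    then show ?thesis using A_sets[OF that(2)] by simp
  qed
  have indG: "ind k \<in> borel_measurable (G i)" if "k \<le> i" for i k
    using sG that by (intro ind_meas spG) auto
  have wG: "w k \<in> borel_measurable (G i)" if "k \<le> i" for i k
    unfolding w_def using indG UG that by (intro borel_measurable_sum borel_measurable_times) auto
  have AM: "{\<omega>\<in>space M. A k \<omega>} \<in> sets M" for k by (rule A_sets[OF sM])
  have indM [measurable]: "ind k \<in> borel_measurable M" for k by (rule ind_meas[OF refl sM])
  have wM [measurable]: "w k \<in> borel_measurable M" for k unfolding w_def by measurable
  have indb: "0 \<le> ind i \<omega>" "ind i \<omega> \<le> 1" "ind i \<omega> * ind i \<omega> = ind i \<omega>" for i \<omega> by (auto simp: ind_def)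
  have wb: "\<bar>w k \<omega>\<bar> \<le> real k * (z / 2)" if "k \<le> N" "\<omega> \<in> space M" for k \<omega>
  proof -
    have "\<bar>w k \<omega>\<bar> \<le> (\<Sum>i<k. \<bar>ind i \<omega> * U i \<omega>\<bar>)" unfolding w_def by (rule sum_abs)
    also have "\<dots> \<le> (\<Sum>i<k. z / 2)"
      using bnd that z by (intro sum_mono) (auto simp: ind_def abs_mult)
    finally show ?thesis by simp
  qed
  define c where "c = 2 * (real j + 1) * z"
  have c: "c > 0" using z by (simp add: c_def)
  have wA: "\<bar>ind i \<omega> * w i \<omega>\<bar> \<le> c" if "i \<le> N" for i \<omega>
  proof (cases "\<omega> \<in> space M \<and> A i \<omega>")
    case True
    have "\<exists>t\<le>i. \<bar>s t \<omega>\<bar> \<le> real j * z + z / 2 \<and> w i \<omega> = s i \<omega> - s t \<omega>"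
      by (rule path[THEN conjunct1, THEN mp]) (use True that in auto)
    then obtain t where t: "t \<le> i" "w i \<omega> = s i \<omega> - s t \<omega>" by blast
    moreover have "\<bar>s i \<omega>\<bar> < (real j + 1) * z" "\<bar>s t \<omega>\<bar> < (real j + 1) * z"
      using True t(1) unfolding A_def by auto
    ultimately show ?thesis using True unfolding ind_def c_def by (simp add: algebra_simps)
  qed (use c in \<open>auto simp: ind_def\<close>)
  have int_bd: "integrable M f" if "f \<in> borel_measurable M" "\<And>\<omega>. \<omega> \<in> space M \<Longrightarrow> \<bar>f \<omega>\<bar> \<le> B" for f :: "'a \<Rightarrow> real" and B
    using that by (intro integrable_const_bound[where B=B]) (auto intro!: AE_I2)
  have pj: "(\<integral>\<omega>. ind i \<omega> \<partial>M) \<le> p j" if "i \<le> N" for i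
  proof -
    have ev: "{\<omega>\<in>space M. \<exists>k\<in>{..N}. \<bar>s k \<omega>\<bar> \<ge> real j * z} \<in> sets M" by measurable
    have "(\<integral>\<omega>. ind i \<omega> \<partial>M) = (\<integral>\<omega>. indicator {\<omega>\<in>space M. A i \<omega>} \<omega> \<partial>M)"
      by (intro Bochner_Integration.integral_cong) (auto simp: ind_def indicator_def)
    also have "\<dots> = prob {\<omega>\<in>space M. A i \<omega>}" using AM by simp
    also have "\<dots> \<le> p j" unfolding p_def
      using that ev by (intro finite_measure_mono) (auto simp: A_def Bex_def intro: order_trans)
    finally show ?thesis .
  qed
  have step: "(\<integral>\<omega>. (w (Suc i) \<omega>)\<^sup>2 \<partial>M) \<le> (\<integral>\<omega>. (w i \<omega>)\<^sup>2 \<partial>M) + (\<sigma>2 * p j + \<delta>2 + 2 * c * \<delta>1)" if i: "i < N" for i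
  proof -
    \<comment> \<open>Dividing by the bound c makes the factor in the cross term an admissible test function.\<close>
    have e: "(w (Suc i) \<omega>)\<^sup>2 = (w i \<omega>)\<^sup>2 + (ind i \<omega> * (U i \<omega>)\<^sup>2 + 2 * c * ((ind i \<omega> * w i \<omega> / c) * U i \<omega>))" for \<omega>
    proof -
      have "(w (Suc i) \<omega>)\<^sup>2 = (w i \<omega>)\<^sup>2 + (ind i \<omega> * ind i \<omega>) * (U i \<omega>)\<^sup>2 + 2 * w i \<omega> * ind i \<omega> * U i \<omega>"
        by (simp add: w_def power2_eq_square algebra_simps)
      then show ?thesis using c indb(3) by simp
    qed
    have U2: "(U i \<omega>)\<^sup>2 \<le> (z/2)\<^sup>2" if "\<omega> \<in> space M" for \<omega>
      using power_mono[OF bnd[OF i that], of 2] by simp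
    have i1: "integrable M (\<lambda>\<omega>. (w i \<omega>)\<^sup>2)"
    proof (rule int_bd[of _ "(real i * (z / 2))\<^sup>2"])
      fix \<omega> assume "\<omega> \<in> space M"
      then show "\<bar>(w i \<omega>)\<^sup>2\<bar> \<le> (real i * (z / 2))\<^sup>2"
        using power_mono[OF wb[of i \<omega>], of 2] i by simp
    qed simp
    have i2: "integrable M (\<lambda>\<omega>. ind i \<omega> * (U i \<omega>)\<^sup>2)"
    proof (rule int_bd[of _ "1 * (z/2)\<^sup>2"])
      show "\<bar>ind i \<omega> * (U i \<omega>)\<^sup>2\<bar> \<le> 1 * (z/2)\<^sup>2" if "\<omega> \<in> space M" for \<omega>
        unfolding abs_mult using U2[OF that] indb[of i \<omega>] by (intro mult_mono) auto
    qed measurable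
    have x1: "\<bar>ind i \<omega> * w i \<omega> / c\<bar> \<le> 1" for \<omega> using wA[of i \<omega>] i c by (simp add: abs_divide)
    have i3: "integrable M (\<lambda>\<omega>. (ind i \<omega> * w i \<omega> / c) * U i \<omega>)"
    proof (rule int_bd[of _ "1 * (z/2)"])
      show "\<bar>(ind i \<omega> * w i \<omega> / c) * U i \<omega>\<bar> \<le> 1 * (z/2)" if "\<omega> \<in> space M" for \<omega>
        unfolding abs_mult[of "ind i \<omega> * w i \<omega> / c"] using x1[of \<omega>] bnd[OF i that] by (intro mult_mono) auto
    qed measurable
    have "(\<integral>\<omega>. (w (Suc i) \<omega>)\<^sup>2 \<partial>M) = (\<integral>\<omega>. (w i \<omega>)\<^sup>2 \<partial>M) + ((\<integral>\<omega>. ind i \<omega> * (U i \<omega>)\<^sup>2 \<partial>M)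
        + 2 * c * (\<integral>\<omega>. (ind i \<omega> * w i \<omega> / c) * U i \<omega> \<partial>M))"
      unfolding e using i1 i2 i3 by (subst Bochner_Integration.integral_add) (auto simp del: times_divide_eq_left times_divide_eq_right)
    moreover have "(\<integral>\<omega>. ind i \<omega> * (U i \<omega>)\<^sup>2 \<partial>M) \<le> \<sigma>2 * (\<integral>\<omega>. ind i \<omega> \<partial>M) + \<delta>2"
      using indG indb by (intro d2[OF i]) auto
    moreover have "\<sigma>2 * (\<integral>\<omega>. ind i \<omega> \<partial>M) \<le> \<sigma>2 * p j" using pj[of i] i s0 by (intro mult_left_mono) auto
    moreover have "(\<integral>\<omega>. (ind i \<omega> * w i \<omega> / c) * U i \<omega> \<partial>M) \<le> \<delta>1"
      using indG[of i i] wG[of i i] x1 by (intro order_trans[OF abs_ge_self d1[OF i]]) auto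
    then have "2 * c * (\<integral>\<omega>. (ind i \<omega> * w i \<omega> / c) * U i \<omega> \<partial>M) \<le> 2 * c * \<delta>1"
      using c by (intro mult_left_mono) auto
    ultimately show ?thesis by linarith
  qed
  have EW: "(\<integral>\<omega>. (w k \<omega>)\<^sup>2 \<partial>M) \<le> real k * (\<sigma>2 * p j + \<delta>2 + 2 * c * \<delta>1)" if "k \<le> N" for k
    using that
  proof (induction k)
    case 0
    then show ?case by (simp add: w_def)
  next
    case (Suc k)
    then show ?case using step[of k] by (simp add: algebra_simps)
  qed
  have iw: "integrable M (\<lambda>\<omega>. (w N \<omega>)\<^sup>2)"
  proof (rule int_bd[of _ "(real N * (z / 2))\<^sup>2"])
    fix \<omega> assume "\<omega> \<in> space M"
    then show "\<bar>(w N \<omega>)\<^sup>2\<bar> \<le> (real N * (z / 2))\<^sup>2"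
      using power_mono[OF wb[of N \<omega>], of 2] by simp
  qed simp
  have sub: "{\<omega>\<in>space M. \<exists>k\<le>N. \<bar>s k \<omega>\<bar> \<ge> real (Suc j) * z} \<subseteq> {\<omega>\<in>space M. (w N \<omega>)\<^sup>2 \<ge> (z/2)\<^sup>2}"
  proof clarsimp
    fix \<omega> k assume a: "\<omega> \<in> space M" "k \<le> N" "(1 + real j) * z \<le> \<bar>s k \<omega>\<bar>"
    then have "\<bar>w N \<omega>\<bar> \<ge> z / 2" using path[of \<omega> N] by (auto simp: add.commute)
    then have "(z/2)\<^sup>2 \<le> \<bar>w N \<omega>\<bar>\<^sup>2" using z by (intro power_mono) auto
    then show "(z/2)\<^sup>2 \<le> (w N \<omega>)\<^sup>2" by simp
  qed
  have "p (Suc j) \<le> prob {\<omega>\<in>space M. (w N \<omega>)\<^sup>2 \<ge> (z/2)\<^sup>2}"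
    unfolding p_def using sub by (intro finite_measure_mono) auto
  also have "\<dots> \<le> (\<integral>\<omega>. (w N \<omega>)\<^sup>2 \<partial>M) / (z/2)\<^sup>2"
    using iw z by (intro integral_Markov_inequality_measure[where A="space M"]) auto
  also have "\<dots> \<le> (real N * (\<sigma>2 * p j + \<delta>2 + 2 * c * \<delta>1)) / (z/2)\<^sup>2"
    using EW[of N] by (intro divide_right_mono) auto
  also have "\<dots> = 4 / z\<^sup>2 * (real N * (\<sigma>2 * p j + \<delta>2 + 4 * (real j + 1) * z * \<delta>1))"
    by (simp add: c_def power_divide algebra_simps add_divide_distrib)
  finally show ?thesis .
qed

section \<open>Quantile functions and step approximation of monotone functions\<close>

text \<open>Superlevel sets of a non-increasing function are intervals.\<close>

lemma antimono_ennreal_borel_measurable: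
  fixes f :: "real \<Rightarrow> ennreal"
  assumes "antimono f"
  shows "f \<in> borel_measurable borel"
proof (rule borel_measurableI_greater)
  fix y
  have "is_interval {x. y < f x}"
    using assms unfolding is_interval_1 by (auto dest: antimonoD intro: less_le_trans)
  then show "{x \<in> space borel. y < f x} \<in> sets borel"
    using real_interval_borel_measurable by simp
qed

lemma quantile_fun_antimono: "antimono (quantile_fun H)"
  unfolding quantile_fun_def by (intro antimonoI Inf_superset_mono) auto

lemma quantile_fun_measurable [measurable]: "quantile_fun H \<in> borel_measurable borel"
  by (rule antimono_ennreal_borel_measurable[OF quantile_fun_antimono])

lemma le_quantile_fun:
  assumes "tail_function H" "0 \<le> t" "u < H t"
  shows "ennreal t \<le> quantile_fun H u"
  unfolding quantile_fun_def
proof (rule Inf_greatest, clarify)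
  fix t' assume t': "0 \<le> t'" "H t' \<le> u"
  have "antimono_on {0..} H" using assms(1) by (simp add: tail_function_def)
  then have "\<not> t' \<le> t" using monotone_onD[of "{0..}" "(\<le>)" "(\<ge>)" H t' t] t' assms(2,3) by auto
  then show "ennreal t \<le> ennreal t'" by (simp add: ennreal_leI)
qed

lemma Mon_class_measurable:
  assumes "g \<in> Mon_class H \<mu>"
  shows "g \<in> borel_measurable borel"
proof -
  obtain I where I: "open I" "is_interval I" "mono_on I g \<or> antimono_on I g" "\<And>y. y \<notin> I \<Longrightarrow> g y = 0"
    using assms unfolding Mon_class_def by blast
  have Ib: "I \<in> sets borel" using I(1) by simp
  have *: "g' \<in> borel_measurable borel" if "mono_on I g'" "\<And>y. y \<notin> I \<Longrightarrow> g' y = 0" for g' :: "real \<Rightarrow> real"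
  proof (rule borel_measurable_piecewise_mono[of "{I, - I}"])
    show "mono_on c g'" if "c \<in> {I, - I}" for c
      using that \<open>mono_on I g'\<close> \<open>\<And>y. y \<notin> I \<Longrightarrow> g' y = 0\<close> by (auto simp: mono_on_def)
  qed (use Ib in auto)
  from I(3) show ?thesis
  proof
    assume "antimono_on I g"
    then have "(\<lambda>y. - g y) \<in> borel_measurable borel"
      using I(4) by (intro *) (auto simp: monotone_on_def)
    then show ?thesis by simp
  qed (use * I(4) in blast)
qed

text \<open>This is what ties the class to the dependency coefficients: being null off the interval of
monotonicity, such a function has only intervals as level sets beyond nonnegative levels.\<close>

lemma Mon_class_level_intervals:
  assumes "g \<in> Mon_class H \<mu>" "0 \<le> t"
  shows "is_interval {y. t < g y}" "is_interval {y. g y < - t}"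
proof -
  obtain I where I: "is_interval I" "mono_on I g \<or> antimono_on I g" "\<And>y. y \<notin> I \<Longrightarrow> g y = 0"
    using assms unfolding Mon_class_def by blast
  have *: "is_interval {y. t < g' y}"
    if g': "mono_on I g' \<or> antimono_on I g'" "\<And>y. y \<notin> I \<Longrightarrow> g' y = 0" for g' :: "real \<Rightarrow> real"
    unfolding is_interval_1
  proof (intro ballI allI impI)
    fix a b c assume a: "a \<in> {y. t < g' y}" "b \<in> {y. t < g' y}" "a \<le> c \<and> c \<le> b"
    have abI: "a \<in> I" "b \<in> I" using a g'(2) assms(2) by force+
    then have cI: "c \<in> I" using I(1) a(3) unfolding is_interval_1 by blast
    have "g' a \<le> g' c \<or> g' b \<le> g' c" using g'(1) abI cI a(3) by (auto simp: monotone_on_def)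
    then show "c \<in> {y. t < g' y}" using a(1,2) by auto
  qed
  show "is_interval {y. t < g y}" by (rule *[OF I(2,3)])
  have "mono_on I (\<lambda>y. - g y) \<or> antimono_on I (\<lambda>y. - g y)"
    using I(2) by (auto simp: monotone_on_def)
  then have "is_interval {y. t < - g y}" using I(3) by (intro *) auto
  also have "{y. t < - g y} = {y. g y < - t}" by auto
  finally show "is_interval {y. g y < - t}" .
qed

text \<open>The sum is \<open>\<delta>\<close> times the number of grid points \<open>\<delta>, 2 \<delta>, ..., m \<delta>\<close> strictly below \<open>v\<close>, that
is, \<open>v\<close> truncated at \<open>m \<delta>\<close> and rounded down.\<close>

lemma grid_sum:
  fixes v \<delta> :: real
  assumes "0 \<le> \<delta>" "0 \<le> v"
  shows "(v > real m * \<delta> \<longrightarrow> (\<Sum>i=1..m. \<delta> * of_bool (real i * \<delta> < v)) = real m * \<delta>) \<and>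
     (v \<le> real m * \<delta> \<longrightarrow> v - \<delta> \<le> (\<Sum>i=1..m. \<delta> * of_bool (real i * \<delta> < v)) \<and>
        (\<Sum>i=1..m. \<delta> * of_bool (real i * \<delta> < v)) \<le> v)"
proof (induction m)
  case 0
  then show ?case using assms by simp
next
  case (Suc m)
  have "real (Suc m) * \<delta> = real m * \<delta> + \<delta>" by (simp add: algebra_simps)
  then show ?case using Suc assms by (auto simp: not_less)
qed

lemma grid_count_le:
  fixes c \<delta> :: real
  assumes "0 \<le> \<delta>" "0 \<le> c"
  shows "(\<Sum>i=1..m. \<delta> * of_bool (real i * \<delta> \<le> c)) \<le> min c (real m * \<delta>)"
proof (induction m)
  case (Suc m)
  have "real (Suc m) * \<delta> = real m * \<delta> + \<delta>" by (simp add: algebra_simps)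
  then show ?case using Suc assms by (auto simp: not_less)
qed (use assms in auto)

lemma grid_approximation:
  fixes v \<delta> :: real
  assumes \<delta>: "0 \<le> \<delta>"
  shows "\<bar>v - (\<Sum>i=1..m. \<delta> * of_bool (real i * \<delta> < v) - \<delta> * of_bool (v < - (real i * \<delta>)))\<bar>
     \<le> \<delta> + max 0 (\<bar>v\<bar> - real m * \<delta>)"
proof -
  have *: "\<bar>v - (\<Sum>i=1..m. \<delta> * of_bool (real i * \<delta> < v))\<bar> \<le> \<delta> + max 0 (v - real m * \<delta>)"
    if "0 \<le> v" for v
    using grid_sum[OF \<delta> that, of m] \<delta> by (cases "v > real m * \<delta>") auto
  have 0: "0 \<le> real i * \<delta>" for i using \<delta> by simp
  show ?thesis
  proof (cases "0 \<le> v")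
    case True
    have "\<not> v < - (real i * \<delta>)" for i using True 0[of i] by linarith
    then show ?thesis using *[OF True] True by simp
  next
    case False
    have "\<not> real i * \<delta> < v" "v < - (real i * \<delta>) \<longleftrightarrow> real i * \<delta> < - v" for i using False 0[of i] by linarith+
    then show ?thesis using *[of "- v"] False by (simp add: sum_negf)
  qed
qed

text \<open>Both sides are areas. By Fubini the left one is the integral over \<open>t \<ge> K\<close> of the measure of
\<open>{\<bar>g\<bar> > t}\<close>, which is at most \<open>H t\<close>, so it is at most the area of
\<open>{(t, u). K \<le> t, u < H t}\<close>; and \<open>u < H t\<close> forces \<open>t \<le> Q u\<close>.\<close>

lemma Mon_class_excess_integral:
  assumes H: "tail_function H" and \<mu>: "prob_space \<mu>" "sets \<mu> = sets borel"
    and g: "g \<in> Mon_class H \<mu>" and K: "0 \<le> K"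
  shows "(\<integral>\<^sup>+y. ennreal (\<bar>g y\<bar> - K) \<partial>\<mu>) \<le> (\<integral>\<^sup>+u\<in>{0..1}. (quantile_fun H u - ennreal K) \<partial>lborel)"
proof -
  interpret \<mu>: prob_space \<mu> by fact
  interpret P: pair_sigma_finite lborel \<mu> by unfold_locales
  have gm [measurable]: "g \<in> borel_measurable \<mu>"
    using Mon_class_measurable[OF g] \<mu>(2) by (simp cong: measurable_cong_sets)
  define H' where "H' = (\<lambda>t. H (max 0 t))"
  have anti: "antimono_on {0..} H" and H01: "\<And>t. t \<ge> 0 \<Longrightarrow> H t \<in> {0..1}"
    using H by (auto simp: tail_function_def)
  have "mono (\<lambda>t. - H' t)"
    unfolding H'_def mono_def using anti by (auto simp: monotone_on_def)
  then have "(\<lambda>t. - H' t) \<in> borel_measurable borel" by (rule borel_measurable_mono)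
  then have H'm [measurable]: "H' \<in> borel_measurable borel" by simp
  let ?A = "\<lambda>t u. if K \<le> t \<and> 0 \<le> u \<and> u < H' t then 1 else 0 :: ennreal"
  have "(\<integral>\<^sup>+y. ennreal (\<bar>g y\<bar> - K) \<partial>\<mu>) = (\<integral>\<^sup>+y. \<integral>\<^sup>+t. (if K \<le> t \<and> t < \<bar>g y\<bar> then 1 else 0) \<partial>lborel \<partial>\<mu>)"
  proof (intro nn_integral_cong)
    fix y
    have "(\<integral>\<^sup>+t. (if K \<le> t \<and> t < \<bar>g y\<bar> then 1 else 0) \<partial>lborel) = (\<integral>\<^sup>+t. indicator {K..<\<bar>g y\<bar>} t \<partial>lborel)"
      by (intro nn_integral_cong) (auto simp: indicator_def)
    also have "\<dots> = ennreal (\<bar>g y\<bar> - K)" by (cases "K \<le> \<bar>g y\<bar>") (auto simp: ennreal_neg)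
    finally show "ennreal (\<bar>g y\<bar> - K) = (\<integral>\<^sup>+t. (if K \<le> t \<and> t < \<bar>g y\<bar> then 1 else 0) \<partial>lborel)" ..
  qed
  also have "\<dots> = (\<integral>\<^sup>+t. \<integral>\<^sup>+y. (if K \<le> t \<and> t < \<bar>g y\<bar> then 1 else 0) \<partial>\<mu> \<partial>lborel)"
    by (intro P.Fubini') measurable
  also have "\<dots> \<le> (\<integral>\<^sup>+t. \<integral>\<^sup>+u. ?A t u \<partial>lborel \<partial>lborel)"
  proof (intro nn_integral_mono)
    fix t :: real
    show "(\<integral>\<^sup>+y. (if K \<le> t \<and> t < \<bar>g y\<bar> then 1 else 0) \<partial>\<mu>)
          \<le> (\<integral>\<^sup>+u. ?A t u \<partial>lborel)"
    proof (cases "K \<le> t")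
      case True
      then have t: "0 \<le> t" using K by simp
      have "(\<integral>\<^sup>+y. (if K \<le> t \<and> t < \<bar>g y\<bar> then 1 else 0) \<partial>\<mu>) = (\<integral>\<^sup>+y. indicator {y\<in>space \<mu>. t < \<bar>g y\<bar>} y \<partial>\<mu>)"
        using True by (intro nn_integral_cong) (auto simp: indicator_def)
      also have "\<dots> = emeasure \<mu> {y\<in>space \<mu>. t < \<bar>g y\<bar>}" by (rule nn_integral_indicator) measurable
      also have "{y\<in>space \<mu>. t < \<bar>g y\<bar>} = {y. t < \<bar>g y\<bar>}" using sets_eq_imp_space_eq[OF \<mu>(2)] by simp
      also have "emeasure \<mu> {y. t < \<bar>g y\<bar>} \<le> ennreal (H t)"
        using g t unfolding Mon_class_def by (auto simp: \<mu>.emeasure_eq_measure intro!: ennreal_leI)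
      also have "\<dots> = (\<integral>\<^sup>+u. indicator {0..<H' t} u \<partial>lborel)" using H01[OF t] t by (simp add: H'_def)
      also have "\<dots> = (\<integral>\<^sup>+u. ?A t u \<partial>lborel)"
        using True by (intro nn_integral_cong) (auto simp: indicator_def)
      finally show ?thesis .
    qed simp
  qed
  also have "\<dots> = (\<integral>\<^sup>+u. \<integral>\<^sup>+t. ?A t u \<partial>lborel \<partial>lborel)"
    by (intro lborel_pair.Fubini'[symmetric]) measurable
  also have "\<dots> \<le> (\<integral>\<^sup>+u\<in>{0..1}. (quantile_fun H u - ennreal K) \<partial>lborel)"
  proof (intro nn_integral_mono)
    fix u :: real
    have Hle: "H' t \<le> 1" for t using H01[of "max 0 t"] by (simp add: H'_def)
    show "(\<integral>\<^sup>+t. ?A t u \<partial>lborel) \<le> (quantile_fun H u - ennreal K) * indicator {0..1} u"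
    proof (cases "0 \<le> u \<and> u < 1")
      case False
      then have "?A t u = 0" for t using Hle[of t] by auto
      then show ?thesis by simp
    next
      case True
      show ?thesis
      proof (cases "quantile_fun H u")
        case (real c)
        have "(\<integral>\<^sup>+t. ?A t u \<partial>lborel) \<le> (\<integral>\<^sup>+t. indicator {K..c} t \<partial>lborel)"
        proof (intro nn_integral_mono)
          fix t
          have "t \<le> c" if "K \<le> t" "u < H' t"
            using le_quantile_fun[OF H, of t u] that K real by (auto simp: H'_def)
          then show "?A t u \<le> indicator {K..c} t"
            by (auto simp: indicator_def)
        qed
        also have "\<dots> = ennreal (c - K)" by (cases "K \<le> c") (auto simp: ennreal_neg)
        also have "\<dots> = quantile_fun H u - ennreal K" using K real by (simp add: ennreal_minus)
        finally show ?thesis using True by simp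
      qed (use True in simp)
    qed
  qed
  finally show ?thesis .
qed

text \<open>With grid width \<open>\<delta> = K / m\<close>, each monotone \<open>g\<close> is approximated by \<open>\<delta>\<close> times the sum over the
grid points \<open>i \<delta>\<close> of the indicators of \<open>{g > i \<delta>}\<close> minus those of \<open>{g < - i \<delta>}\<close>; an index
\<open>(l, i, b)\<close> stands for the function, the grid point and the sign. The last but one
inequality keeps track of the tails: an interval at level \<open>i \<delta>\<close> has measure at most
\<open>H (i \<delta>)\<close>, so those of measure above \<open>u\<close> sit at levels below \<open>Q u\<close>, and their weights add up
to at most \<open>2 Q u\<close>.\<close>

lemma Mon_combination_step_approximation:
  assumes H: "tail_function H" and \<mu>: "prob_space \<mu>" "sets \<mu> = sets borel"
    and h: "h \<in> Mon_combinations H \<mu>" and K: "0 \<le> K" and \<epsilon>: "0 < \<epsilon>"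
  shows "\<exists>(P :: (nat \<times> nat \<times> bool) set) c B. finite P \<and> (\<forall>p\<in>P. is_interval (B p)) \<and>
    (\<Sum>p\<in>P. \<bar>c p\<bar>) \<le> 2 * K \<and>
    (\<forall>u\<ge>0. (\<Sum>p\<in>P. ennreal \<bar>c p\<bar> * of_bool (u < measure \<mu> (B p))) \<le> 2 * quantile_fun H u) \<and>
    (\<integral>\<^sup>+y. ennreal \<bar>h y - (\<Sum>p\<in>P. c p * indicator (B p) y)\<bar> \<partial>\<mu>)
      \<le> ennreal \<epsilon> + (\<integral>\<^sup>+u\<in>{0..1}. (quantile_fun H u - ennreal K) \<partial>lborel)"
proof -
  let ?ex = "(\<integral>\<^sup>+u\<in>{0..1}. (quantile_fun H u - ennreal K) \<partial>lborel)"
  interpret \<mu>: prob_space \<mu> by fact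
  have sp: "space \<mu> = UNIV" using sets_eq_imp_space_eq[OF \<mu>(2)] by simp
  obtain L a g where hd: "h = (\<lambda>y. \<Sum>l=1..(L::nat). a l * g l y)" and a: "(\<Sum>l=1..L. \<bar>a l\<bar>) \<le> 1"
    and g: "\<And>l. l \<in> {1..L} \<Longrightarrow> g l \<in> Mon_class H \<mu>" using h unfolding Mon_combinations_def by blast
  obtain m :: nat where m: "K / \<epsilon> < real m" using reals_Archimedean2 by blast
  have m0: "m > 0" using m K \<epsilon> by (metis divide_nonneg_pos gr0I not_less of_nat_0)
  define \<delta> where "\<delta> = K / real m"
  have \<delta>: "0 \<le> \<delta>" "real m * \<delta> = K" "\<delta> \<le> \<epsilon>"
    using K m0 m \<epsilon> by (auto simp: \<delta>_def field_simps)
  define P where "P = {1..L} \<times> {1..m} \<times> (UNIV :: bool set)"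
  define c where "c = (\<lambda>(l, i::nat, b). (if b then a l * \<delta> else - a l * \<delta>))"
  define B where "B = (\<lambda>(l, i::nat, b). (if b then {y. real i * \<delta> < g l y} else {y. g l y < - (real i * \<delta>)}))"
  have Psum: "(\<Sum>p\<in>P. F p) = (\<Sum>l=1..L. \<Sum>i=1..m. F (l,i,True) + F (l,i,False))"
    for F :: "_ \<Rightarrow> 'b::comm_monoid_add"
    unfolding P_def by (simp add: sum.cartesian_product' UNIV_bool add.commute)
  have fin: "finite P" by (simp add: P_def)
  have int: "is_interval (B p)" if "p \<in> P" for p
    using that \<delta> g Mon_class_level_intervals[of "g (fst p)" H \<mu> "real (fst (snd p)) * \<delta>"]
    by (auto simp: P_def B_def)
  have csum: "(\<Sum>p\<in>P. \<bar>c p\<bar>) \<le> 2 * K"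
  proof -
    have "(\<Sum>p\<in>P. \<bar>c p\<bar>) = (\<Sum>l=1..L. \<bar>a l\<bar>) * (2 * K)"
      unfolding Psum \<delta>(2)[symmetric] using \<delta>(1) by (simp add: c_def abs_mult sum_distrib_left mult_ac)
    also have "\<dots> \<le> 1 * (2 * K)" using a K by (intro mult_right_mono) auto
    finally show ?thesis by simp
  qed
  have Bmeas: "measure \<mu> (B (l,i,b)) \<le> H (real i * \<delta>)" if "l \<in> {1..L}" for l i b
  proof -
    have gm [measurable]: "g l \<in> borel_measurable \<mu>"
      using Mon_class_measurable[OF g[OF that]] \<mu>(2) by (simp cong: measurable_cong_sets)
    have "{y \<in> space \<mu>. real i * \<delta> < \<bar>g l y\<bar>} \<in> sets \<mu>" by measurable
    then have "measure \<mu> (B (l,i,b)) \<le> measure \<mu> {y. real i * \<delta> < \<bar>g l y\<bar>}"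
      by (intro \<mu>.finite_measure_mono) (auto simp: B_def sp)
    also have "\<dots> \<le> H (real i * \<delta>)" using g[OF that] \<delta> unfolding Mon_class_def by auto
    finally show ?thesis .
  qed
  have prof: "(\<Sum>p\<in>P. ennreal \<bar>c p\<bar> * of_bool (u < measure \<mu> (B p))) \<le> 2 * quantile_fun H u" if "u \<ge> 0" for u
  proof (cases "quantile_fun H u")
    case (real q)
    let ?t = "\<lambda>l i. \<bar>c (l,i,True)\<bar> * of_bool (u < measure \<mu> (B (l,i,True))) + \<bar>c (l,i,False)\<bar> * of_bool (u < measure \<mu> (B (l,i,False)))"
    have le: "of_bool (u < measure \<mu> (B (l,i,b))) \<le> (of_bool (real i * \<delta> \<le> q) :: real)" if "l \<in> {1..L}" for l i b
    proof (cases "u < measure \<mu> (B (l,i,b))")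
      case True
      then have "u < H (real i * \<delta>)" using Bmeas[OF that] by (rule less_le_trans)
      from le_quantile_fun[OF H _ this] show ?thesis using \<delta> real by simp
    qed simp
    have "(\<Sum>p\<in>P. ennreal \<bar>c p\<bar> * of_bool (u < measure \<mu> (B p))) = (\<Sum>p\<in>P. ennreal (\<bar>c p\<bar> * of_bool (u < measure \<mu> (B p))))"
      by (intro sum.cong) (auto simp: of_bool_def)
    also have "\<dots> = ennreal (\<Sum>p\<in>P. \<bar>c p\<bar> * of_bool (u < measure \<mu> (B p)))"
      by (rule sum_ennreal) simp
    also have "(\<Sum>p\<in>P. \<bar>c p\<bar> * of_bool (u < measure \<mu> (B p))) \<le> (\<Sum>l=1..L. \<bar>a l\<bar> * (2 * q))"
      unfolding Psum
    proof (intro sum_mono)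
      fix l assume l: "l \<in> {1..L}"
      have "(\<Sum>i=1..m. ?t l i)
         \<le> (\<Sum>i=1..m. \<bar>a l\<bar> * (2 * (\<delta> * of_bool (real i * \<delta> \<le> q))))"
      proof (intro sum_mono)
        fix i
        have "\<bar>c (l,i,b)\<bar> * of_bool (u < measure \<mu> (B (l,i,b))) \<le> \<bar>a l\<bar> * \<delta> * of_bool (real i * \<delta> \<le> q)" for b
          using le[OF l, of i b] \<delta> by (intro mult_mono) (auto simp: c_def abs_mult)
        from this[of True] this[of False]
        show "?t l i
          \<le> \<bar>a l\<bar> * (2 * (\<delta> * of_bool (real i * \<delta> \<le> q)))" by (simp add: algebra_simps)
      qed
      also have "\<dots> = \<bar>a l\<bar> * (2 * (\<Sum>i=1..m. \<delta> * of_bool (real i * \<delta> \<le> q)))"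
        by (simp only: sum_distrib_left)
      also have "\<dots> \<le> \<bar>a l\<bar> * (2 * q)"
        using grid_count_le[OF \<delta>(1) real(1), of m] by (intro mult_left_mono) auto
      finally show "(\<Sum>i=1..m. ?t l i)
         \<le> \<bar>a l\<bar> * (2 * q)" .
    qed
    also have "(\<Sum>l=1..L. \<bar>a l\<bar> * (2 * q)) = (\<Sum>l=1..L. \<bar>a l\<bar>) * (2 * q)" by (simp add: sum_distrib_right)
    also have "\<dots> \<le> 1 * (2 * q)" using a real by (intro mult_right_mono) auto
    finally show ?thesis using real by (simp add: ennreal_mult ennreal_leI)
  qed (simp add: ennreal_mult_top)
  let ?d = "\<lambda>y. ennreal \<bar>h y - (\<Sum>p\<in>P. c p * indicator (B p) y)\<bar>"
  let ?e = "\<lambda>y. (\<Sum>l=1..L. ennreal \<bar>a l\<bar> * (ennreal \<epsilon> + ennreal (\<bar>g l y\<bar> - K)))"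
  have "(\<integral>\<^sup>+y. ?d y \<partial>\<mu>)
     \<le> (\<integral>\<^sup>+y. ?e y \<partial>\<mu>)"
  proof (intro nn_integral_mono)
    fix y
    define st where "st = (\<lambda>l. \<Sum>i=1..m. \<delta> * of_bool (real i * \<delta> < g l y) - \<delta> * of_bool (g l y < - (real i * \<delta>)))"
    have "(\<Sum>p\<in>P. c p * indicator (B p) y) = (\<Sum>l=1..L. a l * st l)"
      unfolding Psum st_def sum_distrib_left
      by (intro sum.cong) (auto simp: c_def B_def indicator_def)
    then have "\<bar>h y - (\<Sum>p\<in>P. c p * indicator (B p) y)\<bar> = \<bar>\<Sum>l=1..L. a l * (g l y - st l)\<bar>"
      by (simp add: hd right_diff_distrib sum_subtractf)
    also have "\<dots> \<le> (\<Sum>l=1..L. \<bar>a l\<bar> * \<bar>g l y - st l\<bar>)"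
      by (rule order_trans[OF sum_abs]) (simp add: abs_mult)
    also have "\<dots> \<le> (\<Sum>l=1..L. \<bar>a l\<bar> * (\<epsilon> + max 0 (\<bar>g l y\<bar> - K)))"
      using grid_approximation[OF \<delta>(1), of "g _ y" m] \<delta>(2,3) unfolding st_def
      by (intro sum_mono mult_left_mono) (smt (verit, ccfv_threshold), simp)
    finally have "?d y \<le> ennreal (\<Sum>l=1..L. \<bar>a l\<bar> * (\<epsilon> + max 0 (\<bar>g l y\<bar> - K)))"
      by (rule ennreal_leI)
    also have "\<dots> = ?e y"
      using \<epsilon> by (subst sum_ennreal[symmetric]) (auto simp: ennreal_mult ennreal_plus max_def ennreal_neg intro!: sum.cong)
    finally show "?d y \<le> ?e y" .
  qed
  also have "\<dots> = (\<Sum>l=1..L. ennreal \<bar>a l\<bar> * (ennreal \<epsilon> + (\<integral>\<^sup>+y. ennreal (\<bar>g l y\<bar> - K) \<partial>\<mu>)))"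
  proof -
    have gm: "g l \<in> borel_measurable \<mu>" if "l \<in> {1..L}" for l
      using Mon_class_measurable[OF g[OF that]] \<mu>(2) by (simp cong: measurable_cong_sets)
    show ?thesis using gm
      by (subst nn_integral_sum) (auto intro!: sum.cong simp: nn_integral_cmult nn_integral_add \<mu>.emeasure_space_1)
  qed
  also have "\<dots> \<le> (\<Sum>l=1..L. ennreal \<bar>a l\<bar> * (ennreal \<epsilon> + ?ex))"
    using Mon_class_excess_integral[OF H \<mu> g K] by (intro sum_mono mult_left_mono add_left_mono) auto
  also have "\<dots> = ennreal (\<Sum>l=1..L. \<bar>a l\<bar>) * (ennreal \<epsilon> + ?ex)"
    by (simp only: sum_distrib_right[symmetric] sum_ennreal[OF abs_ge_zero])
  also have "\<dots> \<le> 1 * (ennreal \<epsilon> + ?ex)"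
    using a by (intro mult_right_mono) auto
  finally have appr: "(\<integral>\<^sup>+y. ennreal \<bar>h y - (\<Sum>p\<in>P. c p * indicator (B p) y)\<bar> \<partial>\<mu>)
      \<le> ennreal \<epsilon> + ?ex" by simp
  show ?thesis using fin int csum prof appr by blast
qed

section \<open>Duality for conditional expectations and intervals of the line\<close>

text \<open>The coefficients are \<open>L\<^sup>1\<close> norms of conditional expectations. Testing against bounded
\<open>F\<close>-measurable functions turns them into bounds for integrals, which are linear in \<open>Z\<close> and
stable under dominated convergence.\<close>

lemma (in prob_space) cond_exp_duality:
  assumes F: "subalgebra M F"
    and \<xi>: "\<xi> \<in> borel_measurable F" "\<And>\<omega>. \<bar>\<xi> \<omega>\<bar> \<le> 1"
    and Z: "integrable M Z"
  shows "ennreal \<bar>\<integral>\<omega>. \<xi> \<omega> * (Z \<omega> - (\<integral>\<omega>'. Z \<omega>' \<partial>M)) \<partial>M\<bar>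
    \<le> (\<integral>\<^sup>+\<omega>. ennreal \<bar>real_cond_exp M F Z \<omega> - (\<integral>\<omega>'. Z \<omega>' \<partial>M)\<bar> \<partial>M)"
proof -
  interpret F: finite_measure_subalgebra M F by unfold_locales (rule F)
  have \<xi>M [measurable]: "\<xi> \<in> borel_measurable M" by (rule measurable_from_subalg[OF F \<xi>(1)])
  have Zm [measurable]: "Z \<in> borel_measurable M" using Z by auto
  have mult: "integrable M (\<lambda>\<omega>. \<xi> \<omega> * f \<omega>)" if "integrable M f" for f :: "'a \<Rightarrow> real"
    using \<xi>(2) by (intro Bochner_Integration.integrable_bound[OF that])
      (use that in \<open>auto simp: abs_mult intro!: mult_left_le_one_le borel_measurable_times\<close>)
  define E where "E = (\<integral>\<omega>'. Z \<omega>' \<partial>M)"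
  define Z' where "Z' = real_cond_exp M F Z"
  have iZ': "integrable M Z'" unfolding Z'_def using F.real_cond_exp_int[OF Z] by simp
  have "(\<integral>\<omega>. \<xi> \<omega> * (Z \<omega> - E) \<partial>M) = (\<integral>\<omega>. \<xi> \<omega> * Z \<omega> \<partial>M) - (\<integral>\<omega>. \<xi> \<omega> * E \<partial>M)"
    using mult[OF Z] mult[of "\<lambda>_. E"] by (simp add: right_diff_distrib)
  also have "(\<integral>\<omega>. \<xi> \<omega> * Z \<omega> \<partial>M) = (\<integral>\<omega>. \<xi> \<omega> * Z' \<omega> \<partial>M)"
    unfolding Z'_def using F.real_cond_exp_intg(2)[OF mult[OF Z] \<xi>(1)] by simp
  also have "(\<integral>\<omega>. \<xi> \<omega> * Z' \<omega> \<partial>M) - (\<integral>\<omega>. \<xi> \<omega> * E \<partial>M) = (\<integral>\<omega>. \<xi> \<omega> * (Z' \<omega> - E) \<partial>M)"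
    using mult[OF iZ'] mult[of "\<lambda>_. E"] by (simp add: right_diff_distrib)
  finally have "\<bar>\<integral>\<omega>. \<xi> \<omega> * (Z \<omega> - E) \<partial>M\<bar> \<le> (\<integral>\<omega>. \<bar>\<xi> \<omega> * (Z' \<omega> - E)\<bar> \<partial>M)"
    using integral_abs_bound[of M "\<lambda>\<omega>. \<xi> \<omega> * (Z' \<omega> - E)"] by simp
  also have "\<dots> \<le> (\<integral>\<omega>. \<bar>Z' \<omega> - E\<bar> \<partial>M)"
  proof (rule integral_mono)
    show "integrable M (\<lambda>\<omega>. \<bar>\<xi> \<omega> * (Z' \<omega> - E)\<bar>)"
      using mult[of "\<lambda>\<omega>. Z' \<omega> - E"] iZ' by (intro integrable_abs) auto
    show "\<bar>\<xi> \<omega> * (Z' \<omega> - E)\<bar> \<le> \<bar>Z' \<omega> - E\<bar>" for \<omega>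
      using \<xi>(2)[of \<omega>] by (simp add: abs_mult mult_left_le_one_le)
  qed (use iZ' in auto)
  finally have "ennreal \<bar>\<integral>\<omega>. \<xi> \<omega> * (Z \<omega> - E) \<partial>M\<bar> \<le> ennreal (\<integral>\<omega>. \<bar>Z' \<omega> - E\<bar> \<partial>M)" by (rule ennreal_leI)
  also have "\<dots> = (\<integral>\<^sup>+\<omega>. ennreal \<bar>Z' \<omega> - E\<bar> \<partial>M)"
    using iZ' by (intro nn_integral_eq_integral[symmetric]) auto
  finally show ?thesis unfolding E_def Z'_def .
qed

definition down_closed :: "real set \<Rightarrow> bool" where
  "down_closed D \<longleftrightarrow> (\<forall>b\<in>D. \<forall>a\<le>b. a \<in> D)"

text \<open>The coefficients are suprema over closed half-lines, whereas the level sets of a monotone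
function may have open, closed or infinite ends; this limit reaches the remaining cases.\<close>

lemma down_set_limit_of_half_lines:
  assumes "down_closed D"
  shows "\<exists>x::nat \<Rightarrow> real. \<forall>y. (\<lambda>n. indicator {..x n} y :: real) \<longlonglongrightarrow> indicator D y"
proof -
  consider "D = {}" | "D = UNIV" | s where "D = {..s}" | s where "D = {..<s}"
  proof (cases "D = {} \<or> D = UNIV")
    case False
    then obtain b where "b \<notin> D" by auto
    then have bdd: "bdd_above D" using assms unfolding down_closed_def by (intro bdd_aboveI[of _ b]) (metis linear)
    have le: "y \<le> Sup D" if "y \<in> D" for y using that bdd by (rule cSup_upper)
    have lt: "y \<in> D" if "y < Sup D" for y
      using less_cSupD[OF _ that] False assms unfolding down_closed_def by (meson less_imp_le)
    have "D = {..Sup D} \<or> D = {..<Sup D}"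
      using le lt by (cases "Sup D \<in> D") (auto simp: less_le)
    then show thesis using that by blast
  qed (use that in auto)
  then show ?thesis
  proof cases
    case 1
    have "(\<lambda>n. indicator {..- real n} y :: real) \<longlonglongrightarrow> 0" for y :: real
    proof -
      obtain N :: nat where "- y < real N" using reals_Archimedean2 by blast
      then show ?thesis
        by (intro tendsto_eventually eventually_sequentiallyI[of N]) (auto simp: indicator_def)
    qed
    then show ?thesis using 1 by (intro exI[of _ "\<lambda>n. - real n"]) simp
  next
    case 2
    have "(\<lambda>n. indicator {..real n} y :: real) \<longlonglongrightarrow> 1" for y :: real
    proof -
      obtain N :: nat where "y < real N" using reals_Archimedean2 by blast
      then show ?thesis
        by (intro tendsto_eventually eventually_sequentiallyI[of N]) (auto simp: indicator_def)
    qed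
    then show ?thesis using 2 by (intro exI[of _ real]) simp
  next
    case (3 s)
    then show ?thesis by (intro exI[of _ "\<lambda>_. s"]) simp
  next
    case (4 s)
    have "(\<lambda>n. indicator {..s - 1 / (real n + 1)} y :: real) \<longlonglongrightarrow> indicator {..<s} y" for y
    proof (cases "y < s")
      case True
      then obtain N :: nat where N: "1 / (s - y) < real N" using reals_Archimedean2 by blast
      have "y \<le> s - 1 / (real n + 1)" if "N \<le> n" for n
      proof -
        have "1 / (s - y) < real n + 1" using N that by (simp add: less_le_trans[OF N])
        then have "1 < (real n + 1) * (s - y)" using True by (simp add: divide_less_eq)
        then have "1 / (real n + 1) < s - y" by (simp add: divide_less_eq mult.commute)
        then show ?thesis by simp
      qed
      then show ?thesis using True
        by (intro tendsto_eventually eventually_sequentiallyI[of N]) (auto simp: indicator_def)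
    next
      case False
      then have "\<not> y \<le> s - 1 / (real n + 1)" for n
        by (smt (verit) divide_pos_pos of_nat_0_le_iff)
      then show ?thesis using False by (auto simp: indicator_def)
    qed
    then show ?thesis using 4 by (intro exI[of _ "\<lambda>n. s - 1 / (real n + 1)"]) simp
  qed
qed

lemma interval_difference_of_down_sets:
  fixes B :: "real set"
  assumes "is_interval B"
  obtains D1 D2 where "D1 \<subseteq> D2" "B = D2 - D1" "down_closed D1" "down_closed D2"
proof -
  define D2 where "D2 = {y. \<exists>b\<in>B. y \<le> b}"
  show thesis
  proof (rule that)
    have "a \<in> D2 - B" if b: "b \<in> D2 - B" "a \<le> b" for a b
    proof -
      obtain b' where b': "b' \<in> B" "b \<le> b'" using b by (auto simp: D2_def)
      then have "a \<le> b'" using b(2) by simp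
      then have "a \<in> D2" using b'(1) unfolding D2_def by blast
      moreover have "a \<notin> B" using assms b b' unfolding is_interval_1 by blast
      ultimately show ?thesis by blast
    qed
    then show "down_closed (D2 - B)" unfolding down_closed_def by blast
    have "B \<subseteq> D2" unfolding D2_def by blast
    then show "B = D2 - (D2 - B)" by blast
    have "a \<in> D2" if b: "b \<in> D2" "a \<le> b" for a b
    proof -
      obtain b' where b': "b' \<in> B" "b \<le> b'" using b by (auto simp: D2_def)
      then have "a \<le> b'" using b(2) by simp
      then show ?thesis using b'(1) unfolding D2_def by blast
    qed
    then show "down_closed D2" unfolding down_closed_def by blast
  qed blast
qed

lemma down_closed_borel: "down_closed D \<Longrightarrow> D \<in> sets borel"
  by (rule real_interval_borel_measurable) (auto simp: is_interval_1 down_closed_def)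

section \<open>The stationary sequence and its past\<close>

locale stationary_sequence = prob_space M for M :: "'a measure" +
  fixes F0 :: "'a measure" and T :: "'a \<Rightarrow> 'a" and Y0 :: "'a \<Rightarrow> real"
  assumes bij: "bij_betw T (space M) (space M)"
    and T_meas: "T \<in> measurable M M" and inv_meas: "the_inv_into (space M) T \<in> measurable M M"
    and preserving: "distr M M T = M"
    and subalg: "subalgebra M F0"
    and increasing: "sets F0 \<subseteq> (\<lambda>B. T -` B \<inter> space M) ` sets F0"
    and Y0_meas: "Y0 \<in> borel_measurable F0"
begin

abbreviation "\<tau> \<equiv> int_iterate (space M) T"

abbreviation "law \<equiv> distr M borel Y0"

definition "Y i = Y0 \<circ> \<tau> i"

abbreviation "\<alpha> \<equiv> alpha_coeff M F0 Y"

text \<open>This is the sigma-algebra \<open>T\<^sup>-\<^sup>l F0\<close>.\<close>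

definition "past l = vimage_algebra (space M) (\<tau> l) F0"

abbreviation "Tinv \<equiv> the_inv_into (space M) T"

lemma T_space: "\<omega> \<in> space M \<Longrightarrow> T \<omega> \<in> space M" "\<omega> \<in> space M \<Longrightarrow> Tinv \<omega> \<in> space M"
  using T_meas inv_meas by (auto dest: measurable_space)

lemma T_Tinv: "\<omega> \<in> space M \<Longrightarrow> T (Tinv \<omega>) = \<omega>" "\<omega> \<in> space M \<Longrightarrow> Tinv (T \<omega>) = \<omega>"
  using bij by (auto simp: bij_betw_def the_inv_into_f_f intro!: f_the_inv_into_f)

lemma shift_0: "\<tau> 0 \<omega> = \<omega>"
  by (simp add: int_iterate_def)

lemma shift_Suc: assumes "\<omega> \<in> space M" shows "\<tau> (i + 1) \<omega> = \<tau> i (T \<omega>)"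
proof -
  consider "i \<ge> 0" | "i = -1" | "i < -1" by linarith
  then show ?thesis
  proof cases
    case 1
    then have "nat (i + 1) = Suc (nat i)" by simp
    then show ?thesis using 1 by (simp add: int_iterate_def funpow_Suc_right del: funpow.simps)
  next
    case 2
    then show ?thesis using assms by (simp add: int_iterate_def T_Tinv)
  next
    case 3
    then have "nat (- i) = Suc (nat (- (i + 1)))" by simp
    then have "\<tau> i (T \<omega>) = (Tinv ^^ Suc (nat (- (i + 1)))) (T \<omega>)" using 3 by (simp add: int_iterate_def)
    also have "\<dots> = (Tinv ^^ nat (- (i + 1))) \<omega>"
      using assms by (simp add: funpow_Suc_right T_Tinv del: funpow.simps)
    finally show ?thesis using 3 by (simp add: int_iterate_def)
  qed
qed

lemma shift_pred: assumes "\<omega> \<in> space M" shows "\<tau> (i - 1) \<omega> = \<tau> i (Tinv \<omega>)"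
  using shift_Suc[OF T_space(2)[OF assms], of "i - 1"] assms by (simp add: T_Tinv)

lemma shift_add: assumes "\<omega> \<in> space M" shows "\<tau> i (\<tau> j \<omega>) = \<tau> (i + j) \<omega>"
proof -
  have sp: "\<omega> \<in> space M \<Longrightarrow> (T ^^ k) \<omega> \<in> space M" "\<omega> \<in> space M \<Longrightarrow> (Tinv ^^ k) \<omega> \<in> space M" for k \<omega>
    by (induction k) (auto simp: T_space)
  have 1: "\<tau> i ((T ^^ k) \<omega>) = \<tau> (i + int k) \<omega>" for i k
  proof (induction k arbitrary: i)
    case (Suc k)
    have "\<tau> i ((T ^^ Suc k) \<omega>) = \<tau> (i + 1) ((T ^^ k) \<omega>)" using sp(1)[OF assms] by (simp add: shift_Suc)
    then show ?case using Suc by (simp add: add.assoc)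
  qed simp
  have 2: "\<tau> i ((Tinv ^^ k) \<omega>) = \<tau> (i - int k) \<omega>" for i k
  proof (induction k arbitrary: i)
    case (Suc k)
    have "\<tau> i ((Tinv ^^ Suc k) \<omega>) = \<tau> (i - 1) ((Tinv ^^ k) \<omega>)" using sp(2)[OF assms] by (simp add: shift_pred)
    then show ?case using Suc by (simp add: algebra_simps)
  qed simp
  show ?thesis using 1[of i "nat j"] 2[of i "nat (- j)"] by (cases "0 \<le> j") (auto simp: int_iterate_def)
qed

lemma shift_measurable [measurable]: "\<tau> i \<in> measurable M M"
proof -
  have "f ^^ k \<in> measurable M M" if "f \<in> measurable M M" for f k
    using that by (induction k) (auto simp: id_def[symmetric] intro: measurable_comp)
  then show ?thesis using T_meas inv_meas by (auto simp: int_iterate_def[abs_def])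
qed

lemma shift_preserving: "distr M M (\<tau> i) = M"
proof -
  have *: "f ^^ k \<in> measurable M M \<and> distr M M (f ^^ k) = M" if "f \<in> measurable M M" "distr M M f = M" for f k
  proof (induction k)
    case 0
    show ?case by (simp add: id_def)
  next
    case (Suc k)
    then have "distr M M (f \<circ> (f ^^ k)) = distr (distr M M (f ^^ k)) M f"
      using that by (intro distr_distr[symmetric]) auto
    moreover have "f \<circ> (f ^^ k) \<in> measurable M M" using Suc that by (auto intro: measurable_comp)
    ultimately show ?case using Suc that by (simp only: funpow.simps)
  qed
  have "distr M M Tinv = distr (distr M M T) M Tinv" by (simp add: preserving)
  also have "\<dots> = distr M M (Tinv \<circ> T)" by (rule distr_distr[OF inv_meas T_meas])
  also have "\<dots> = distr M M (\<lambda>x. x)" by (rule distr_cong) (auto simp: T_Tinv)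
  also have "\<dots> = M" by simp
  finally have "distr M M Tinv = M" .
  then show ?thesis using *[OF T_meas preserving] *[OF inv_meas] by (auto simp: int_iterate_def[abs_def])
qed

lemma integral_shift:
  fixes f :: "'a \<Rightarrow> real"
  assumes "f \<in> borel_measurable M"
  shows "(\<integral>\<omega>. f (\<tau> i \<omega>) \<partial>M) = (\<integral>\<omega>. f \<omega> \<partial>M)"
  using integral_distr[OF shift_measurable assms, of i] by (simp add: shift_preserving)

lemma space_F0: "space F0 = space M"
  using subalg by (simp add: subalgebra_def)

lemma F0_into_M: "f \<in> measurable F0 N \<Longrightarrow> f \<in> measurable M N"
  by (rule measurable_from_subalg[OF subalg])

text \<open>The inclusion of \<open>F0\<close> in \<open>T\<^sup>-\<^sup>1 F0\<close> means that the images under \<open>T\<close> of sets of \<open>F0\<close> are in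
\<open>F0\<close>, and these are the preimages under the inverse of \<open>T\<close>.\<close>

lemma shift_back_measurable: assumes "i \<le> 0" shows "\<tau> i \<in> measurable F0 F0"
proof -
  have "Tinv \<in> measurable F0 F0"
  proof (rule measurableI)
    show "Tinv \<omega> \<in> space F0" if "\<omega> \<in> space F0" for \<omega> using that T_space by (simp add: space_F0)
    fix A assume A: "A \<in> sets F0"
    then obtain A' where A': "A' \<in> sets F0" "A = T -` A' \<inter> space M" using increasing by blast
    have "A' \<subseteq> space M" using sets.sets_into_space[OF A'(1)] by (simp add: space_F0)
    then have "Tinv -` A \<inter> space F0 = A'"
      using A'(2) T_Tinv T_space by (auto simp: space_F0)
    then show "Tinv -` A \<inter> space F0 \<in> sets F0" using A' by simp
  qed
  then have "Tinv ^^ k \<in> measurable F0 F0" for k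
    by (induction k) (auto simp: id_def[symmetric] intro: measurable_comp)
  then show ?thesis using assms by (cases "i = 0") (auto simp: int_iterate_def[abs_def])
qed

lemma Y_measurable [measurable]: "Y i \<in> borel_measurable M"
  unfolding Y_def using F0_into_M[OF Y0_meas] by (intro measurable_comp[OF shift_measurable])

lemma Y_past: assumes "j \<le> l" shows "Y j \<in> borel_measurable (past l)"
proof -
  have m: "\<tau> l \<in> measurable (past l) F0"
    unfolding past_def using measurable_space[OF shift_measurable]
    by (intro measurable_vimage_algebra1) (auto simp: space_F0)
  have "Y0 \<circ> (\<tau> (j - l) \<circ> \<tau> l) \<in> borel_measurable (past l)"
    using assms by (intro measurable_comp[OF measurable_comp[OF m shift_back_measurable] Y0_meas]) auto
  moreover have "Y0 \<circ> (\<tau> (j - l) \<circ> \<tau> l) \<in> borel_measurable (past l) \<longleftrightarrow> Y j \<in> borel_measurable (past l)"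
    by (intro measurable_cong) (auto simp: past_def Y_def shift_add)
  ultimately show ?thesis by simp
qed

lemma space_past: "space (past l) = space M"
  by (simp add: past_def)

text \<open>By stationarity, conditioning on the past at time \<open>l\<close> thus reduces to conditioning on \<open>F0\<close>.\<close>

lemma past_shift: assumes "\<xi> \<in> borel_measurable (past l)" shows "(\<lambda>\<omega>. \<xi> (\<tau> (- l) \<omega>)) \<in> borel_measurable F0"
proof -
  have "\<tau> (- l) \<in> measurable F0 (past l)"
    unfolding past_def
  proof (rule measurable_vimage_algebra2)
    show "\<tau> (- l) \<in> space F0 \<rightarrow> space M" using measurable_space[OF shift_measurable] by (auto simp: space_F0)
    have "(\<lambda>x. \<tau> l (\<tau> (- l) x)) \<in> measurable F0 F0 \<longleftrightarrow> (\<lambda>x. x) \<in> measurable F0 F0"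
      by (intro measurable_cong) (simp add: shift_add space_F0 shift_0)
    then show "(\<lambda>x. \<tau> l (\<tau> (- l) x)) \<in> measurable F0 F0" by simp
  qed
  then show ?thesis using assms by (rule measurable_compose)
qed

lemma past_into_M: assumes "\<xi> \<in> borel_measurable (past l)" shows "\<xi> \<in> borel_measurable M"
proof -
  have "(\<lambda>\<omega>. \<xi> (\<tau> (- l) (\<tau> l \<omega>))) \<in> borel_measurable M"
    using measurable_compose[OF shift_measurable F0_into_M[OF past_shift[OF assms]]] .
  also have "?this \<longleftrightarrow> \<xi> \<in> borel_measurable M"
    by (intro measurable_cong) (simp add: shift_add shift_0)
  finally show ?thesis .
qed

section \<open>Dependency coefficients tested on intervals\<close>

definition cind :: "real set \<Rightarrow> int \<Rightarrow> 'a \<Rightarrow> real" where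
  "cind B k \<omega> = indicator B (Y k \<omega>) - measure law B"

lemma cind_measurable [measurable]: "B \<in> sets borel \<Longrightarrow> cind B k \<in> borel_measurable M"
  unfolding cind_def[abs_def]
  by (rule borel_measurable_diff[OF measurable_compose[OF Y_measurable borel_measurable_indicator] borel_measurable_const])

lemma cind_past: "B \<in> sets borel \<Longrightarrow> j \<le> l \<Longrightarrow> cind B j \<in> borel_measurable (past l)"
  unfolding cind_def[abs_def]
  by (rule borel_measurable_diff[OF measurable_compose[OF Y_past borel_measurable_indicator] borel_measurable_const])

lemma Y0_M [measurable]: "Y0 \<in> borel_measurable M"
  by (rule F0_into_M[OF Y0_meas])

lemma prob_space_Y0: "prob_space law"
  by (rule prob_space_distr) simp

lemma integral_Y:
  fixes f :: "real \<Rightarrow> real"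
  assumes "f \<in> borel_measurable borel"
  shows "(\<integral>\<omega>. f (Y k \<omega>) \<partial>M) = (\<integral>\<omega>. f (Y0 \<omega>) \<partial>M)"
  unfolding Y_def comp_def by (rule integral_shift[OF measurable_compose[OF Y0_M assms]])

lemma integral_indicator_Y:
  assumes "B \<in> sets borel"
  shows "(\<integral>\<omega>. indicator B (Y k \<omega>) \<partial>M) = measure law B"
proof -
  have "(\<integral>\<omega>. indicator B (Y k \<omega>) \<partial>M) = (\<integral>\<omega>. (indicator B (Y0 \<omega>) :: real) \<partial>M)"
    by (rule integral_Y[of "indicator B"]) (use assms in simp)
  also have "\<dots> = (\<integral>y. indicator B y \<partial>law)"
    using assms by (intro integral_distr[symmetric]) auto
  finally show ?thesis using assms by simp
qed

lemma centered_indicator_eq: "B \<in> sets borel \<Longrightarrow> centered M (\<lambda>\<omega>. indicator B (Y k \<omega>)) = cind B k"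
  by (rule ext) (simp add: centered_def cind_def integral_indicator_Y)

lemma cind_bound: "\<bar>cind B k \<omega>\<bar> \<le> 1"
proof -
  interpret D: prob_space "law" by (rule prob_space_Y0)
  define m where "m = measure law B"
  have "0 \<le> m" "m \<le> 1" by (auto simp: m_def)
  moreover have "indicator B (Y k \<omega>) = (0::real) \<or> indicator B (Y k \<omega>) = (1::real)" by (simp add: indicator_def)
  ultimately show ?thesis unfolding cind_def m_def[symmetric] by linarith
qed

lemma cind_shift: "\<omega> \<in> space M \<Longrightarrow> cind B k (\<tau> l \<omega>) = cind B (k + l) \<omega>"
  by (simp add: cind_def Y_def shift_add)

text \<open>Each interval costs two down-sets, hence the factors 2 and 4 in the bounds for one interval
and for a pair of intervals.\<close>

lemma cind_interval:
  assumes "is_interval B"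
  obtains D1 D2 where "down_closed D1" "down_closed D2" "\<And>k \<omega>. cind B k \<omega> = cind D2 k \<omega> - cind D1 k \<omega>"
proof -
  interpret D: prob_space "law" by (rule prob_space_Y0)
  obtain D1 D2 where D: "D1 \<subseteq> D2" "B = D2 - D1" "down_closed D1" "down_closed D2"
    using interval_difference_of_down_sets[OF assms] by blast
  have "measure law B = measure law D2 - measure law D1"
    unfolding D(2) using D by (intro D.finite_measure_Diff) (auto intro: down_closed_borel)
  moreover have "indicator B y = indicator D2 y - (indicator D1 y :: real)" for y using D by (auto simp: indicator_def)
  ultimately have e: "cind B k \<omega> = cind D2 k \<omega> - cind D1 k \<omega>" for k \<omega> by (simp add: cind_def)
  show thesis by (rule that[OF D(3,4) e])
qed

lemma integrable_bounded:
  fixes f :: "'a \<Rightarrow> real"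
  assumes "f \<in> borel_measurable M" "\<And>\<omega>. \<bar>f \<omega>\<bar> \<le> C"
  shows "integrable M f"
  by (rule integrable_const_bound[where B=C]) (simp_all add: assms)

lemma integral_cind:
  assumes B: "B \<in> sets borel"
  shows "(\<integral>\<omega>. cind B k \<omega> \<partial>M) = 0"
proof -
  have "integrable M (\<lambda>\<omega>. indicator B (Y k \<omega>) :: real)"
    by (rule integrable_bounded[where C=1])
      (rule measurable_compose[OF Y_measurable borel_measurable_indicator[OF B]], simp add: indicator_def)
  then show ?thesis unfolding cind_def using integral_indicator_Y[OF B] by (simp add: prob_space)
qed

lemma alpha_coeff_Suc:
  assumes "n \<ge> 1" "\<kappa> \<ge> 1"
  shows "\<alpha> \<kappa> n = (MAX l\<in>{1..\<kappa>}. SUP i\<in>{i :: nat \<Rightarrow> int. int n \<le> i 1 \<and> mono_on {1..l} i}. alpha_vec M F0 l (\<lambda>j. Y (i j)))"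
  using assms by (simp add: alpha_coeff_def)

lemma alpha_vec_le_coeff:
  assumes n: "n \<ge> 1" and l: "1 \<le> l" "l \<le> \<kappa>" and i: "int n \<le> i 1" "mono_on {1..l} i"
  shows "alpha_vec M F0 l (\<lambda>j. Y (i j)) \<le> \<alpha> \<kappa> n"
proof -
  have "alpha_vec M F0 l (\<lambda>j. Y (i j)) \<le> (SUP i\<in>{i :: nat \<Rightarrow> int. int n \<le> i 1 \<and> mono_on {1..l} i}. alpha_vec M F0 l (\<lambda>j. Y (i j)))"
    using i by (intro SUP_upper) auto
  also have "\<dots> \<le> \<alpha> \<kappa> n"
    unfolding alpha_coeff_Suc[OF n order_trans[OF l]] using l by (intro Max_ge) auto
  finally show ?thesis .
qed

lemma alpha_coeff_antimono:
  assumes "1 \<le> m" "m \<le> n" "\<kappa> \<ge> 1"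
  shows "\<alpha> \<kappa> n \<le> \<alpha> \<kappa> m"
proof -
  have "alpha_vec M F0 l (\<lambda>j. Y (i j)) \<le> \<alpha> \<kappa> m"
    if "l \<in> {1..\<kappa>}" "int n \<le> i 1" "mono_on {1..l} i" for l i
    by (rule alpha_vec_le_coeff) (use that assms in auto)
  then show ?thesis using assms by (subst alpha_coeff_Suc) (auto intro!: Max.boundedI SUP_least)
qed

lemma duality_half_line:
  assumes n: "n \<ge> 1" and k: "int n \<le> k" and \<kappa>: "1 \<le> \<kappa>"
    and a: "\<alpha> \<kappa> n \<le> ennreal a" "0 \<le> a"
    and \<xi>: "\<xi> \<in> borel_measurable F0" "\<And>\<omega>. \<bar>\<xi> \<omega>\<bar> \<le> 1"
  shows "\<bar>\<integral>\<omega>. \<xi> \<omega> * cind {..x} k \<omega> \<partial>M\<bar> \<le> a"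
proof -
  have e: "centered_indicator_prod M 1 (\<lambda>j. Y k) (\<lambda>_. x) = cind {..x} k"
    by (auto simp: centered_indicator_prod_def centered_indicator_eq)
  have I: "integrable M (cind {..x} k)"
    using cind_bound by (intro integrable_bounded[where C=1]) auto
  have "ennreal \<bar>\<integral>\<omega>. \<xi> \<omega> * (cind {..x} k \<omega> - (\<integral>\<omega>'. cind {..x} k \<omega>' \<partial>M)) \<partial>M\<bar>
    \<le> (\<integral>\<^sup>+\<omega>. ennreal \<bar>real_cond_exp M F0 (cind {..x} k) \<omega> - (\<integral>\<omega>'. cind {..x} k \<omega>' \<partial>M)\<bar> \<partial>M)"
    by (rule cond_exp_duality[OF subalg \<xi> I])
  also have "\<dots> \<le> alpha_vec M F0 1 (\<lambda>j. Y k)"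
    unfolding alpha_vec_def by (rule SUP_upper2[of "\<lambda>_. x"]) (auto simp: e[simplified])
  also have "\<dots> \<le> ennreal a"
    by (rule order_trans[OF alpha_vec_le_coeff[OF n _ \<kappa>] a(1)]) (use k in \<open>auto intro: monotone_onI\<close>)
  finally show ?thesis using a(2) by (simp add: integral_cind)
qed

lemma duality_half_line_pair:
  assumes n: "n \<ge> 1" and jk: "int n \<le> j" "j \<le> k"
    and a: "\<alpha> 2 n \<le> ennreal a" "0 \<le> a"
    and \<xi>: "\<xi> \<in> borel_measurable F0" "\<And>\<omega>. \<bar>\<xi> \<omega>\<bar> \<le> 1"
  shows "\<bar>\<integral>\<omega>. \<xi> \<omega> * (cind {..x} j \<omega> * cind {..x'} k \<omega> - (\<integral>\<omega>'. cind {..x} j \<omega>' * cind {..x'} k \<omega>' \<partial>M)) \<partial>M\<bar> \<le> a"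
proof -
  define i where "i = (\<lambda>t::nat. if t = 1 then j else k)"
  define xx where "xx = (\<lambda>t::nat. if t = 1 then x else x')"
  define Z where "Z = (\<lambda>\<omega>. cind {..x} j \<omega> * cind {..x'} k \<omega>)"
  have e: "centered_indicator_prod M 2 (\<lambda>t. Y (i t)) xx = Z"
    by (auto simp: centered_indicator_prod_def centered_indicator_eq Z_def i_def xx_def numeral_2_eq_2)
  have I: "integrable M Z"
    using cind_bound[of "{..x}" j] cind_bound[of "{..x'}" k] unfolding Z_def
    by (intro integrable_bounded[where C=1]) (auto simp: abs_mult intro!: mult_le_one)
  have "ennreal \<bar>\<integral>\<omega>. \<xi> \<omega> * (Z \<omega> - (\<integral>\<omega>'. Z \<omega>' \<partial>M)) \<partial>M\<bar>
    \<le> (\<integral>\<^sup>+\<omega>. ennreal \<bar>real_cond_exp M F0 Z \<omega> - (\<integral>\<omega>'. Z \<omega>' \<partial>M)\<bar> \<partial>M)"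
    by (rule cond_exp_duality[OF subalg \<xi> I])
  also have "\<dots> \<le> alpha_vec M F0 2 (\<lambda>t. Y (i t))"
    unfolding alpha_vec_def by (rule SUP_upper2[of xx]) (auto simp: e)
  also have "\<dots> \<le> \<alpha> 2 n"
    using jk by (intro alpha_vec_le_coeff[OF n]) (auto simp: i_def monotone_on_def)
  also have "\<dots> \<le> ennreal a" by (rule a)
  finally show ?thesis using a(2) by (simp add: Z_def)
qed

lemma cind_tendsto:
  assumes "\<And>y. (\<lambda>n. indicator {..x n} y :: real) \<longlonglongrightarrow> indicator D y" "D \<in> sets borel"
  shows "(\<lambda>n. cind {..x n} k \<omega>) \<longlonglongrightarrow> cind D k \<omega>"
proof -
  have "(\<lambda>n. \<integral>\<omega>. indicator {..x n} (Y k \<omega>) \<partial>M) \<longlonglongrightarrow> (\<integral>\<omega>. (indicator D (Y k \<omega>) :: real) \<partial>M)"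
  proof (rule integral_dominated_convergence[where w="\<lambda>_. 1"])
    have m: "(\<lambda>\<omega>. indicator A (Y k \<omega>) :: real) \<in> borel_measurable M" if "A \<in> sets borel" for A
      by (rule measurable_compose[OF Y_measurable borel_measurable_indicator[OF that]])
    show "(\<lambda>\<omega>. indicator {..x n} (Y k \<omega>) :: real) \<in> borel_measurable M" for n by (rule m) simp
    show "(\<lambda>\<omega>. indicator D (Y k \<omega>) :: real) \<in> borel_measurable M" by (rule m[OF assms(2)])
  qed (use assms in \<open>auto simp: indicator_def\<close>)
  then show ?thesis
    unfolding cind_def using assms by (intro tendsto_diff) (auto simp: integral_indicator_Y)
qed

lemma duality_interval:
  assumes n: "n \<ge> 1" and k: "int n \<le> k" and \<kappa>: "1 \<le> \<kappa>"
    and a: "\<alpha> \<kappa> n \<le> ennreal a" "0 \<le> a"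
    and \<xi>: "\<xi> \<in> borel_measurable F0" "\<And>\<omega>. \<bar>\<xi> \<omega>\<bar> \<le> 1" and B: "is_interval B"
  shows "\<bar>\<integral>\<omega>. \<xi> \<omega> * cind B k \<omega> \<partial>M\<bar> \<le> 2 * a"
proof -
  have \<xi>M [measurable]: "\<xi> \<in> borel_measurable M" by (rule F0_into_M[OF \<xi>(1)])
  have bd: "\<bar>\<xi> \<omega> * cind D k \<omega>\<bar> \<le> 1" if "D \<in> sets borel" for D \<omega>
    using \<xi>(2)[of \<omega>] cind_bound[of D k \<omega>] by (auto simp: abs_mult intro!: mult_le_one)
  have down: "\<bar>\<integral>\<omega>. \<xi> \<omega> * cind D k \<omega> \<partial>M\<bar> \<le> a" if D: "down_closed D" for D
  proof -
    have Db: "D \<in> sets borel" by (rule down_closed_borel[OF D])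
    obtain x where x: "\<And>y. (\<lambda>n. indicator {..x n :: real} y :: real) \<longlonglongrightarrow> indicator D y"
      using down_set_limit_of_half_lines[OF D] by blast
    have "(\<lambda>n. \<integral>\<omega>. \<xi> \<omega> * cind {..x n} k \<omega> \<partial>M) \<longlonglongrightarrow> (\<integral>\<omega>. \<xi> \<omega> * cind D k \<omega> \<partial>M)"
      using bd Db cind_tendsto[OF x Db]
      by (intro integral_dominated_convergence[where w="\<lambda>_. 1"]) (auto intro!: tendsto_intros)
    then have "(\<lambda>n. \<bar>\<integral>\<omega>. \<xi> \<omega> * cind {..x n} k \<omega> \<partial>M\<bar>) \<longlonglongrightarrow> \<bar>\<integral>\<omega>. \<xi> \<omega> * cind D k \<omega> \<partial>M\<bar>" by (rule tendsto_rabs)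
    then show ?thesis
      by (rule LIMSEQ_le_const2) (use duality_half_line[OF n k \<kappa> a \<xi>] in auto)
  qed
  obtain D1 D2 where d1: "down_closed D1" and d2: "down_closed D2"
    and ce: "\<And>k \<omega>. cind B k \<omega> = cind D2 k \<omega> - cind D1 k \<omega>" using cind_interval[OF B] by blast
  have b12: "D1 \<in> sets borel" "D2 \<in> sets borel" using down_closed_borel[OF d1] down_closed_borel[OF d2] by auto
  have i12: "integrable M (\<lambda>\<omega>. \<xi> \<omega> * cind D k \<omega>)" if "D \<in> sets borel" for D
    using bd[OF that] that by (intro integrable_bounded[where C=1]) auto
  have "(\<integral>\<omega>. \<xi> \<omega> * cind B k \<omega> \<partial>M) = (\<integral>\<omega>. \<xi> \<omega> * cind D2 k \<omega> \<partial>M) - (\<integral>\<omega>. \<xi> \<omega> * cind D1 k \<omega> \<partial>M)"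
    unfolding ce right_diff_distrib using i12 b12 by (intro Bochner_Integration.integral_diff) auto
  then show ?thesis using down[OF d1] down[OF d2] by linarith
qed

text \<open>The functional of the two sets is bilinear in the centred indicators, so it splits into four
terms with down-sets; each is a limit of terms with half-lines, to which the definition of
the second order coefficient applies.\<close>

lemma duality_interval_pair:
  assumes n: "n \<ge> 1" and jk: "int n \<le> j" "j \<le> k"
    and a: "\<alpha> 2 n \<le> ennreal a" "0 \<le> a"
    and \<xi>: "\<xi> \<in> borel_measurable F0" "\<And>\<omega>. \<bar>\<xi> \<omega>\<bar> \<le> 1" and B: "is_interval B" "is_interval B'"
  shows "\<bar>\<integral>\<omega>. \<xi> \<omega> * (cind B j \<omega> * cind B' k \<omega> - (\<integral>\<omega>'. cind B j \<omega>' * cind B' k \<omega>' \<partial>M)) \<partial>M\<bar> \<le> 4 * a"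
proof -
  have \<xi>M [measurable]: "\<xi> \<in> borel_measurable M" by (rule F0_into_M[OF \<xi>(1)])
  have I\<xi>: "integrable M \<xi>" using \<xi>(2) by (intro integrable_bounded) auto
  define \<Psi> where "\<Psi> = (\<lambda>D D'. (\<integral>\<omega>. \<xi> \<omega> * (cind D j \<omega> * cind D' k \<omega>) \<partial>M)
      - (\<integral>\<omega>. \<xi> \<omega> \<partial>M) * (\<integral>\<omega>. cind D j \<omega> * cind D' k \<omega> \<partial>M))"
  have bd: "\<bar>cind D j \<omega> * cind D' k \<omega>\<bar> \<le> 1" if "D \<in> sets borel" "D' \<in> sets borel" for D D' \<omega>
    using cind_bound[of D j \<omega>] cind_bound[of D' k \<omega>] by (auto simp: abs_mult intro!: mult_le_one)
  have bd': "\<bar>\<xi> \<omega> * (cind D j \<omega> * cind D' k \<omega>)\<bar> \<le> 1" if "D \<in> sets borel" "D' \<in> sets borel" for D D' \<omega>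
    using \<xi>(2)[of \<omega>] bd[OF that, of \<omega>] by (subst abs_mult) (auto intro!: mult_le_one)
  have i1: "integrable M (\<lambda>\<omega>. cind D j \<omega> * cind D' k \<omega>)" if "D \<in> sets borel" "D' \<in> sets borel" for D D'
    using bd[OF that] that by (intro integrable_bounded[where C=1]) auto
  have i2: "integrable M (\<lambda>\<omega>. \<xi> \<omega> * (cind D j \<omega> * cind D' k \<omega>))" if "D \<in> sets borel" "D' \<in> sets borel" for D D'
    using bd'[OF that] that by (intro integrable_bounded[where C=1]) auto
  have \<Psi>: "(\<integral>\<omega>. \<xi> \<omega> * (cind D j \<omega> * cind D' k \<omega> - (\<integral>\<omega>'. cind D j \<omega>' * cind D' k \<omega>' \<partial>M)) \<partial>M) = \<Psi> D D'"
    if "D \<in> sets borel" "D' \<in> sets borel" for D D'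
    unfolding \<Psi>_def right_diff_distrib using i2[OF that] I\<xi> by (subst Bochner_Integration.integral_diff) auto
  have down: "\<bar>\<Psi> D D'\<bar> \<le> a" if D: "down_closed D" and D': "down_closed D'" for D D'
  proof -
    have Db: "D \<in> sets borel" "D' \<in> sets borel" using down_closed_borel[OF D] down_closed_borel[OF D'] by auto
    obtain x where x: "\<And>y. (\<lambda>n. indicator {..x n :: real} y :: real) \<longlonglongrightarrow> indicator D y"
      using down_set_limit_of_half_lines[OF D] by blast
    obtain x' where x': "\<And>y. (\<lambda>n. indicator {..x' n :: real} y :: real) \<longlonglongrightarrow> indicator D' y"
      using down_set_limit_of_half_lines[OF D'] by blast
    note lims = cind_tendsto[OF x Db(1)] cind_tendsto[OF x' Db(2)]
    have "(\<lambda>n. \<integral>\<omega>. \<xi> \<omega> * (cind {..x n} j \<omega> * cind {..x' n} k \<omega>) \<partial>M) \<longlonglongrightarrow> (\<integral>\<omega>. \<xi> \<omega> * (cind D j \<omega> * cind D' k \<omega>) \<partial>M)"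
      using bd' Db lims by (intro integral_dominated_convergence[where w="\<lambda>_. 1"]) (auto intro!: tendsto_intros)
    moreover have "(\<lambda>n. \<integral>\<omega>. cind {..x n} j \<omega> * cind {..x' n} k \<omega> \<partial>M) \<longlonglongrightarrow> (\<integral>\<omega>. cind D j \<omega> * cind D' k \<omega> \<partial>M)"
      using bd Db lims by (intro integral_dominated_convergence[where w="\<lambda>_. 1"]) (auto intro!: tendsto_intros)
    ultimately have "(\<lambda>n. \<bar>\<Psi> {..x n} {..x' n}\<bar>) \<longlonglongrightarrow> \<bar>\<Psi> D D'\<bar>" unfolding \<Psi>_def by (intro tendsto_intros)
    then show ?thesis
      by (rule LIMSEQ_le_const2) (use duality_half_line_pair[OF n jk a \<xi>] \<Psi> in auto)
  qed
  obtain D1 D2 where d1: "down_closed D1" and d2: "down_closed D2"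
    and ce: "\<And>k \<omega>. cind B k \<omega> = cind D2 k \<omega> - cind D1 k \<omega>" using cind_interval[OF B(1)] by blast
  obtain D1' D2' where d1': "down_closed D1'" and d2': "down_closed D2'"
    and ce': "\<And>k \<omega>. cind B' k \<omega> = cind D2' k \<omega> - cind D1' k \<omega>" using cind_interval[OF B(2)] by blast
  note b = down_closed_borel[OF d1] down_closed_borel[OF d2] down_closed_borel[OF d1'] down_closed_borel[OF d2']
  have Bb: "B \<in> sets borel" "B' \<in> sets borel" using B by (auto intro: real_interval_borel_measurable)
  have e: "\<Psi> B B' = \<Psi> D2 D2' - \<Psi> D2 D1' - \<Psi> D1 D2' + \<Psi> D1 D1'"
  proof -
    have p: "cind B j \<omega> * cind B' k \<omega> = cind D2 j \<omega> * cind D2' k \<omega> - cind D2 j \<omega> * cind D1' k \<omega>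
        - cind D1 j \<omega> * cind D2' k \<omega> + cind D1 j \<omega> * cind D1' k \<omega>" for \<omega>
      unfolding ce ce' by (simp add: algebra_simps)
    have q: "\<xi> \<omega> * (cind B j \<omega> * cind B' k \<omega>) = \<xi> \<omega> * (cind D2 j \<omega> * cind D2' k \<omega>) - \<xi> \<omega> * (cind D2 j \<omega> * cind D1' k \<omega>)
        - \<xi> \<omega> * (cind D1 j \<omega> * cind D2' k \<omega>) + \<xi> \<omega> * (cind D1 j \<omega> * cind D1' k \<omega>)" for \<omega>
      unfolding p by (simp add: algebra_simps)
    have "(\<integral>\<omega>. cind B j \<omega> * cind B' k \<omega> \<partial>M) = (\<integral>\<omega>. cind D2 j \<omega> * cind D2' k \<omega> \<partial>M) - (\<integral>\<omega>. cind D2 j \<omega> * cind D1' k \<omega> \<partial>M)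
        - (\<integral>\<omega>. cind D1 j \<omega> * cind D2' k \<omega> \<partial>M) + (\<integral>\<omega>. cind D1 j \<omega> * cind D1' k \<omega> \<partial>M)"
      unfolding p by (simp add: i1 b)
    moreover have "(\<integral>\<omega>. \<xi> \<omega> * (cind B j \<omega> * cind B' k \<omega>) \<partial>M) = (\<integral>\<omega>. \<xi> \<omega> * (cind D2 j \<omega> * cind D2' k \<omega>) \<partial>M)
        - (\<integral>\<omega>. \<xi> \<omega> * (cind D2 j \<omega> * cind D1' k \<omega>) \<partial>M)
        - (\<integral>\<omega>. \<xi> \<omega> * (cind D1 j \<omega> * cind D2' k \<omega>) \<partial>M) + (\<integral>\<omega>. \<xi> \<omega> * (cind D1 j \<omega> * cind D1' k \<omega>) \<partial>M)"
      unfolding q by (simp add: i2 b)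
    ultimately show ?thesis unfolding \<Psi>_def by (simp only: right_diff_distrib distrib_left)
  qed
  have "\<bar>x1 - x2 - x3 + x4\<bar> \<le> 4 * a" if "\<bar>x1\<bar> \<le> a" "\<bar>x2\<bar> \<le> a" "\<bar>x3\<bar> \<le> a" "\<bar>x4\<bar> \<le> a" for x1 x2 x3 x4 :: real
    using that by linarith
  from this[OF down[OF d2 d2'] down[OF d2 d1'] down[OF d1 d2'] down[OF d1 d1']]
  show ?thesis unfolding \<Psi>[OF Bb] e .
qed

end

section \<open>Covariances and variances of blocks\<close>

lemma coeff_inv_attained:
  assumes "coeff_inv a u = enat m"
  shows "a m \<le> ennreal u"
proof -
  let ?S = "{enat q | q. a q \<le> ennreal u}"
  have ne: "?S \<noteq> {}" using assms unfolding coeff_inv_def by (intro notI) (simp add: top_enat_def)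
  then obtain x where "x \<in> ?S" by blast
  then have "(LEAST x. x \<in> ?S) \<in> ?S" by (rule LeastI[of "\<lambda>x. x \<in> ?S"])
  then have "Inf ?S \<in> ?S" unfolding Inf_enat_def using ne by simp
  then show ?thesis using assms unfolding coeff_inv_def by auto
qed

lemma coeff_inv_antimono: "antimono (coeff_inv a)"
  unfolding coeff_inv_def
  by (intro antimonoI Inf_superset_mono) (auto intro: order_trans[OF _ ennreal_leI])

lemma abs_double_sum_le:
  fixes f :: "'b \<Rightarrow> 'c \<Rightarrow> real"
  shows "\<bar>\<Sum>p\<in>P. \<Sum>p'\<in>P'. f p p'\<bar> \<le> (\<Sum>p\<in>P. \<Sum>p'\<in>P'. \<bar>f p p'\<bar>)"
  by (rule order_trans[OF sum_abs sum_mono[OF sum_abs]])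

lemma ennreal_double_sum:
  fixes f :: "'b \<Rightarrow> 'c \<Rightarrow> real"
  assumes "\<And>p p'. 0 \<le> f p p'"
  shows "ennreal (\<Sum>p\<in>P. \<Sum>p'\<in>P'. f p p') = (\<Sum>p\<in>P. \<Sum>p'\<in>P'. ennreal (f p p'))"
  using assms by (simp add: sum_nonneg)

text \<open>Every lag occurs at most twice, to the left and to the right of \<open>j\<close>.\<close>

lemma sum_abs_difference_le:
  fixes F :: "nat \<Rightarrow> ennreal"
  assumes "j \<in> {1..q}"
  shows "(\<Sum>k=1..q. F (nat \<bar>int k - int j\<bar>)) \<le> 2 * (\<Sum>d<q. F d)"
proof -
  have "(\<Sum>k=1..q. F (nat \<bar>int k - int j\<bar>)) = (\<Sum>k\<in>{1..j}. F (nat \<bar>int k - int j\<bar>)) + (\<Sum>k\<in>{j<..q}. F (nat \<bar>int k - int j\<bar>))"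
    using assms by (subst sum.union_disjoint[symmetric]) (auto intro!: sum.cong)
  also have "(\<Sum>k\<in>{1..j}. F (nat \<bar>int k - int j\<bar>)) = (\<Sum>d\<in>(\<lambda>k. j - k) ` {1..j}. F d)"
    by (subst sum.reindex) (auto simp: inj_on_def intro!: sum.cong arg_cong[of _ _ F])
  also have "\<dots> \<le> (\<Sum>d<q. F d)" using assms by (intro sum_mono2) auto
  also have "(\<Sum>k\<in>{j<..q}. F (nat \<bar>int k - int j\<bar>)) = (\<Sum>d\<in>(\<lambda>k. k - j) ` {j<..q}. F d)"
    by (subst sum.reindex) (auto simp: inj_on_def intro!: sum.cong arg_cong[of _ _ F])
  also have "\<dots> \<le> (\<Sum>d<q. F d)" using assms by (intro sum_mono2) auto
  finally show ?thesis by (simp add: mult_2 add_mono)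
qed

context stationary_sequence
begin

text \<open>The cut at \<open>1/2\<close>, the coefficient at \<open>0\<close>, gives a real-valued function that at every lag,
\<open>0\<close> included, bounds covariances of indicators up to a factor 2 and is at most the
coefficient.\<close>

definition alpha1 :: "nat \<Rightarrow> real" where
  "alpha1 d = (if d = 0 \<or> \<alpha> 1 d \<ge> ennreal (1/2) then 1/2 else enn2real (\<alpha> 1 d))"

lemma alpha1_nonneg: "0 \<le> alpha1 d"
  by (simp add: alpha1_def)

lemma alpha1_le_half: "alpha1 d \<le> 1/2"
proof (cases "d = 0 \<or> \<alpha> 1 d \<ge> ennreal (1/2)")
  case False
  then have "\<alpha> 1 d \<le> ennreal (1/2)" by (meson linear)
  then have "enn2real (\<alpha> 1 d) \<le> 1/2" by (intro enn2real_leI) auto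
  then show ?thesis unfolding alpha1_def using False by (simp only: if_False)
qed (simp add: alpha1_def)

text \<open>This converts a sum over lags into the inverse of the coefficients: beyond the first index
where the coefficient is at most \<open>u\<close> no lag contributes.\<close>

lemma alpha1_count:
  assumes "0 \<le> u"
  shows "(\<Sum>d<q. of_bool (u < alpha1 d) :: ennreal) \<le> ennreal_of_enat (min (coeff_inv (\<alpha> 1) u) (enat q))"
proof -
  have "(\<Sum>d<q. of_bool (u < alpha1 d) :: ennreal) = of_nat (card {d. d < q \<and> u < alpha1 d})"
    by (simp add: of_bool_def sum.If_cases lessThan_def Collect_conj_eq)
  also have "\<dots> \<le> ennreal_of_enat (min (coeff_inv (\<alpha> 1) u) (enat q))"
  proof (cases "coeff_inv (\<alpha> 1) u")
    case (enat m)
    have "alpha1 d \<le> u" if "m \<le> d" for d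
    proof (cases "m = 0")
      case True
      then have "ennreal (1/2) \<le> ennreal u" using coeff_inv_attained[OF enat] by (simp add: alpha_coeff_def)
      from this[unfolded ennreal_le_iff[OF assms]] show ?thesis using alpha1_le_half[of d] by simp
    next
      case False
      have a: "\<alpha> 1 d \<le> ennreal u"
        using alpha_coeff_antimono[of m d 1] that False coeff_inv_attained[OF enat] by simp
      show ?thesis
      proof (cases "\<alpha> 1 d \<ge> ennreal (1/2)")
        case True
        then have "ennreal (1/2) \<le> ennreal u" using a by (rule order_trans)
        from this[unfolded ennreal_le_iff[OF assms]] show ?thesis using alpha1_le_half[of d] by simp
      next
        case F2: False
        have "enn2real (\<alpha> 1 d) \<le> enn2real (ennreal u)" using a by (intro enn2real_mono) auto
        then show ?thesis using F2 that False assms by (simp add: alpha1_def)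
      qed
    qed
    then have "d < m" if "u < alpha1 d" for d using that by (meson not_le)
    then have "{d. d < q \<and> u < alpha1 d} \<subseteq> {..<min m q}" by auto
    then have "card {d. d < q \<and> u < alpha1 d} \<le> min m q" using card_mono[of "{..<min m q}"] by simp
    then show ?thesis using enat by simp
  next
    case infinity
    have "card {d. d < q \<and> u < alpha1 d} \<le> card {..<q}" by (intro card_mono) auto
    then show ?thesis using infinity by simp
  qed
  finally show ?thesis .
qed

text \<open>The covariance of two events is at most either probability. The bound by the coefficient
uses the centred indicator at time \<open>0\<close>, which is \<open>F0\<close>-measurable, as test function. The
factor 2 also covers the cut of \<open>alpha1\<close> at \<open>1/2\<close>, because probabilities are at most 1.\<close>

lemma covariance_intervals:
  assumes B: "is_interval B" "is_interval B'"
  shows "\<bar>\<integral>\<omega>. cind B 0 \<omega> * cind B' (int d) \<omega> \<partial>M\<bar>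
    \<le> 2 * min (alpha1 d) (min (measure law B) (measure law B'))"
proof -
  interpret D: prob_space "law" by (rule prob_space_Y0)
  have Bb: "B \<in> sets borel" "B' \<in> sets borel" using B by (auto intro: real_interval_borel_measurable)
  define p where "p = measure law B"
  define p' where "p' = measure law B'"
  have p: "0 \<le> p" "p \<le> 1" "0 \<le> p'" "p' \<le> 1" by (auto simp: p_def p'_def)
  define A where "A = {\<omega>\<in>space M. Y 0 \<omega> \<in> B}"
  define A' where "A' = {\<omega>\<in>space M. Y (int d) \<omega> \<in> B'}"
  have m: "A \<in> sets M" "A' \<in> sets M"
    unfolding A_def A'_def using measurable_sets[OF Y_measurable Bb(1), of 0] measurable_sets[OF Y_measurable Bb(2), of "int d"]
    by (auto simp: vimage_def Int_def conj_commute)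
  have pA: "prob A = p" "prob A' = p'"
  proof -
    have *: "prob {\<omega>\<in>space M. Y k \<omega> \<in> C} = measure law C" if "{\<omega>\<in>space M. Y k \<omega> \<in> C} \<in> sets M" "C \<in> sets borel" for k C
    proof -
      have "prob {\<omega>\<in>space M. Y k \<omega> \<in> C} = (\<integral>\<omega>. indicator {\<omega>\<in>space M. Y k \<omega> \<in> C} \<omega> \<partial>M)" using that by simp
      also have "\<dots> = (\<integral>\<omega>. indicator C (Y k \<omega>) \<partial>M)"
        by (intro Bochner_Integration.integral_cong) (auto simp: indicator_def)
      also have "\<dots> = measure law C" by (rule integral_indicator_Y[OF that(2)])
      finally show ?thesis .
    qed
    show "prob A = p" "prob A' = p'" using * m Bb unfolding A_def A'_def p_def p'_def by auto
  qed
  have "(\<integral>\<omega>. cind B 0 \<omega> * cind B' (int d) \<omega> \<partial>M) = (\<integral>\<omega>. indicator (A \<inter> A') \<omega> - p * indicator A' \<omega> - p' * indicator A \<omega> + p * p' \<partial>M)"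
    by (intro Bochner_Integration.integral_cong) (auto simp: cind_def A_def A'_def p_def p'_def indicator_def algebra_simps)
  also have "\<dots> = prob (A \<inter> A') - p * p'"
    using m by (simp add: pA prob_space less_top[symmetric])
  finally have e: "(\<integral>\<omega>. cind B 0 \<omega> * cind B' (int d) \<omega> \<partial>M) = prob (A \<inter> A') - p * p'" .
  have "prob (A \<inter> A') \<le> min p p'" using m finite_measure_mono[of "A \<inter> A'" A] finite_measure_mono[of "A \<inter> A'" A'] by (simp add: pA)
  moreover have "p * p' \<le> min p p'" using p mult_left_le[of p' p] mult_left_le_one_le[of p' p] by simp
  moreover have "0 \<le> p * p'" using p by simp
  ultimately have c1: "\<bar>\<integral>\<omega>. cind B 0 \<omega> * cind B' (int d) \<omega> \<partial>M\<bar> \<le> min p p'"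
    unfolding e using measure_nonneg[of M "A \<inter> A'"] by linarith
  have c2: "\<bar>\<integral>\<omega>. cind B 0 \<omega> * cind B' (int d) \<omega> \<partial>M\<bar> \<le> 2 * alpha1 d"
  proof (cases "d = 0 \<or> \<alpha> 1 d \<ge> ennreal (1/2)")
    case True
    then show ?thesis using c1 p by (simp add: alpha1_def)
  next
    case False
    then have lt: "\<alpha> 1 d < ennreal (1/2)" "d \<noteq> 0" by auto
    have "\<alpha> 1 d \<le> ennreal (alpha1 d)"
      using lt by (cases "\<alpha> 1 d") (auto simp: alpha1_def)
    moreover have "cind B 0 \<in> borel_measurable F0"
    proof -
      have "Y 0 \<in> borel_measurable F0 \<longleftrightarrow> Y0 \<in> borel_measurable F0"
        by (intro measurable_cong) (simp add: Y_def shift_0)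
      then have "Y 0 \<in> borel_measurable F0" using Y0_meas by simp
      from borel_measurable_diff[OF measurable_compose[OF this borel_measurable_indicator[OF Bb(1)]] borel_measurable_const]
      show ?thesis unfolding cind_def[abs_def] .
    qed
    ultimately show ?thesis
      using lt by (intro duality_interval[where n=d and \<kappa>=1]) (auto simp: alpha1_nonneg cind_bound B)
  qed
  have "v \<le> 2 * min a m" if "v \<le> m" "v \<le> 2 * a" "0 \<le> m" for v a m :: real
    using that by (simp add: min_def)
  from this[OF c1 c2] show ?thesis using p unfolding p_def[symmetric] p'_def[symmetric] by simp
qed

end

text \<open>The truncated process. \<open>B p\<close> are the level intervals, \<open>c p\<close> their weights, \<open>K\<close> is the
truncation level, and \<open>profile\<close> is the control of the weights by the quantile function that
the step approximation provides.\<close>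

locale step_sequence = stationary_sequence +
  fixes P :: "'p set" and c :: "'p \<Rightarrow> real" and B :: "'p \<Rightarrow> real set" and K :: real and Q :: "real \<Rightarrow> ennreal"
  assumes finP: "finite P" and int: "\<And>p. p \<in> P \<Longrightarrow> is_interval (B p)"
    and csum: "(\<Sum>p\<in>P. \<bar>c p\<bar>) \<le> 2 * K"
    and profile: "\<And>u. 0 \<le> u \<Longrightarrow> (\<Sum>p\<in>P. ennreal \<bar>c p\<bar> * of_bool (u < measure law (B p))) \<le> 2 * Q u"
    and Q_meas [measurable]: "Q \<in> borel_measurable borel"
begin

definition X :: "int \<Rightarrow> 'a \<Rightarrow> real" where "X k \<omega> = (\<Sum>p\<in>P. c p * cind (B p) k \<omega>)"

lemma B_borel: "p \<in> P \<Longrightarrow> B p \<in> sets borel"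
  using int by (auto intro: real_interval_borel_measurable)

lemma K_nonneg: "0 \<le> K"
proof -
  have "0 \<le> (\<Sum>p\<in>P. \<bar>c p\<bar>)" by (intro sum_nonneg) simp
  then show ?thesis using csum by linarith
qed

lemma X_measurable [measurable]: "X k \<in> borel_measurable M"
  unfolding X_def[abs_def] using B_borel
  by (intro borel_measurable_sum borel_measurable_times borel_measurable_const cind_measurable)

lemma X_past: "k \<le> l \<Longrightarrow> X k \<in> borel_measurable (past l)"
  unfolding X_def[abs_def] using B_borel
  by (intro borel_measurable_sum borel_measurable_times borel_measurable_const cind_past)

lemma X_bound: "\<bar>X k \<omega>\<bar> \<le> 2 * K"
proof -
  have "\<bar>X k \<omega>\<bar> \<le> (\<Sum>p\<in>P. \<bar>c p\<bar> * \<bar>cind (B p) k \<omega>\<bar>)"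
    unfolding X_def by (rule order_trans[OF sum_abs]) (simp add: abs_mult)
  also have "\<dots> \<le> (\<Sum>p\<in>P. \<bar>c p\<bar> * 1)" by (intro sum_mono mult_left_mono cind_bound) auto
  finally show ?thesis using csum by simp
qed

lemma X_shift: "\<omega> \<in> space M \<Longrightarrow> X k (\<tau> l \<omega>) = X (k + l) \<omega>"
  by (simp add: X_def cind_shift)

lemma X_product_integral: "(\<integral>\<omega>. X j \<omega> * X k \<omega> \<partial>M) = (\<integral>\<omega>. X (j + l) \<omega> * X (k + l) \<omega> \<partial>M)"
proof -
  have "(\<integral>\<omega>. X j \<omega> * X k \<omega> \<partial>M) = (\<integral>\<omega>. X j (\<tau> l \<omega>) * X k (\<tau> l \<omega>) \<partial>M)"
    by (intro integral_shift[symmetric]) measurable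
  also have "\<dots> = (\<integral>\<omega>. X (j + l) \<omega> * X (k + l) \<omega> \<partial>M)"
    by (intro Bochner_Integration.integral_cong) (auto simp: X_shift)
  finally show ?thesis .
qed

lemma X_duality:
  assumes n: "n \<ge> 1" and a: "\<alpha> 2 n \<le> ennreal a" "0 \<le> a"
    and \<xi>: "\<xi> \<in> borel_measurable (past l)" "\<And>\<omega>. \<bar>\<xi> \<omega>\<bar> \<le> 1" and k: "l + int n \<le> k"
  shows "\<bar>\<integral>\<omega>. \<xi> \<omega> * X k \<omega> \<partial>M\<bar> \<le> 4 * K * a"
proof -
  have \<xi>M [measurable]: "\<xi> \<in> borel_measurable M" by (rule past_into_M[OF \<xi>(1)])
  define \<xi>' where "\<xi>' = (\<lambda>\<omega>. \<xi> (\<tau> (- l) \<omega>))"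
  have \<xi>': "\<xi>' \<in> borel_measurable F0" "\<And>\<omega>. \<bar>\<xi>' \<omega>\<bar> \<le> 1" unfolding \<xi>'_def using past_shift[OF \<xi>(1)] \<xi>(2) by auto
  have \<xi>'M [measurable]: "\<xi>' \<in> borel_measurable M" by (rule F0_into_M[OF \<xi>'(1)])
  have I: "integrable M (\<lambda>\<omega>. \<xi>' \<omega> * cind (B p) k' \<omega>)" if "p \<in> P" for p k'
  proof (rule integrable_bounded[where C=1])
    show "(\<lambda>\<omega>. \<xi>' \<omega> * cind (B p) k' \<omega>) \<in> borel_measurable M"
      using cind_measurable[OF B_borel[OF that]] by simp
    show "\<bar>\<xi>' \<omega> * cind (B p) k' \<omega>\<bar> \<le> 1" for \<omega>
      using \<xi>'(2)[of \<omega>] cind_bound[of "B p" k' \<omega>] unfolding abs_mult by (intro mult_le_one) auto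
  qed
  have "(\<integral>\<omega>. \<xi> \<omega> * X k \<omega> \<partial>M) = (\<integral>\<omega>. \<xi> (\<tau> (- l) \<omega>) * X k (\<tau> (- l) \<omega>) \<partial>M)"
    by (intro integral_shift[symmetric]) measurable
  also have "\<dots> = (\<integral>\<omega>. (\<Sum>p\<in>P. c p * (\<xi>' \<omega> * cind (B p) (k - l) \<omega>)) \<partial>M)"
    by (intro Bochner_Integration.integral_cong)
      (auto simp: X_shift X_def[of "k - l"] \<xi>'_def sum_distrib_left mult_ac)
  also have "\<dots> = (\<Sum>p\<in>P. c p * (\<integral>\<omega>. \<xi>' \<omega> * cind (B p) (k - l) \<omega> \<partial>M))"
    using I by (subst Bochner_Integration.integral_sum) (auto simp del: integrable_mult_right_iff intro!: integrable_mult_right)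
  finally have "\<bar>\<integral>\<omega>. \<xi> \<omega> * X k \<omega> \<partial>M\<bar> \<le> (\<Sum>p\<in>P. \<bar>c p\<bar> * \<bar>\<integral>\<omega>. \<xi>' \<omega> * cind (B p) (k - l) \<omega> \<partial>M\<bar>)"
    by (simp add: order_trans[OF sum_abs] abs_mult)
  also have "\<dots> \<le> (\<Sum>p\<in>P. \<bar>c p\<bar> * (2 * a))"
    by (intro sum_mono mult_left_mono duality_interval[OF n _ _ a \<xi>']) (use k int in auto)
  also have "\<dots> = (\<Sum>p\<in>P. \<bar>c p\<bar>) * (2 * a)" by (simp add: sum_distrib_right)
  also have "\<dots> \<le> 2 * K * (2 * a)" using csum a(2) by (intro mult_right_mono) auto
  finally show ?thesis by simp
qed

lemma integrable_cind_pair: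
  assumes "\<xi> \<in> borel_measurable M" "\<And>\<omega>. \<bar>\<xi> \<omega>\<bar> \<le> 1" "p \<in> P" "p' \<in> P"
  shows "integrable M (\<lambda>\<omega>. \<xi> \<omega> * (cind (B p) j \<omega> * cind (B p') k \<omega>))"
proof (rule integrable_bounded[where C="1 * (1 * 1)"])
  show "(\<lambda>\<omega>. \<xi> \<omega> * (cind (B p) j \<omega> * cind (B p') k \<omega>)) \<in> borel_measurable M"
    using assms cind_measurable[OF B_borel[OF assms(3)]] cind_measurable[OF B_borel[OF assms(4)]] by simp
  show "\<bar>\<xi> \<omega> * (cind (B p) j \<omega> * cind (B p') k \<omega>)\<bar> \<le> 1 * (1 * 1)" for \<omega>
    unfolding abs_mult by (intro mult_mono cind_bound assms) auto
qed

lemma X_pair_expansion: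
  assumes "\<xi> \<in> borel_measurable M" "\<And>\<omega>. \<bar>\<xi> \<omega>\<bar> \<le> 1"
  shows "(\<integral>\<omega>. \<xi> \<omega> * (X j \<omega> * X k \<omega>) \<partial>M)
    = (\<Sum>p\<in>P. \<Sum>p'\<in>P. c p * c p' * (\<integral>\<omega>. \<xi> \<omega> * (cind (B p) j \<omega> * cind (B p') k \<omega>) \<partial>M))"
proof -
  define Z where "Z = (\<lambda>p p' \<omega>. c p * c p' * (\<xi> \<omega> * (cind (B p) j \<omega> * cind (B p') k \<omega>)))"
  have I: "integrable M (Z p p')" if "p \<in> P" "p' \<in> P" for p p'
    unfolding Z_def using integrable_cind_pair[OF assms that] by (rule integrable_mult_right)
  have "X j \<omega> * X k \<omega> = (\<Sum>p\<in>P. \<Sum>p'\<in>P. (c p * cind (B p) j \<omega>) * (c p' * cind (B p') k \<omega>))" for \<omega>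
    unfolding X_def by (rule sum_product)
  then have "\<xi> \<omega> * (X j \<omega> * X k \<omega>) = (\<Sum>p\<in>P. \<Sum>p'\<in>P. Z p p' \<omega>)" for \<omega>
    by (simp only: sum_distrib_left Z_def mult_ac)
  then have "(\<integral>\<omega>. \<xi> \<omega> * (X j \<omega> * X k \<omega>) \<partial>M) = (\<Sum>p\<in>P. \<integral>\<omega>. (\<Sum>p'\<in>P. Z p p' \<omega>) \<partial>M)"
    using I by (simp add: Bochner_Integration.integral_sum)
  also have "\<dots> = (\<Sum>p\<in>P. \<Sum>p'\<in>P. \<integral>\<omega>. Z p p' \<omega> \<partial>M)"
    using I by (intro sum.cong refl Bochner_Integration.integral_sum) auto
  finally show ?thesis by (simp add: Z_def)
qed

text \<open>After a shift to \<open>F0\<close> the integral expands into pairs of intervals, each of which costs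
\<open>4 a\<close>; the weights of the pairs add up to at most \<open>(2 K)\<^sup>2\<close>. The coefficients refer to
ordered times, and a pair in the other order is covered by symmetry.\<close>

lemma X_pair_duality:
  assumes n: "n \<ge> 1" and a: "\<alpha> 2 n \<le> ennreal a" "0 \<le> a"
    and \<xi>: "\<xi> \<in> borel_measurable (past l)" "\<And>\<omega>. \<bar>\<xi> \<omega>\<bar> \<le> 1" and jk: "l + int n \<le> j" "l + int n \<le> k"
  shows "\<bar>(\<integral>\<omega>. \<xi> \<omega> * (X j \<omega> * X k \<omega>) \<partial>M) - (\<integral>\<omega>. \<xi> \<omega> \<partial>M) * (\<integral>\<omega>. X j \<omega> * X k \<omega> \<partial>M)\<bar> \<le> 16 * K\<^sup>2 * a"
proof -
  have \<xi>M [measurable]: "\<xi> \<in> borel_measurable M" by (rule past_into_M[OF \<xi>(1)])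
  define \<xi>' where "\<xi>' = (\<lambda>\<omega>. \<xi> (\<tau> (- l) \<omega>))"
  have \<xi>': "\<xi>' \<in> borel_measurable F0" "\<And>\<omega>. \<bar>\<xi>' \<omega>\<bar> \<le> 1" unfolding \<xi>'_def using past_shift[OF \<xi>(1)] \<xi>(2) by auto
  have \<xi>'M: "\<xi>' \<in> borel_measurable M" by (rule F0_into_M[OF \<xi>'(1)])
  have I\<xi>': "integrable M \<xi>'" using \<xi>'(2) \<xi>'M by (intro integrable_bounded) auto
  define Z where "Z = (\<lambda>p p' \<omega>. cind (B p) (j - l) \<omega> * cind (B p') (k - l) \<omega>)"
  have "(\<integral>\<omega>. \<xi> \<omega> * (X j \<omega> * X k \<omega>) \<partial>M) = (\<integral>\<omega>. \<xi> (\<tau> (- l) \<omega>) * (X j (\<tau> (- l) \<omega>) * X k (\<tau> (- l) \<omega>)) \<partial>M)"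
    by (intro integral_shift[symmetric]) measurable
  also have "\<dots> = (\<integral>\<omega>. \<xi>' \<omega> * (X (j - l) \<omega> * X (k - l) \<omega>) \<partial>M)"
    by (intro Bochner_Integration.integral_cong) (auto simp: X_shift \<xi>'_def)
  finally have 1: "(\<integral>\<omega>. \<xi> \<omega> * (X j \<omega> * X k \<omega>) \<partial>M) = (\<Sum>p\<in>P. \<Sum>p'\<in>P. c p * c p' * (\<integral>\<omega>. \<xi>' \<omega> * Z p p' \<omega> \<partial>M))"
    unfolding X_pair_expansion[OF \<xi>'M \<xi>'(2)] Z_def .
  have 2: "(\<integral>\<omega>. X j \<omega> * X k \<omega> \<partial>M) = (\<Sum>p\<in>P. \<Sum>p'\<in>P. c p * c p' * (\<integral>\<omega>. Z p p' \<omega> \<partial>M))"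
    using X_product_integral[of j k "- l"] X_pair_expansion[of "\<lambda>_. 1" "j - l" "k - l"] by (simp add: Z_def)
  have 3: "(\<integral>\<omega>. \<xi> \<omega> \<partial>M) = (\<integral>\<omega>. \<xi>' \<omega> \<partial>M)" unfolding \<xi>'_def by (rule integral_shift[symmetric]) simp
  define D where "D = (\<lambda>p p'. (\<integral>\<omega>. \<xi>' \<omega> * Z p p' \<omega> \<partial>M) - (\<integral>\<omega>. \<xi>' \<omega> \<partial>M) * (\<integral>\<omega>. Z p p' \<omega> \<partial>M))"
  have D: "\<bar>D p p'\<bar> \<le> 4 * a" if "p \<in> P" "p' \<in> P" for p p'
  proof -
    have "D p p' = (\<integral>\<omega>. \<xi>' \<omega> * (Z p p' \<omega> - (\<integral>\<omega>. Z p p' \<omega> \<partial>M)) \<partial>M)"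
      unfolding D_def right_diff_distrib Z_def using integrable_cind_pair[OF \<xi>'M \<xi>'(2) that] I\<xi>'
      by (subst Bochner_Integration.integral_diff) auto
    then show ?thesis
      using duality_interval_pair[OF n _ _ a \<xi>' int[OF that(1)] int[OF that(2)], of "j - l" "k - l"]
        duality_interval_pair[OF n _ _ a \<xi>' int[OF that(2)] int[OF that(1)], of "k - l" "j - l"] jk
      by (cases "j \<le> k") (simp_all add: Z_def mult.commute[of "cind (B p) _ _"])
  qed
  have "(\<integral>\<omega>. \<xi> \<omega> * (X j \<omega> * X k \<omega>) \<partial>M) - (\<integral>\<omega>. \<xi> \<omega> \<partial>M) * (\<integral>\<omega>. X j \<omega> * X k \<omega> \<partial>M) = (\<Sum>p\<in>P. \<Sum>p'\<in>P. c p * c p' * D p p')"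
    unfolding 1 2 3 sum_distrib_left sum_subtractf[symmetric] D_def by (simp add: algebra_simps)
  also have "\<bar>\<dots>\<bar> \<le> (\<Sum>p\<in>P. \<Sum>p'\<in>P. \<bar>c p * c p' * D p p'\<bar>)"
    by (rule abs_double_sum_le)
  also have "\<dots> \<le> (\<Sum>p\<in>P. \<Sum>p'\<in>P. \<bar>c p\<bar> * \<bar>c p'\<bar> * (4 * a))"
    using D by (intro sum_mono) (auto simp: abs_mult intro!: mult_left_mono)
  also have "\<dots> = (\<Sum>p\<in>P. \<bar>c p\<bar>) * (\<Sum>p\<in>P. \<bar>c p\<bar>) * (4 * a)"
    unfolding sum_product by (simp add: sum_distrib_right)
  also have "\<dots> \<le> (2 * K) * (2 * K) * (4 * a)"
    using csum a(2) K_nonneg by (intro mult_right_mono mult_mono sum_nonneg) auto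
  finally show ?thesis by (simp add: power2_eq_square)
qed

text \<open>The minimum of three nonnegative numbers is the integral over \<open>u\<close> of the product of the
indicators of \<open>u\<close> being below each of them. Inserting this for every pair of intervals turns
the double sum of covariance bounds into the integral of a square, and the weights of the
intervals of measure above \<open>u\<close> add up to at most \<open>2 min (Q u) K\<close>.\<close>

lemma X_covariance_nonneg_lag:
  "ennreal \<bar>\<integral>\<omega>. X 0 \<omega> * X (int d) \<omega> \<partial>M\<bar> \<le> 8 * (\<integral>\<^sup>+u\<in>{0..<alpha1 d}. (min (Q u) (ennreal K))\<^sup>2 \<partial>lborel)"
proof -
  define pr where "pr = (\<lambda>p. measure law (B p))"
  define G :: "'p \<Rightarrow> real \<Rightarrow> ennreal" where "G = (\<lambda>p u. ennreal \<bar>c p\<bar> * of_bool (u < pr p))"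
  have "(\<lambda>u. of_bool (u < t)) = (indicator {..<t} :: real \<Rightarrow> ennreal)" for t
    by (auto simp: indicator_def fun_eq_iff)
  then have Gm [measurable]: "G p \<in> borel_measurable borel" for p
    unfolding G_def by simp
  have "(\<integral>\<omega>. X 0 \<omega> * X (int d) \<omega> \<partial>M)
      = (\<Sum>p\<in>P. \<Sum>p'\<in>P. c p * c p' * (\<integral>\<omega>. cind (B p) 0 \<omega> * cind (B p') (int d) \<omega> \<partial>M))"
    using X_pair_expansion[of "\<lambda>_. 1" 0 "int d"] by simp
  also have "\<bar>\<dots>\<bar> \<le> (\<Sum>p\<in>P. \<Sum>p'\<in>P. \<bar>c p * c p' * (\<integral>\<omega>. cind (B p) 0 \<omega> * cind (B p') (int d) \<omega> \<partial>M)\<bar>)"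
    by (rule abs_double_sum_le)
  also have "\<dots> \<le> (\<Sum>p\<in>P. \<Sum>p'\<in>P. \<bar>c p\<bar> * \<bar>c p'\<bar> * (2 * min (alpha1 d) (min (pr p) (pr p'))))"
    using covariance_intervals int unfolding pr_def
    by (intro sum_mono) (auto simp: abs_mult intro!: mult_left_mono)
  finally have "ennreal \<bar>\<integral>\<omega>. X 0 \<omega> * X (int d) \<omega> \<partial>M\<bar>
      \<le> ennreal (\<Sum>p\<in>P. \<Sum>p'\<in>P. \<bar>c p\<bar> * \<bar>c p'\<bar> * (2 * min (alpha1 d) (min (pr p) (pr p'))))" by (rule ennreal_leI)
  also have "\<dots> = (\<Sum>p\<in>P. \<Sum>p'\<in>P. ennreal (\<bar>c p\<bar> * \<bar>c p'\<bar> * (2 * min (alpha1 d) (min (pr p) (pr p')))))"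
    using alpha1_nonneg by (intro ennreal_double_sum) (simp add: pr_def)
  also have "\<dots> = (\<Sum>p\<in>P. \<Sum>p'\<in>P. \<integral>\<^sup>+u. 2 * (G p u * G p' u * indicator {0..<alpha1 d} u) \<partial>lborel)"
  proof (intro sum.cong refl)
    fix p p'
    define m where "m = min (alpha1 d) (min (pr p) (pr p'))"
    have m: "0 \<le> m" using alpha1_nonneg by (simp add: m_def pr_def)
    have "(\<integral>\<^sup>+u. 2 * (G p u * G p' u * indicator {0..<alpha1 d} u) \<partial>lborel)
       = (\<integral>\<^sup>+u. ennreal (\<bar>c p\<bar> * \<bar>c p'\<bar> * 2) * indicator {0..<m} u \<partial>lborel)"
      by (intro nn_integral_cong) (auto simp: G_def indicator_def m_def ennreal_mult mult_ac)
    also have "\<dots> = ennreal (\<bar>c p\<bar> * \<bar>c p'\<bar> * 2) * ennreal m"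
      using m by (subst nn_integral_cmult_indicator) auto
    also have "\<dots> = ennreal (\<bar>c p\<bar> * \<bar>c p'\<bar> * 2 * m)"
      using m by (intro ennreal_mult[symmetric]) auto
    finally show "ennreal (\<bar>c p\<bar> * \<bar>c p'\<bar> * (2 * min (alpha1 d) (min (pr p) (pr p')))) =
       (\<integral>\<^sup>+u. 2 * (G p u * G p' u * indicator {0..<alpha1 d} u) \<partial>lborel)"
      unfolding m_def[symmetric] by (simp only: mult.assoc)
  qed
  also have "\<dots> = (\<Sum>p\<in>P. \<integral>\<^sup>+u. (\<Sum>p'\<in>P. 2 * (G p u * G p' u * indicator {0..<alpha1 d} u)) \<partial>lborel)"
    by (intro sum.cong refl nn_integral_sum[symmetric]) measurable
  also have "\<dots> = (\<integral>\<^sup>+u. (\<Sum>p\<in>P. \<Sum>p'\<in>P. 2 * (G p u * G p' u * indicator {0..<alpha1 d} u)) \<partial>lborel)"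
    by (intro nn_integral_sum[symmetric]) measurable
  also have "\<dots> = (\<integral>\<^sup>+u. 2 * ((\<Sum>p\<in>P. G p u)\<^sup>2 * indicator {0..<alpha1 d} u) \<partial>lborel)"
  proof (intro nn_integral_cong)
    fix u
    show "(\<Sum>p\<in>P. \<Sum>p'\<in>P. 2 * (G p u * G p' u * indicator {0..<alpha1 d} u)) = 2 * ((\<Sum>p\<in>P. G p u)\<^sup>2 * indicator {0..<alpha1 d} u)"
      unfolding power2_eq_square sum_product sum_distrib_left sum_distrib_right by (rule sum.swap)
  qed
  also have "\<dots> \<le> (\<integral>\<^sup>+u. 8 * ((min (Q u) (ennreal K))\<^sup>2 * indicator {0..<alpha1 d} u) \<partial>lborel)"
  proof (intro nn_integral_mono)
    fix u :: real
    show "2 * ((\<Sum>p\<in>P. G p u)\<^sup>2 * indicator {0..<alpha1 d} u) \<le> 8 * ((min (Q u) (ennreal K))\<^sup>2 * indicator {0..<alpha1 d} u)"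
    proof (cases "0 \<le> u \<and> u < alpha1 d")
      case True
      define s where "s = (\<Sum>p\<in>P. G p u)"
      have "s \<le> (\<Sum>p\<in>P. ennreal \<bar>c p\<bar> * 1)"
        unfolding s_def G_def by (intro sum_mono mult_left_mono) auto
      also have "\<dots> = ennreal (\<Sum>p\<in>P. \<bar>c p\<bar>)" by simp
      also have "\<dots> \<le> ennreal (2 * K)" using csum by (rule ennreal_leI)
      finally have "s \<le> 2 * ennreal K" using K_nonneg by (simp add: ennreal_mult)
      moreover have "s \<le> 2 * Q u" using profile[of u] True unfolding s_def G_def pr_def by simp
      ultimately have "s \<le> 2 * min (Q u) (ennreal K)" by (simp add: min_def)
      then have "s * s \<le> (2 * min (Q u) (ennreal K)) * (2 * min (Q u) (ennreal K))" by (intro mult_mono) auto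
      then have "2 * (s * s) \<le> 2 * ((2 * min (Q u) (ennreal K)) * (2 * min (Q u) (ennreal K)))" by (rule mult_left_mono) simp
      also have "\<dots> = (2 * (2 * 2)) * (min (Q u) (ennreal K) * min (Q u) (ennreal K))" by (simp only: mult_ac)
      finally show ?thesis using True unfolding s_def[symmetric] by (simp add: power2_eq_square)
    qed (auto simp: indicator_def)
  qed
  also have "\<dots> = 8 * (\<integral>\<^sup>+u\<in>{0..<alpha1 d}. (min (Q u) (ennreal K))\<^sup>2 \<partial>lborel)"
    by (intro nn_integral_cmult) measurable
  finally show ?thesis .
qed

lemma X_covariance:
  "ennreal \<bar>\<integral>\<omega>. X j \<omega> * X k \<omega> \<partial>M\<bar> \<le> 8 * (\<integral>\<^sup>+u\<in>{0..<alpha1 (nat \<bar>k - j\<bar>)}. (min (Q u) (ennreal K))\<^sup>2 \<partial>lborel)"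
proof (cases "j \<le> k")
  case True
  then show ?thesis using X_covariance_nonneg_lag[of "nat (k - j)"] X_product_integral[of j k "- j"] by simp
next
  case False
  have "(\<integral>\<omega>. X j \<omega> * X k \<omega> \<partial>M) = (\<integral>\<omega>. X 0 \<omega> * X (j - k) \<omega> \<partial>M)"
    using X_product_integral[of k j "- k"] by (simp add: mult.commute)
  then show ?thesis using False X_covariance_nonneg_lag[of "nat (j - k)"] by simp
qed

definition V :: "nat \<Rightarrow> ennreal" where
  "V q = (\<integral>\<^sup>+u\<in>{0..1}. ennreal_of_enat (min (coeff_inv (\<alpha> 1) u) (enat q)) * (min (Q u) (ennreal K))\<^sup>2 \<partial>lborel)"

text \<open>Summing the covariance bounds over the \<open>q\<^sup>2\<close> pairs of times gives each lag below \<open>q\<close> at most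
\<open>2 q\<close> times, and the sum over the lags is counted under the integral.\<close>

lemma block_variance:
  "ennreal (\<integral>\<omega>. (\<Sum>t=1..q. X (m + int t) \<omega>)\<^sup>2 \<partial>M) \<le> 16 * of_nat q * V q"
proof -
  define F where "F = (\<lambda>d. \<integral>\<^sup>+u\<in>{0..<alpha1 d}. (min (Q u) (ennreal K))\<^sup>2 \<partial>lborel)"
  have I: "integrable M (\<lambda>\<omega>. X j \<omega> * X k \<omega>)" for j k
  proof (rule integrable_bounded[where C="(2*K)*(2*K)"])
    show "\<bar>X j \<omega> * X k \<omega>\<bar> \<le> (2*K)*(2*K)" for \<omega>
      unfolding abs_mult using K_nonneg by (intro mult_mono X_bound) auto
  qed simp
  have "(\<integral>\<omega>. (\<Sum>t=1..q. X (m + int t) \<omega>)\<^sup>2 \<partial>M) = (\<Sum>s=1..q. \<Sum>t=1..q. \<integral>\<omega>. X (m + int s) \<omega> * X (m + int t) \<omega> \<partial>M)"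
    unfolding power2_eq_square sum_product using I
    by (simp add: Bochner_Integration.integral_sum Bochner_Integration.integrable_sum)
  also have "\<dots> \<le> (\<Sum>s=1..q. \<Sum>t=1..q. \<bar>\<integral>\<omega>. X (m + int s) \<omega> * X (m + int t) \<omega> \<partial>M\<bar>)"
    by (intro sum_mono) auto
  finally have "ennreal (\<integral>\<omega>. (\<Sum>t=1..q. X (m + int t) \<omega>)\<^sup>2 \<partial>M) \<le> ennreal (\<Sum>s=1..q. \<Sum>t=1..q. \<bar>\<integral>\<omega>. X (m + int s) \<omega> * X (m + int t) \<omega> \<partial>M\<bar>)"
    by (rule ennreal_leI)
  also have "\<dots> = (\<Sum>s=1..q. \<Sum>t=1..q. ennreal \<bar>\<integral>\<omega>. X (m + int s) \<omega> * X (m + int t) \<omega> \<partial>M\<bar>)"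
    by (rule ennreal_double_sum) simp
  also have "\<dots> \<le> (\<Sum>s=1..q. \<Sum>t=1..q. 8 * F (nat \<bar>int t - int s\<bar>))"
    unfolding F_def by (intro sum_mono order_trans[OF X_covariance]) simp
  also have "\<dots> = (\<Sum>s=1..q. 8 * (\<Sum>t=1..q. F (nat \<bar>int t - int s\<bar>)))" by (simp add: sum_distrib_left)
  also have "\<dots> \<le> (\<Sum>s=1..q. 8 * (2 * (\<Sum>d<q. F d)))"
    by (intro sum_mono mult_left_mono sum_abs_difference_le) auto
  also have "\<dots> = 16 * of_nat q * (\<Sum>d<q. F d)" 
  proof -
    have "8 * (2 * x) = 16 * x" for x :: ennreal by (simp add: mult.assoc[symmetric])
    then show ?thesis by (simp add: mult.left_commute mult.assoc)
  qed
  finally have le: "ennreal (\<integral>\<omega>. (\<Sum>t=1..q. X (m + int t) \<omega>)\<^sup>2 \<partial>M) \<le> 16 * of_nat q * (\<Sum>d<q. F d)" .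
  have "(\<Sum>d<q. F d) = (\<integral>\<^sup>+u. (\<Sum>d<q. (min (Q u) (ennreal K))\<^sup>2 * indicator {0..<alpha1 d} u) \<partial>lborel)"
    unfolding F_def by (intro nn_integral_sum[symmetric]) measurable
  also have "\<dots> \<le> V q"
    unfolding V_def
  proof (intro nn_integral_mono)
    fix u :: real
    show "(\<Sum>d<q. (min (Q u) (ennreal K))\<^sup>2 * indicator {0..<alpha1 d} u)
       \<le> ennreal_of_enat (min (coeff_inv (\<alpha> 1) u) (enat q)) * (min (Q u) (ennreal K))\<^sup>2 * indicator {0..1} u"
    proof (cases "0 \<le> u \<and> u \<le> 1")
      case True
      have "(\<Sum>d<q. (min (Q u) (ennreal K))\<^sup>2 * indicator {0..<alpha1 d} u) = (\<Sum>d<q. of_bool (u < alpha1 d)) * (min (Q u) (ennreal K))\<^sup>2"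
        unfolding sum_distrib_right using True by (intro sum.cong) (auto simp: indicator_def)
      also have "\<dots> \<le> ennreal_of_enat (min (coeff_inv (\<alpha> 1) u) (enat q)) * (min (Q u) (ennreal K))\<^sup>2"
        using alpha1_count[of u q] True by (intro mult_right_mono) auto
      finally show ?thesis using True by simp
    next
      case False
      have "indicator {0..<alpha1 d} u = (0::ennreal)" for d
        using False alpha1_le_half[of d] by (auto simp: indicator_def)
      then show ?thesis by simp
    qed
  qed
  finally have "(\<Sum>d<q. F d) \<le> V q" .
  then show ?thesis by (rule order_trans[OF le mult_left_mono]) simp
qed

end

section \<open>Deviations of the truncated sums\<close>

lemma sum_blocks:
  fixes f :: "nat \<Rightarrow> real"
  shows "(\<Sum>i=1..j*q. f i) = (\<Sum>b<j. \<Sum>t=1..q. f (b * q + t))"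
proof (induction j)
  case (Suc j)
  have "(\<Sum>i=1..Suc j*q. f i) = (\<Sum>i=1..j*q + q. f i)" by (simp add: add.commute)
  also have "\<dots> = (\<Sum>i=1..j*q. f i) + (\<Sum>i=j*q+1..j*q+q. f i)" by (rule sum.ub_add_nat) simp
  also have "(\<Sum>i=j*q+1..j*q+q. f i) = (\<Sum>t=1..q. f (j * q + t))"
    using sum.shift_bounds_cl_nat_ivl[of f 1 "j*q" q] by (simp add: add.commute)
  finally show ?case using Suc by simp
qed simp

lemma sum_parity:
  fixes W :: "nat \<Rightarrow> real"
  shows "(\<Sum>b<j. W b) = (\<Sum>i<(j + 1) div 2. W (2 * i)) + (\<Sum>i<j div 2. W (2 * i + 1))"
proof (induction j)
  case (Suc j)
  show ?case
  proof (cases "even j")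
    case True
    then obtain m where "j = 2 * m" by blast
    then show ?thesis using Suc by simp
  next
    case False
    then obtain m where "j = 2 * m + 1" using oddE by blast
    then show ?thesis using Suc by simp
  qed
qed simp

text \<open>Since \<open>a \<le> 1\<close>, each step adds at most \<open>b\<close>.\<close>

lemma affine_recursion_bound:
  fixes p :: "nat \<Rightarrow> real"
  assumes "p 0 \<le> 1" "\<And>j. j < J \<Longrightarrow> p (Suc j) \<le> a * p j + b" "0 \<le> a" "a \<le> 1" "0 \<le> b" "j \<le> J"
  shows "p j \<le> a ^ j + real j * b"
  using assms(6)
proof (induction j)
  case (Suc j)
  then have "p (Suc j) \<le> a * (a ^ j + real j * b) + b"
    using assms(2)[of j] mult_left_mono[of "p j" "a ^ j + real j * b" a] assms(3) by simp
  also have "\<dots> = a ^ Suc j + a * (real j * b) + b" by (simp add: algebra_simps)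
  also have "a * (real j * b) \<le> 1 * (real j * b)" using assms by (intro mult_right_mono) auto
  finally show ?case by (simp add: algebra_simps)
qed (use assms in simp)

context step_sequence
begin

text \<open>The level recursion for the blocks \<open>e, e + 2, e + 4, ...\<close>, with level spacing \<open>z = 8 y\<close>. The
conditioning at block \<open>i\<close> is on the past up to time \<open>(2 i + e) q - q\<close>: it contains the
earlier blocks of the same parity and lies more than \<open>q\<close> time units before the block. In the
assumption on \<open>V q\<close> the part of the variance due to \<open>u \<le> L\<close>, which is at most \<open>n y K L\<close>, is
separated from the main part \<open>v\<close>; it joins the error terms of the recursion.\<close>

lemma block_sums_deviation:
  fixes n q J e :: nat and y L v :: real
  defines "U \<equiv> \<lambda>i \<omega>. \<Sum>t=1..q. X (int ((2 * i + e) * q) + int t) \<omega>"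
  assumes q: "q \<ge> 1" and a: "\<alpha> 2 q \<le> ennreal L" "0 \<le> L"
    and y: "0 < y" "real q * K \<le> y" and v: "0 \<le> v"
    and V: "of_nat n * V q \<le> ennreal (v + real n * y * K * L)" and v1: "v / y\<^sup>2 \<le> 1" and n: "n \<ge> 1"
  shows "prob {\<omega>\<in>space M. \<exists>k\<le>n div q. \<bar>\<Sum>i<k. U i \<omega>\<bar> \<ge> real J * (8 * y)}
    \<le> (v / y\<^sup>2) ^ J + real J * ((2 + 8 * real J) * (real n * K * L / y))"
proof -
  define N where "N = n div q"
  define z where "z = 8 * y"
  define \<delta>1 where "\<delta>1 = 4 * real q * K * L"
  define \<delta>2 where "\<delta>2 = 16 * (real q)\<^sup>2 * K\<^sup>2 * L"
  define \<sigma>2 where "\<sigma>2 = enn2real (16 * of_nat q * V q)"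
  define p where "p = (\<lambda>j::nat. prob {\<omega>\<in>space M. \<exists>k\<le>N. \<bar>\<Sum>i<k. U i \<omega>\<bar> \<ge> real j * z})"
  define G where "G = (\<lambda>i::nat. past (int ((2 * i + e) * q) - int q))"
  define w where "w = real n * y * K * L"
  have K0: "0 \<le> K" by (rule K_nonneg)
  have w0: "0 \<le> w" using K0 a y by (simp add: w_def)
  have Nq: "real N * real q \<le> real n" unfolding N_def by (metis of_nat_le_iff of_nat_mult div_times_less_eq_dividend)
  have Vfin: "V q < \<infinity>"
  proof (rule ccontr)
    assume "\<not> V q < \<infinity>"
    then have "V q = \<infinity>" using less_top[of "V q"] by auto
    then show False using V n by (simp add: ennreal_mult_top top_unique)
  qed
  have \<sigma>e: "ennreal \<sigma>2 = 16 * of_nat q * V q"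
    unfolding \<sigma>2_def using Vfin by (intro ennreal_enn2real) (auto simp: ennreal_mult_less_top of_nat_less_top)
  have s0: "0 \<le> \<sigma>2" by (simp add: \<sigma>2_def)
  have N\<sigma>: "real N * \<sigma>2 \<le> 16 * (v + w)"
  proof -
    have "ennreal (real N * \<sigma>2) = of_nat N * (16 * of_nat q * V q)"
      unfolding \<sigma>e[symmetric] using s0 by (simp add: ennreal_mult ennreal_of_nat_eq_real_of_nat)
    also have "\<dots> = 16 * (of_nat (N * q) * V q)" by (simp add: mult_ac)
    also have "\<dots> \<le> 16 * (of_nat n * V q)"
      unfolding N_def by (intro mult_left_mono mult_right_mono) (auto simp: div_times_less_eq_dividend simp del: of_nat_mult)
    also have "\<dots> \<le> 16 * ennreal (v + w)" using V unfolding w_def by (intro mult_left_mono) auto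
    also have "\<dots> = ennreal (16 * (v + w))" using v w0 by (simp add: ennreal_mult)
    finally have "ennreal (real N * \<sigma>2) \<le> ennreal (16 * (v + w))" .
    moreover have "0 \<le> 16 * (v + w)" using v w0 by simp
    ultimately show ?thesis by (simp only: ennreal_le_iff)
  qed
  have Xint: "integrable M (\<lambda>\<omega>. \<xi> \<omega> * (X j \<omega> * X k \<omega>))" if "\<xi> \<in> borel_measurable M" "\<And>\<omega>. \<bar>\<xi> \<omega>\<bar> \<le> 1" for \<xi> :: "'a \<Rightarrow> real" and j k
  proof (rule integrable_bounded[where C="1 * ((2*K)*(2*K))"])
    show "\<bar>\<xi> \<omega> * (X j \<omega> * X k \<omega>)\<bar> \<le> 1 * ((2*K)*(2*K))" for \<omega>
      unfolding abs_mult using K0 that by (intro mult_mono X_bound) auto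
  qed (use that in simp)
  have Xint1: "integrable M (\<lambda>\<omega>. \<xi> \<omega> * X k \<omega>)" if "\<xi> \<in> borel_measurable M" "\<And>\<omega>. \<bar>\<xi> \<omega>\<bar> \<le> 1" for \<xi> :: "'a \<Rightarrow> real" and k
  proof (rule integrable_bounded[where C="1 * (2*K)"])
    show "\<bar>\<xi> \<omega> * X k \<omega>\<bar> \<le> 1 * (2*K)" for \<omega>
      unfolding abs_mult using K0 that by (intro mult_mono X_bound) auto
  qed (use that in simp)
  have rec: "p (Suc j) \<le> 4 / z\<^sup>2 * (real N * (\<sigma>2 * p j + \<delta>2 + 4 * (real j + 1) * z * \<delta>1))" for j
    unfolding p_def
  proof (rule exit_level_recursion[where G=G])
    show "0 < z" using y by (simp add: z_def)
    show "U i \<in> borel_measurable M" for i unfolding U_def by measurable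
    show "space (G i) = space M" for i by (simp add: G_def space_past)
    show "U k \<in> borel_measurable (G i)" if "k < i" for i k
      unfolding U_def G_def
    proof (intro borel_measurable_sum X_past)
      fix t assume t: "t \<in> {1..q}"
      have "(2 * k + e) * q + t + q \<le> (2 * k + e + 2) * q" using t by (simp add: algebra_simps)
      also have "\<dots> \<le> (2 * i + e) * q" using that by (intro mult_right_mono) auto
      finally have "int ((2 * k + e) * q + t + q) \<le> int ((2 * i + e) * q)" by (rule zle_int[THEN iffD2])
      then show "int ((2 * k + e) * q) + int t \<le> int ((2 * i + e) * q) - int q" by linarith
    qed
    show "\<bar>U i \<omega>\<bar> \<le> z / 2" for i \<omega>
    proof -
      have "\<bar>U i \<omega>\<bar> \<le> (\<Sum>t=1..q. 2 * K)" unfolding U_def by (intro order_trans[OF sum_abs] sum_mono X_bound)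
      also have "\<dots> = 2 * (real q * K)" by simp
      finally show ?thesis using y by (simp add: z_def)
    qed
    show "0 \<le> \<sigma>2" by (simp add: \<sigma>2_def)
    have gap: "int ((2 * i + e) * q) - int q + int q \<le> int ((2 * i + e) * q) + int t" for i t by simp
    {
      fix i and \<xi> :: "'a \<Rightarrow> real" assume \<xi>: "\<xi> \<in> borel_measurable (G i)" "\<And>\<omega>. \<bar>\<xi> \<omega>\<bar> \<le> 1"
      have \<xi>p: "\<xi> \<in> borel_measurable (past (int ((2 * i + e) * q) - int q))" using \<xi>(1) by (simp add: G_def)
      have \<xi>M: "\<xi> \<in> borel_measurable M" by (rule past_into_M[OF \<xi>p])
      have "(\<integral>\<omega>. \<xi> \<omega> * U i \<omega> \<partial>M) = (\<Sum>t=1..q. \<integral>\<omega>. \<xi> \<omega> * X (int ((2 * i + e) * q) + int t) \<omega> \<partial>M)"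
        unfolding U_def sum_distrib_left by (intro Bochner_Integration.integral_sum Xint1[OF \<xi>M \<xi>(2)])
      also have "\<bar>\<dots>\<bar> \<le> (\<Sum>t=1..q. 4 * K * L)"
        by (intro order_trans[OF sum_abs] sum_mono X_duality[OF q a \<xi>p \<xi>(2) gap])
      finally show "\<bar>\<integral>\<omega>. \<xi> \<omega> * U i \<omega> \<partial>M\<bar> \<le> \<delta>1" by (simp add: \<delta>1_def mult_ac)
    }
    {
      fix i and \<xi> :: "'a \<Rightarrow> real" assume \<xi>: "\<xi> \<in> borel_measurable (G i)" "\<And>\<omega>. 0 \<le> \<xi> \<omega> \<and> \<xi> \<omega> \<le> 1"
      have \<xi>1: "\<bar>\<xi> \<omega>\<bar> \<le> 1" for \<omega> using \<xi>(2)[of \<omega>] by simp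
      have \<xi>p: "\<xi> \<in> borel_measurable (past (int ((2 * i + e) * q) - int q))" using \<xi>(1) by (simp add: G_def)
      have \<xi>M: "\<xi> \<in> borel_measurable M" by (rule past_into_M[OF \<xi>p])
      define m where "m = int ((2 * i + e) * q)"
      have U2: "(U i \<omega>)\<^sup>2 = (\<Sum>s=1..q. \<Sum>t=1..q. X (m + int s) \<omega> * X (m + int t) \<omega>)" for \<omega>
        unfolding U_def m_def power2_eq_square sum_product ..
      have eU: "(\<integral>\<omega>. \<xi>' \<omega> * (U i \<omega>)\<^sup>2 \<partial>M) = (\<Sum>s=1..q. \<Sum>t=1..q. \<integral>\<omega>. \<xi>' \<omega> * (X (m + int s) \<omega> * X (m + int t) \<omega>) \<partial>M)"
        if "\<xi>' \<in> borel_measurable M" "\<And>\<omega>. \<bar>\<xi>' \<omega>\<bar> \<le> 1" for \<xi>' :: "'a \<Rightarrow> real"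
      proof -
        have "(\<integral>\<omega>. \<xi>' \<omega> * (U i \<omega>)\<^sup>2 \<partial>M) = (\<Sum>s=1..q. \<integral>\<omega>. (\<Sum>t=1..q. \<xi>' \<omega> * (X (m + int s) \<omega> * X (m + int t) \<omega>)) \<partial>M)"
          unfolding U2 sum_distrib_left
          by (intro Bochner_Integration.integral_sum Bochner_Integration.integrable_sum Xint[OF that])
        also have "\<dots> = (\<Sum>s=1..q. \<Sum>t=1..q. \<integral>\<omega>. \<xi>' \<omega> * (X (m + int s) \<omega> * X (m + int t) \<omega>) \<partial>M)"
          by (intro sum.cong refl Bochner_Integration.integral_sum Xint[OF that])
        finally show ?thesis .
      qed
      have E\<xi>: "0 \<le> (\<integral>\<omega>. \<xi> \<omega> \<partial>M)" using \<xi>(2) by (intro Bochner_Integration.integral_nonneg) auto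
      have EU: "(\<integral>\<omega>. (U i \<omega>)\<^sup>2 \<partial>M) \<le> \<sigma>2"
      proof -
        have "ennreal (\<integral>\<omega>. (U i \<omega>)\<^sup>2 \<partial>M) \<le> ennreal \<sigma>2" unfolding \<sigma>e U_def by (rule block_variance)
        then show ?thesis by (simp add: \<sigma>2_def ennreal_le_iff)
      qed
      have "(\<integral>\<omega>. \<xi> \<omega> * (U i \<omega>)\<^sup>2 \<partial>M) = (\<Sum>s=1..q. \<Sum>t=1..q. \<integral>\<omega>. \<xi> \<omega> * (X (m + int s) \<omega> * X (m + int t) \<omega>) \<partial>M)"
        by (rule eU[OF \<xi>M \<xi>1])
      also have "\<dots> \<le> (\<Sum>s=1..q. \<Sum>t=1..q. (\<integral>\<omega>. \<xi> \<omega> \<partial>M) * (\<integral>\<omega>. X (m + int s) \<omega> * X (m + int t) \<omega> \<partial>M) + 16 * K\<^sup>2 * L)"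
      proof (intro sum_mono)
        fix s t
        show "(\<integral>\<omega>. \<xi> \<omega> * (X (m + int s) \<omega> * X (m + int t) \<omega>) \<partial>M)
          \<le> (\<integral>\<omega>. \<xi> \<omega> \<partial>M) * (\<integral>\<omega>. X (m + int s) \<omega> * X (m + int t) \<omega> \<partial>M) + 16 * K\<^sup>2 * L"
          using X_pair_duality[OF q a \<xi>p \<xi>1 gap gap, of s t] unfolding m_def by linarith
      qed
      also have "\<dots> = (\<integral>\<omega>. \<xi> \<omega> \<partial>M) * (\<Sum>s=1..q. \<Sum>t=1..q. \<integral>\<omega>. X (m + int s) \<omega> * X (m + int t) \<omega> \<partial>M) + \<delta>2"
        by (simp add: sum.distrib sum_distrib_left \<delta>2_def power2_eq_square)
      also have "(\<Sum>s=1..q. \<Sum>t=1..q. \<integral>\<omega>. X (m + int s) \<omega> * X (m + int t) \<omega> \<partial>M) = (\<integral>\<omega>. (U i \<omega>)\<^sup>2 \<partial>M)"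
        using eU[of "\<lambda>_. 1"] by simp
      also have "(\<integral>\<omega>. \<xi> \<omega> \<partial>M) * (\<integral>\<omega>. (U i \<omega>)\<^sup>2 \<partial>M) \<le> (\<integral>\<omega>. \<xi> \<omega> \<partial>M) * \<sigma>2"
        by (rule mult_left_mono[OF EU E\<xi>])
      finally show "(\<integral>\<omega>. \<xi> \<omega> * (U i \<omega>)\<^sup>2 \<partial>M) \<le> \<sigma>2 * (\<integral>\<omega>. \<xi> \<omega> \<partial>M) + \<delta>2" by (simp add: mult.commute)
    }
  qed
  define b where "b = (2 + 8 * real J) * (real n * K * L / y)"
  have p01: "0 \<le> p j" "p j \<le> 1" for j by (auto simp: p_def)
  have N2: "real N * \<delta>2 \<le> 16 * w"
  proof -
    have "real N * \<delta>2 = 16 * ((real N * real q) * ((real q * K) * (K * L)))" by (simp add: \<delta>2_def power2_eq_square)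
    also have "\<dots> \<le> 16 * (real n * (y * (K * L)))"
      using Nq y K0 a by (intro mult_left_mono mult_mono) auto
    finally show ?thesis by (simp add: w_def mult_ac)
  qed
  have N1: "real N * \<delta>1 \<le> 4 * (real n * K * L)"
  proof -
    have "real N * \<delta>1 = 4 * ((real N * real q) * (K * L))" by (simp add: \<delta>1_def)
    also have "\<dots> \<le> 4 * (real n * (K * L))"
      using Nq K0 a by (intro mult_left_mono mult_right_mono) auto
    finally show ?thesis by (simp add: mult_ac)
  qed
  have rec': "p (Suc j) \<le> (v / y\<^sup>2) * p j + b" if j: "j < J" for j
  proof -
    let ?B = "real N * (\<sigma>2 * p j + \<delta>2 + 4 * (real j + 1) * z * \<delta>1)"
    have "?B
      = real N * \<sigma>2 * p j + real N * \<delta>2 + 4 * (real j + 1) * z * (real N * \<delta>1)" by (simp add: algebra_simps)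
    also have "\<dots> \<le> 16 * (v + w) * p j + 16 * w + 4 * real J * z * (4 * (real n * K * L))"
    proof (intro add_mono N2)
      show "real N * \<sigma>2 * p j \<le> 16 * (v + w) * p j" by (rule mult_right_mono[OF N\<sigma> p01(1)])
      have "4 * (real j + 1) * z \<le> 4 * real J * z" using j y by (intro mult_right_mono) (auto simp: z_def)
      then show "4 * (real j + 1) * z * (real N * \<delta>1) \<le> 4 * real J * z * (4 * (real n * K * L))"
        by (rule mult_mono[OF _ N1]) (use y K0 a in \<open>auto simp: z_def \<delta>1_def\<close>)
    qed
    also have "\<dots> \<le> 16 * v * p j + 16 * w * 1 + 16 * w + 128 * real J * w"
    proof -
      have "w * p j \<le> w * 1" using w0 p01 by (intro mult_left_mono) auto
      then show ?thesis by (simp add: algebra_simps z_def w_def)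
    qed
    finally have "4 / z\<^sup>2 * (?B)
      \<le> 4 / z\<^sup>2 * (16 * v * p j + 16 * w * 1 + 16 * w + 128 * real J * w)"
      by (intro mult_left_mono) auto
    also have "\<dots> = (v / y\<^sup>2) * p j + b"
      using y by (simp add: z_def w_def b_def power2_eq_square field_simps)
    finally show ?thesis using rec[of j] by linarith
  qed
  have "p J \<le> (v / y\<^sup>2) ^ J + real J * b"
    using v y v1 K0 a p01 by (intro affine_recursion_bound[where p=p, OF _ rec']) (auto simp: b_def)
  then show ?thesis by (simp add: p_def N_def z_def b_def)
qed

text \<open>The partial sum up to \<open>k\<close> differs from that up to the last complete block by less than \<open>q\<close>
terms, hence by at most \<open>2 y\<close>. So if it reaches \<open>32 J y\<close>, the even or the odd block sums
reach \<open>8 J y\<close>.\<close>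

lemma partial_sums_deviation:
  fixes n q J :: nat and y L v :: real
  assumes q: "q \<ge> 1" and a: "\<alpha> 2 q \<le> ennreal L" "0 \<le> L"
    and y: "0 < y" "real q * K \<le> y" and v: "0 \<le> v"
    and V: "of_nat n * V q \<le> ennreal (v + real n * y * K * L)" and v1: "v / y\<^sup>2 \<le> 1" and n: "n \<ge> 1" and J: "J \<ge> 1"
  shows "prob {\<omega>\<in>space M. \<exists>k\<in>{1..n}. \<bar>\<Sum>i=1..k. X (int i) \<omega>\<bar> \<ge> 32 * real J * y}
    \<le> 2 * ((v / y\<^sup>2) ^ J + real J * ((2 + 8 * real J) * (real n * K * L / y)))"
  (is "prob ?E \<le> 2 * ?b")
proof -
  define U where "U = (\<lambda>e i \<omega>. \<Sum>t=1..q. X (int ((2 * i + e) * q) + int t) \<omega>)"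
  define N where "N = n div q"
  define E where "E = (\<lambda>e. {\<omega>\<in>space M. \<exists>k\<le>N. \<bar>\<Sum>i<k. U e i \<omega>\<bar> \<ge> real J * (8 * y)})"
  have EM: "E e \<in> sets M" for e
  proof -
    have [measurable]: "U e i \<in> borel_measurable M" for i unfolding U_def by measurable
    have "{\<omega>\<in>space M. \<exists>k\<in>{..N}. \<bar>\<Sum>i<k. U e i \<omega>\<bar> \<ge> real J * (8 * y)} \<in> sets M" by measurable
    then show ?thesis by (simp add: E_def Bex_def)
  qed
  have "?E \<subseteq> E 0 \<union> E 1"
  proof clarify
    fix \<omega> k assume \<omega>: "\<omega> \<in> space M" "\<omega> \<notin> E 1" and k: "k \<in> {1..n}" and big: "\<bar>\<Sum>i=1..k. X (int i) \<omega>\<bar> \<ge> 32 * real J * y"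
    define j where "j = k div q"
    have jN: "j \<le> N" unfolding j_def N_def using k by (intro div_le_mono) auto
    have kj: "k = j * q + k mod q" by (simp add: j_def)
    have "(\<Sum>i=1..k. X (int i) \<omega>) = (\<Sum>i=1..j*q + k mod q. X (int i) \<omega>)" using kj by simp
    also have "\<dots> = (\<Sum>i=1..j*q. X (int i) \<omega>) + (\<Sum>i=j*q+1..j*q+k mod q. X (int i) \<omega>)" by (rule sum.ub_add_nat) simp
    finally have s1: "(\<Sum>i=1..k. X (int i) \<omega>) = (\<Sum>i=1..j*q. X (int i) \<omega>) + (\<Sum>i=j*q+1..j*q+k mod q. X (int i) \<omega>)" .
    have "\<bar>\<Sum>i=j*q+1..j*q+k mod q. X (int i) \<omega>\<bar> \<le> (\<Sum>i=j*q+1..j*q+k mod q. 2 * K)"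
      by (intro order_trans[OF sum_abs] sum_mono X_bound)
    also have "\<dots> = 2 * (real (k mod q) * K)" by simp
    also have "\<dots> \<le> 2 * (real q * K)" using K_nonneg q by (intro mult_left_mono mult_right_mono) auto
    finally have s2: "\<bar>\<Sum>i=j*q+1..j*q+k mod q. X (int i) \<omega>\<bar> \<le> 2 * y" using y by linarith
    have s3: "(\<Sum>i=1..j*q. X (int i) \<omega>) = (\<Sum>i<(j + 1) div 2. U 0 i \<omega>) + (\<Sum>i<j div 2. U 1 i \<omega>)"
      unfolding sum_blocks sum_parity[where j=j] U_def by simp
    have Jy: "y \<le> real J * y" using J y by simp
    have "8 * t \<le> \<bar>a\<bar> \<or> 8 * t \<le> \<bar>b\<bar>"
      if "32 * t \<le> \<bar>a + b + r\<bar>" "\<bar>r\<bar> \<le> 2 * y" "y \<le> t" for t a b r :: real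
      using that y(1) by linarith
    from this[of "real J * y", OF _ s2 Jy]
    have "\<bar>\<Sum>i<(j + 1) div 2. U 0 i \<omega>\<bar> \<ge> 8 * (real J * y) \<or> \<bar>\<Sum>i<j div 2. U 1 i \<omega>\<bar> \<ge> 8 * (real J * y)"
      using big unfolding s1 s3 by (simp only: mult.assoc)
    moreover have "(j + 1) div 2 \<le> N" "j div 2 \<le> N" using jN by auto
    ultimately have "\<omega> \<in> E 0 \<or> \<omega> \<in> E 1" unfolding E_def using \<omega>(1) by (auto simp: mult_ac)
    then show "\<omega> \<in> E 0" using \<omega>(2) by blast
  qed
  then have "prob ?E \<le> prob (E 0 \<union> E 1)"
    using EM by (intro finite_measure_mono) auto
  also have "\<dots> \<le> prob (E 0) + prob (E 1)" using EM by (intro measure_Un_le)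
  also have "\<dots> \<le> ?b
      + ?b"
    unfolding E_def U_def N_def by (intro add_mono block_sums_deviation[OF q a y v V v1 n])
  also have "\<dots> = 2 * ?b" by simp
  finally show ?thesis .
qed

end

section \<open>The truncation level\<close>

lemma R_fun_antimono: "antimono (R_fun (coeff_inv a) (quantile_fun H) n)"
proof (rule antimonoI)
  fix u v :: real assume "u \<le> v"
  then have "coeff_inv a v \<le> coeff_inv a u" "quantile_fun H v \<le> quantile_fun H u"
    using coeff_inv_antimono[of a] quantile_fun_antimono[of H] by (auto dest: antimonoD)
  then show "R_fun (coeff_inv a) (quantile_fun H) n v \<le> R_fun (coeff_inv a) (quantile_fun H) n u"
    unfolding R_fun_def by (intro mult_mono) (auto simp: min_le_iff_disj min_def)
qed

text \<open>Right-continuity of \<open>R\<close>, in the form needed to see that the infimum \<open>L\<close> is attained. The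
integer factor does not decrease just to the right of \<open>L\<close>, as finitely many coefficients
exceed \<open>L\<close> strictly; and for \<open>t < Q L\<close> one has \<open>H t > L\<close>, while \<open>Q \<ge> t\<close> to the left of
\<open>H t\<close>.\<close>

lemma R_fun_right_lower_bound:
  assumes H: "tail_function H" and L: "0 \<le> L" and y: "0 \<le> y"
    and gt: "ennreal y < R_fun (coeff_inv a) (quantile_fun H) n L"
  shows "\<exists>d>0. \<forall>u. u < L + d \<longrightarrow> ennreal y < R_fun (coeff_inv a) (quantile_fun H) n u"
proof -
  define Q where "Q = quantile_fun H"
  obtain m where m: "min (coeff_inv a L) (enat n) = enat m"
    using enat_ile[of "min (coeff_inv a L) (enat n)" n] by auto
  then have Rm: "ennreal y < of_nat m * Q L" using gt by (simp add: R_fun_def Q_def)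
  have m0: "m > 0" using Rm by (cases m) auto
  have "ennreal (y / real m) < Q L"
  proof (rule ccontr)
    assume "\<not> ennreal (y / real m) < Q L"
    then have "of_nat m * Q L \<le> of_nat m * ennreal (y / real m)" by (intro mult_left_mono) auto
    also have "\<dots> = ennreal y"
      using m0 y by (simp add: ennreal_of_nat_eq_real_of_nat ennreal_mult[symmetric])
    finally show False using Rm by simp
  qed
  then obtain w where w: "ennreal (y / real m) < w" "w < Q L" using dense by blast
  then obtain t where t: "w = ennreal t" "0 \<le> t" by (cases w) auto
  have yt: "y / real m < t" using w(1) t y m0 by (simp add: ennreal_less_iff)
  have HL: "L < H t"
  proof (rule ccontr)
    assume "\<not> L < H t"
    then have "Q L \<le> ennreal t" unfolding Q_def quantile_fun_def using t(2) by (intro Inf_lower) auto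
    then show False using w(2) t(1) by simp
  qed
  have am: "ennreal L < a j" if "j < m" for j
  proof (rule ccontr)
    assume "\<not> ennreal L < a j"
    then have "coeff_inv a L \<le> enat j" unfolding coeff_inv_def by (intro Inf_lower) auto
    moreover have "enat m \<le> coeff_inv a L" using m by (metis min.cobounded1)
    ultimately have "enat m \<le> enat j" by (meson order_trans)
    then show False using that by simp
  qed
  have "\<exists>d>0. \<forall>j<k. \<forall>u<L + d. ennreal u < a j" if "k \<le> m" for k
    using that
  proof (induction k)
    case 0
    show ?case by (intro exI[of _ 1]) simp
  next
    case (Suc k)
    then obtain d where d: "0 < d" "\<forall>j<k. \<forall>u<L + d. ennreal u < a j" by auto
    have "\<exists>e>0. \<forall>u<L + e. ennreal u < a k"
    proof (cases "a k")
      case (real b)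
      then have "L < b" using am[of k] Suc.prems L by (simp add: ennreal_less_iff)
      then show ?thesis using real L by (intro exI[of _ "b - L"]) (auto intro!: ennreal_lessI)
    next
      case top
      then show ?thesis by (intro exI[of _ 1]) auto
    qed
    then obtain e where e: "0 < e" "\<forall>u<L + e. ennreal u < a k" by blast
    show ?case
    proof (intro exI[of _ "min d e"] conjI allI impI)
      fix j u assume j: "j < Suc k" and u: "u < L + min d e"
      have "u < L + d" "u < L + e" using u by simp_all
      then show "ennreal u < a j" using d(2) e(2) j by (cases "j = k") auto
    qed (use d(1) e(1) in simp)
  qed
  then obtain d where d: "0 < d" "\<And>j u. j < m \<Longrightarrow> u < L + d \<Longrightarrow> ennreal u < a j" by blast
  have "ennreal y < R_fun (coeff_inv a) (quantile_fun H) n u" if u: "u < L + min d (H t - L)" for u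
  proof -
    have "enat m \<le> coeff_inv a u"
      unfolding coeff_inv_def
    proof (rule Inf_greatest, clarify)
      fix j assume "a j \<le> ennreal u"
      then have "\<not> ennreal u < a j" by simp
      moreover have "u < L + d" using u by simp
      ultimately have "\<not> j < m" using d(2) by blast
      then show "enat m \<le> enat j" by simp
    qed
    moreover have "enat m \<le> enat n" using m by (metis min.cobounded2)
    ultimately have "ennreal_of_enat (enat m) \<le> ennreal_of_enat (min (coeff_inv a u) (enat n))"
      by (simp only: ennreal_of_enat_le_iff min.bounded_iff)
    moreover have "ennreal t \<le> quantile_fun H u" using le_quantile_fun[OF H t(2)] u by simp
    ultimately have "ennreal_of_enat (enat m) * ennreal t \<le> R_fun (coeff_inv a) (quantile_fun H) n u"
      unfolding R_fun_def by (intro mult_mono) auto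
    moreover have "ennreal y < ennreal_of_enat (enat m) * ennreal t"
      using yt y m0 t by (simp add: ennreal_of_nat_eq_real_of_nat ennreal_mult[symmetric] divide_less_eq mult.commute ennreal_lessI)
    ultimately show ?thesis by (rule less_le_trans[rotated])
  qed
  then show ?thesis using d(1) HL by (intro exI[of _ "min d (H t - L)"]) auto
qed

text \<open>\<open>L\<close> is at most \<open>1/2\<close> because the coefficient at \<open>0\<close> is \<open>1/2\<close>, so that its inverse, and with
it \<open>R\<close>, vanishes there.\<close>

lemma L_fun_properties:
  fixes a :: "nat \<Rightarrow> ennreal" and n :: nat
  assumes H: "tail_function H" and y: "0 \<le> y" and a: "a 0 = ennreal (1/2)"
  defines "R \<equiv> R_fun (coeff_inv a) (quantile_fun H) n"
    and "L \<equiv> L_fun (coeff_inv a) (quantile_fun H) n y"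
  shows "0 \<le> L" "L \<le> 1/2" "R L \<le> ennreal y" "\<And>u. 0 \<le> u \<Longrightarrow> u < L \<Longrightarrow> ennreal y < R u"
proof -
  define S where "S = {u \<in> {0..1}. R u \<le> ennreal y}"
  have LS: "L = Inf S" by (simp add: L_def L_fun_def S_def R_def)
  have "coeff_inv a (1/2) \<le> enat 0" unfolding coeff_inv_def using a by (intro Inf_lower) auto
  then have "coeff_inv a (1/2) = 0" by (simp add: zero_enat_def[symmetric])
  then have "R (1/2) = 0" by (simp add: R_def R_fun_def)
  then have half: "1/2 \<in> S" by (simp add: S_def)
  have bdd: "bdd_below S" by (rule bdd_belowI[of _ 0]) (simp add: S_def)
  show L0: "0 \<le> L" unfolding LS by (rule cInf_greatest) (use half in blast, simp add: S_def)
  show Lh: "L \<le> 1/2" unfolding LS by (rule cInf_lower[OF half bdd])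
  show "R L \<le> ennreal y"
  proof (rule ccontr)
    assume "\<not> R L \<le> ennreal y"
    then have "ennreal y < R L" by simp
    then obtain d where d: "0 < d" "\<And>u. u < L + d \<Longrightarrow> ennreal y < R u"
      using R_fun_right_lower_bound[OF H L0 y] unfolding R_def by blast
    have "\<exists>u\<in>S. u < L + d" using cInf_lessD[of S "L + d"] half d(1) unfolding LS by auto
    then obtain u where u: "u \<in> S" "u < L + d" by blast
    have "R u \<le> ennreal y" using u(1) by (simp add: S_def)
    then show False using d(2)[OF u(2)] by (meson leD)
  qed
  show "ennreal y < R u" if "0 \<le> u" "u < L" for u
  proof (rule ccontr)
    assume "\<not> ennreal y < R u"
    then have "u \<in> S" using that Lh by (simp add: S_def)
    then have "L \<le> u" unfolding LS using bdd by (rule cInf_lower)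
    then show False using that by simp
  qed
qed

context stationary_sequence
begin

text \<open>Let \<open>st\<close> be the step function that approximates \<open>f\<close>. The event forces either the sums of the
step process to reach \<open>x / 2\<close> or the sum of the absolute centred remainders to do so. The
mean of a remainder is at most \<open>2 (D0 + 2 \<eta>)\<close>, where the arbitrary \<open>\<eta> > 0\<close> bounds both the
distance of \<open>f\<close> to a combination of monotone functions and the error of the grid.\<close>

lemma deviation_by_step_functions:
  fixes f :: "real \<Rightarrow> real" and n :: nat and x b D0 K :: real
  assumes H: "tail_function H" and f: "f \<in> F_class H law"
    and n: "n \<ge> 1" and x: "0 < x" and K: "0 \<le> K" and D0: "0 \<le> D0"
    and tail: "(\<integral>\<^sup>+u\<in>{0..1}. (quantile_fun H u - ennreal K) \<partial>lborel) \<le> ennreal D0"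
    and b: "\<And>(P :: (nat \<times> nat \<times> bool) set) c B. step_sequence M F0 T Y0 P c B K (quantile_fun H) \<Longrightarrow>
      prob {\<omega>\<in>space M. \<exists>k\<in>{1..n}. \<bar>\<Sum>i=1..k. \<Sum>p\<in>P. c p * cind (B p) (int i) \<omega>\<bar> \<ge> x / 2} \<le> b"
  shows "prob {\<omega>\<in>space M. \<exists>k\<in>{1..n}. \<bar>\<Sum>i=1..k. f (Y (int i) \<omega>) - (\<integral>\<omega>'. f (Y (int i) \<omega>') \<partial>M)\<bar> \<ge> x}
    \<le> b + 4 * real n * D0 / x" (is "prob ?E \<le> _")
proof (rule field_le_epsilon)
  fix \<epsilon> :: real assume \<epsilon>: "0 < \<epsilon>"
  define \<mu> where "\<mu> = law"
  interpret \<mu>: prob_space \<mu> unfolding \<mu>_def by (rule prob_space_Y0)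
  have s\<mu>: "sets \<mu> = sets borel" by (simp add: \<mu>_def)
  \<comment> \<open>The remainder contributes 4 n D / x in total, of which the part due to \<open>\<eta>\<close> is then \<open>\<epsilon>\<close>.\<close>
  define \<eta> where "\<eta> = \<epsilon> * x / (8 * real n)"
  have \<eta>: "0 < \<eta>" using \<epsilon> x n by (simp add: \<eta>_def)
  have fi: "integrable \<mu> f" using f by (simp add: F_class_def \<mu>_def)
  then have fm: "f \<in> borel_measurable borel" by (auto simp: \<mu>_def dest: borel_measurable_integrable)
  obtain h where h: "h \<in> Mon_combinations H \<mu>" "(\<integral>\<^sup>+y. ennreal \<bar>f y - h y\<bar> \<partial>\<mu>) < ennreal \<eta>"
    using f \<eta> unfolding F_class_def \<mu>_def[symmetric] by blast
  obtain P :: "(nat \<times> nat \<times> bool) set" and c B where PcB: "finite P" "\<And>p. p \<in> P \<Longrightarrow> is_interval (B p)"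
    "(\<Sum>p\<in>P. \<bar>c p\<bar>) \<le> 2 * K"
    "\<And>u. u \<ge> 0 \<Longrightarrow> (\<Sum>p\<in>P. ennreal \<bar>c p\<bar> * of_bool (u < measure \<mu> (B p))) \<le> 2 * quantile_fun H u"
    "(\<integral>\<^sup>+y. ennreal \<bar>h y - (\<Sum>p\<in>P. c p * indicator (B p) y)\<bar> \<partial>\<mu>)
      \<le> ennreal \<eta> + (\<integral>\<^sup>+u\<in>{0..1}. (quantile_fun H u - ennreal K) \<partial>lborel)"
    using Mon_combination_step_approximation[OF H \<mu>.prob_space_axioms s\<mu> h(1) K \<eta>] by blast
  interpret step: step_sequence M F0 T Y0 P c B K "quantile_fun H"
    by unfold_locales (use PcB in \<open>auto simp: \<mu>_def\<close>)
  define st where "st = (\<lambda>y. \<Sum>p\<in>P. c p * (indicator (B p) y :: real))"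
  have stm [measurable]: "st \<in> borel_measurable borel"
    unfolding st_def using step.B_borel by (intro borel_measurable_sum borel_measurable_times borel_measurable_const borel_measurable_indicator)
  have hm: "h \<in> borel_measurable borel"
  proof -
    obtain L :: nat and a g where "h = (\<lambda>y. \<Sum>l=1..L. a l * g l y)" "\<And>l. l \<in> {1..L} \<Longrightarrow> g l \<in> Mon_class H \<mu>"
      using h(1) unfolding Mon_combinations_def by blast
    then show ?thesis using Mon_class_measurable
      by (auto intro!: borel_measurable_sum borel_measurable_times)
  qed
  define g where "g = (\<lambda>y. f y - st y)"
  have gm [measurable]: "g \<in> borel_measurable borel" unfolding g_def using fm by simp
  define D where "D = 2 * \<eta> + D0"
  have gD: "(\<integral>\<^sup>+y. ennreal \<bar>g y\<bar> \<partial>\<mu>) \<le> ennreal D"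
  proof -
    have "(\<integral>\<^sup>+y. ennreal \<bar>g y\<bar> \<partial>\<mu>) \<le> (\<integral>\<^sup>+y. ennreal \<bar>f y - h y\<bar> + ennreal \<bar>h y - st y\<bar> \<partial>\<mu>)"
      by (intro nn_integral_mono) (auto simp: g_def ennreal_plus[symmetric] simp del: ennreal_plus intro!: ennreal_leI)
    also have "\<dots> = (\<integral>\<^sup>+y. ennreal \<bar>f y - h y\<bar> \<partial>\<mu>) + (\<integral>\<^sup>+y. ennreal \<bar>h y - st y\<bar> \<partial>\<mu>)"
      using fm hm by (intro nn_integral_add) (auto simp: \<mu>_def)
    also have "\<dots> \<le> ennreal \<eta> + (ennreal \<eta> + ennreal D0)"
      using h(2) order_trans[OF PcB(5) add_left_mono[OF tail]] unfolding st_def by (intro add_mono) auto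
    also have "\<dots> = ennreal D" using \<eta> D0 by (simp add: D_def ennreal_plus[symmetric] del: ennreal_plus)
    finally show ?thesis .
  qed
  have D00: "0 \<le> D" using \<eta> D0 by (simp add: D_def)
  have gi: "integrable \<mu> g"
    by (rule integrableI_bounded) (use gD in \<open>auto simp: \<mu>_def intro: le_less_trans\<close>)
  have gY: "integrable M (\<lambda>\<omega>. g (Y k \<omega>))" "(\<integral>\<omega>. \<bar>g (Y k \<omega>)\<bar> \<partial>M) \<le> D" for k
  proof -
    have dY: "distr M borel (Y k) = \<mu>"
    proof -
      have "distr M borel (Y k) = distr (distr M M (\<tau> k)) borel Y0"
        unfolding Y_def by (rule distr_distr[symmetric]) measurable
      then show ?thesis by (simp add: shift_preserving \<mu>_def)
    qed
    show "integrable M (\<lambda>\<omega>. g (Y k \<omega>))" using gi unfolding dY[of, symmetric]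
      by (subst (asm) integrable_distr_eq) measurable
    have "(\<integral>\<omega>. \<bar>g (Y k \<omega>)\<bar> \<partial>M) = (\<integral>y. \<bar>g y\<bar> \<partial>\<mu>)"
      unfolding dY[symmetric] by (rule integral_distr[symmetric]) measurable
    also have "\<dots> \<le> D"
      by (rule integral_real_bounded[OF D00]) (use gD in simp)
    finally show "(\<integral>\<omega>. \<bar>g (Y k \<omega>)\<bar> \<partial>M) \<le> D" .
  qed
  define r where "r = (\<lambda>k \<omega>. g (Y k \<omega>) - (\<integral>\<omega>'. g (Y k \<omega>') \<partial>M))"
  have sti: "integrable M (\<lambda>\<omega>. st (Y k \<omega>))" for k
  proof (rule integrable_bounded[where C="\<Sum>p\<in>P. \<bar>c p\<bar>"])
    show "(\<lambda>\<omega>. st (Y k \<omega>)) \<in> borel_measurable M" by measurable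
    show "\<bar>st (Y k \<omega>)\<bar> \<le> (\<Sum>p\<in>P. \<bar>c p\<bar>)" for \<omega>
      unfolding st_def by (intro order_trans[OF sum_abs] sum_mono) (auto simp: indicator_def abs_mult)
  qed
  have split: "f (Y k \<omega>) - (\<integral>\<omega>'. f (Y k \<omega>') \<partial>M) = step.X k \<omega> + r k \<omega>" for k \<omega>
  proof -
    have ind_int: "integrable M (\<lambda>\<omega>. indicator (B p) (Y k \<omega>) :: real)" if "p \<in> P" for p
      by (rule integrable_bounded[where C=1])
        (rule measurable_compose[OF Y_measurable borel_measurable_indicator[OF step.B_borel[OF that]]], simp add: indicator_def)
    have "(\<integral>\<omega>'. st (Y k \<omega>') \<partial>M) = (\<Sum>p\<in>P. \<integral>\<omega>'. c p * indicator (B p) (Y k \<omega>') \<partial>M)"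
      unfolding st_def using ind_int by (intro Bochner_Integration.integral_sum integrable_mult_right)
    also have "\<dots> = (\<Sum>p\<in>P. c p * measure law (B p))"
      using integral_indicator_Y step.B_borel by (intro sum.cong) auto
    finally have "step.X k \<omega> = st (Y k \<omega>) - (\<integral>\<omega>'. st (Y k \<omega>') \<partial>M)"
      unfolding step.X_def cind_def st_def by (simp add: right_diff_distrib sum_subtractf)
    moreover have "(\<integral>\<omega>'. f (Y k \<omega>') \<partial>M) = (\<integral>\<omega>'. g (Y k \<omega>') \<partial>M) + (\<integral>\<omega>'. st (Y k \<omega>') \<partial>M)"
      using Bochner_Integration.integral_add[OF gY(1)[of k] sti[of k]] by (simp add: g_def)
    ultimately show ?thesis by (simp add: r_def g_def)
  qed
  have rm [measurable]: "r k \<in> borel_measurable M" for k unfolding r_def by measurable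
  have ri: "integrable M (r k)" and rD: "(\<integral>\<omega>. \<bar>r k \<omega>\<bar> \<partial>M) \<le> 2 * D" for k
  proof -
    show ri: "integrable M (r k)" unfolding r_def using gY(1)[of k] by simp
    have "(\<integral>\<omega>. \<bar>r k \<omega>\<bar> \<partial>M) \<le> (\<integral>\<omega>. \<bar>g (Y k \<omega>)\<bar> + \<bar>\<integral>\<omega>'. g (Y k \<omega>') \<partial>M\<bar> \<partial>M)"
      using ri gY(1)[of k] by (intro integral_mono) (auto simp: r_def)
    also have "\<dots> = (\<integral>\<omega>. \<bar>g (Y k \<omega>)\<bar> \<partial>M) + \<bar>\<integral>\<omega>'. g (Y k \<omega>') \<partial>M\<bar>"
      using gY(1)[of k] by (simp add: prob_space)
    also have "\<dots> \<le> D + D"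
      using gY(2)[of k] order_trans[OF integral_abs_bound gY(2)] by (intro add_mono) auto
    finally show "(\<integral>\<omega>. \<bar>r k \<omega>\<bar> \<partial>M) \<le> 2 * D" by simp
  qed
  define E1 where "E1 = {\<omega>\<in>space M. \<exists>k\<in>{1..n}. \<bar>\<Sum>i=1..k. step.X (int i) \<omega>\<bar> \<ge> x / 2}"
  define E2 where "E2 = {\<omega>\<in>space M. (\<Sum>i=1..n. \<bar>r (int i) \<omega>\<bar>) \<ge> x / 2}"
  have E1m: "E1 \<in> sets M" unfolding E1_def by measurable
  have E2m: "E2 \<in> sets M" unfolding E2_def by measurable
  have "?E \<subseteq> E1 \<union> E2"
  proof clarify
    fix \<omega> k assume \<omega>: "\<omega> \<in> space M" "\<omega> \<notin> E2" and k: "k \<in> {1..n}"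
      and big: "\<bar>\<Sum>i=1..k. f (Y (int i) \<omega>) - (\<integral>\<omega>'. f (Y (int i) \<omega>') \<partial>M)\<bar> \<ge> x"
    have "\<bar>\<Sum>i=1..k. r (int i) \<omega>\<bar> \<le> (\<Sum>i=1..k. \<bar>r (int i) \<omega>\<bar>)" by (rule sum_abs)
    also have "\<dots> \<le> (\<Sum>i=1..n. \<bar>r (int i) \<omega>\<bar>)" using k by (intro sum_mono2) auto
    also have "\<dots> < x / 2" using \<omega> by (simp add: E2_def)
    finally have "\<bar>\<Sum>i=1..k. step.X (int i) \<omega>\<bar> \<ge> x / 2"
      using big unfolding split sum.distrib by linarith
    then show "\<omega> \<in> E1" unfolding E1_def using \<omega>(1) k by blast
  qed
  then have "prob ?E \<le> prob (E1 \<union> E2)"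
    using E1m E2m by (intro finite_measure_mono) auto
  also have "\<dots> \<le> prob E1 + prob E2" by (rule measure_Un_le[OF E1m E2m])
  also have "prob E1 \<le> b" using b[OF step.step_sequence_axioms] unfolding E1_def step.X_def .
  also have "prob E2 \<le> (\<integral>\<omega>. (\<Sum>i=1..n. \<bar>r (int i) \<omega>\<bar>) \<partial>M) / (x / 2)"
    unfolding E2_def using x ri by (intro integral_Markov_inequality_measure[where A="space M"]) (auto intro!: sum_nonneg)
  also have "(\<integral>\<omega>. (\<Sum>i=1..n. \<bar>r (int i) \<omega>\<bar>) \<partial>M) = (\<Sum>i=1..n. \<integral>\<omega>. \<bar>r (int i) \<omega>\<bar> \<partial>M)"
    using ri by (intro Bochner_Integration.integral_sum integrable_abs)
  also have "\<dots> / (x / 2) \<le> (\<Sum>i=1..n. 2 * D) / (x / 2)"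
    using x by (intro divide_right_mono sum_mono rD) auto
  also have "(\<Sum>i=1..n. 2 * D) / (x / 2) = 4 * real n * D0 / x + \<epsilon>"
    using x n by (simp add: D_def \<eta>_def field_simps)
  finally show "prob ?E
    \<le> b + 4 * real n * D0 / x + \<epsilon>" by simp
qed

end

section \<open>The Fuk-Nagaev inequality\<close>

lemma coeff_inv_min_measurable [measurable]:
  "(\<lambda>u. ennreal_of_enat (min (coeff_inv a u) (enat n))) \<in> borel_measurable borel"
proof (rule antimono_ennreal_borel_measurable, rule antimonoI)
  fix u v :: real assume "u \<le> v"
  then have "coeff_inv a v \<le> coeff_inv a u" using coeff_inv_antimono by (rule antimonoD[rotated])
  then show "ennreal_of_enat (min (coeff_inv a v) (enat n)) \<le> ennreal_of_enat (min (coeff_inv a u) (enat n))"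
    by (simp add: min.coboundedI1)
qed

lemma R_fun_measurable [measurable]: "R_fun (coeff_inv a) (quantile_fun H) n \<in> borel_measurable borel"
  by (rule antimono_ennreal_borel_measurable[OF R_fun_antimono])

lemma ennreal_powr_measurable [measurable]: "(\<lambda>z. ennreal_powr z p) \<in> borel_measurable borel"
  unfolding ennreal_powr_def by measurable

lemma ennreal_powr_mono:
  assumes "a \<le> b" "0 \<le> p"
  shows "ennreal_powr a p \<le> ennreal_powr b p"
proof (cases "b = \<infinity>")
  case False
  then have "a \<noteq> \<infinity>" using assms(1) by (auto simp: top_unique)
  moreover have "enn2real a \<le> enn2real b" using assms(1) False by (intro enn2real_mono) (auto simp: less_top)
  ultimately show ?thesis using False assms(2)
    by (simp add: ennreal_powr_def ennreal_leI powr_mono2)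
qed (simp add: ennreal_powr_def)

lemma L_fun_antimono:
  assumes "a 0 = ennreal (1/2)" "0 \<le> y" "y \<le> x"
  shows "L_fun (coeff_inv a) Q n x \<le> L_fun (coeff_inv a) Q n y"
  unfolding L_fun_def
proof (rule cInf_superset_mono)
  have "coeff_inv a (1/2) \<le> enat 0" unfolding coeff_inv_def using assms(1) by (intro Inf_lower) auto
  then have "coeff_inv a (1/2) = 0" by (simp add: zero_enat_def[symmetric])
  then have "R_fun (coeff_inv a) Q n (1/2) = 0" by (simp add: R_fun_def)
  then have "1/2 \<in> {u \<in> {0..1}. R_fun (coeff_inv a) Q n u \<le> ennreal y}" by simp
  then show "{u \<in> {0..1}. R_fun (coeff_inv a) Q n u \<le> ennreal y} \<noteq> {}" by blast
  show "bdd_below {u \<in> {0..1}. R_fun (coeff_inv a) Q n u \<le> ennreal x}" by (rule bdd_belowI[of _ 0]) simp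
  show "{u \<in> {0..1}. R_fun (coeff_inv a) Q n u \<le> ennreal y} \<subseteq> {u \<in> {0..1}. R_fun (coeff_inv a) Q n u \<le> ennreal x}"
    using ennreal_leI[OF assms(3)] by (auto intro: order_trans)
qed

lemma quantile_excess_le:
  assumes L: "0 \<le> L" and K: "quantile_fun H L \<le> ennreal K"
  shows "(\<integral>\<^sup>+u\<in>{0..1}. (quantile_fun H u - ennreal K) \<partial>lborel) \<le> (\<integral>\<^sup>+u\<in>{0..L}. quantile_fun H u \<partial>lborel)"
proof (intro nn_integral_mono)
  fix u :: real
  show "(quantile_fun H u - ennreal K) * indicator {0..1} u \<le> quantile_fun H u * indicator {0..L} u"
  proof (cases "u \<le> L")
    case True
    then show ?thesis by (auto simp: indicator_def diff_le_self_ennreal)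
  next
    case False
    then have "quantile_fun H u \<le> ennreal K"
      using antimonoD[OF quantile_fun_antimono, of L u H] K by (meson less_imp_le not_le order_trans)
    then have "quantile_fun H u - ennreal K = 0"
      using le_less_trans[of "quantile_fun H u" "ennreal K" top] by (intro diff_eq_0_ennreal) auto
    then show ?thesis by simp
  qed
qed

lemma quantile_rectangle_le:
  assumes L: "0 \<le> L"
  shows "quantile_fun H L * ennreal L \<le> (\<integral>\<^sup>+u\<in>{0..L}. quantile_fun H u \<partial>lborel)"
proof -
  have "quantile_fun H L * ennreal L = (\<integral>\<^sup>+u. quantile_fun H L * indicator {0..L} u \<partial>lborel)"
    using L by (subst nn_integral_cmult_indicator) auto
  also have "\<dots> \<le> (\<integral>\<^sup>+u\<in>{0..L}. quantile_fun H u \<partial>lborel)"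
    using antimonoD[OF quantile_fun_antimono, of _ L H] by (intro nn_integral_mono) (auto simp: indicator_def)
  finally show ?thesis .
qed

text \<open>On \<open>[L, 1]\<close> the function is at most its value at \<open>L\<close>, and this interval is not longer than
\<open>[0, L]\<close>.\<close>

lemma quantile_integral_half:
  assumes L: "1/2 \<le> L" "L \<le> 1"
  shows "(\<integral>\<^sup>+u\<in>{0..1}. quantile_fun H u \<partial>lborel) \<le> 2 * (\<integral>\<^sup>+u\<in>{0..L}. quantile_fun H u \<partial>lborel)"
proof -
  have "(\<integral>\<^sup>+u\<in>{0..1}. quantile_fun H u \<partial>lborel)
    \<le> (\<integral>\<^sup>+u. quantile_fun H u * indicator {0..L} u + quantile_fun H L * indicator {L..1} u \<partial>lborel)"
    using antimonoD[OF quantile_fun_antimono, of L _ H] by (intro nn_integral_mono) (auto simp: indicator_def)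
  also have "\<dots> = (\<integral>\<^sup>+u\<in>{0..L}. quantile_fun H u \<partial>lborel) + quantile_fun H L * ennreal (1 - L)"
    using L by (subst nn_integral_add) (auto simp: nn_integral_cmult_indicator)
  also have "quantile_fun H L * ennreal (1 - L) \<le> quantile_fun H L * ennreal L"
    using L by (intro mult_left_mono ennreal_leI) auto
  also have "\<dots> \<le> (\<integral>\<^sup>+u\<in>{0..L}. quantile_fun H u \<partial>lborel)" using L by (intro quantile_rectangle_le) auto
  finally show ?thesis by (simp add: mult_2 add_left_mono)
qed

lemma (in step_sequence) no_deviation:
  assumes "2 * real n * K < z"
  shows "prob {\<omega>\<in>space M. \<exists>k\<in>{1..n}. \<bar>\<Sum>i=1..k. X (int i) \<omega>\<bar> \<ge> z} = 0"
proof -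
  have "\<bar>\<Sum>i=1..k. X (int i) \<omega>\<bar> < z" if "k \<in> {1..n}" for k \<omega>
  proof -
    have "\<bar>\<Sum>i=1..k. X (int i) \<omega>\<bar> \<le> (\<Sum>i=1..k. 2 * K)" by (intro order_trans[OF sum_abs] sum_mono X_bound)
    also have "\<dots> = 2 * (real k * K)" by simp
    also have "\<dots> \<le> 2 * (real n * K)" using that K_nonneg by (intro mult_left_mono mult_right_mono) auto
    finally show ?thesis using assms by simp
  qed
  then have "{\<omega>\<in>space M. \<exists>k\<in>{1..n}. \<bar>\<Sum>i=1..k. X (int i) \<omega>\<bar> \<ge> z} = {}" by (auto simp: not_le[symmetric])
  then show ?thesis by (simp only: measure_empty)
qed

context stationary_sequence
begin

text \<open>If the inverse second order coefficient at \<open>L\<close> is \<open>0\<close> then \<open>L \<ge> 1/2\<close>, and the first moment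
alone suffices: truncate at \<open>0\<close>. If it is at least \<open>n\<close> then \<open>n Q L \<le> y\<close>, and the truncated
sums are deterministically below \<open>x / 2\<close>, where \<open>x = 64 J y\<close>. In the remaining case it is a
block length \<open>q\<close> between \<open>1\<close> and \<open>n\<close>, and the coefficient at \<open>q\<close> is at most \<open>L\<close>.\<close>

lemma fuk_nagaev:
  fixes f H :: "real \<Rightarrow> real" and n J :: nat and y r v I0 :: real
  defines "\<alpha>1 \<equiv> coeff_inv (\<alpha> 1)" and "\<alpha>2 \<equiv> coeff_inv (\<alpha> 2)" and "Q \<equiv> quantile_fun H"
  defines "L \<equiv> L_fun \<alpha>2 Q n y"
  assumes H: "tail_function H" and f: "f \<in> F_class H law"
    and n: "n \<ge> 1" and y: "0 < y" and J: "J \<ge> 1" "r / 2 \<le> real J" and r: "0 < r"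
    and I0: "0 \<le> I0" "(\<integral>\<^sup>+u\<in>{0..L}. Q u \<partial>lborel) = ennreal I0"
    and v: "0 \<le> v" "s_sq \<alpha>1 \<alpha>2 Q n y = ennreal v"
  shows "prob {\<omega>\<in>space M. \<exists>k\<in>{1..n}. \<bar>\<Sum>i=1..k. f (Y (int i) \<omega>) - (\<integral>\<omega>'. f (Y (int i) \<omega>') \<partial>M)\<bar> \<ge> 64 * real J * y}
    \<le> 2 * (v / y\<^sup>2) powr (r / 2) + (2 * real J * (2 + 8 * real J) + 8) * (real n * I0 / y)"
    (is "prob ?E \<le> ?rhs")
proof -
  have Jr: "real J \<ge> 1" using J by simp
  have nI: "0 \<le> real n * I0 / y" using I0 y by simp
  have coef: "0 \<le> (2 * real J * (2 + 8 * real J) + 8) * (real n * I0 / y)" using nI Jr by (intro mult_nonneg_nonneg) auto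
  show ?thesis
  proof (cases "v / y\<^sup>2 \<le> 1")
    case False
    then have "1 \<le> (v / y\<^sup>2) powr (r / 2)" using r by (intro ge_one_powr_ge_zero) auto
    then show ?thesis using coef prob_le_1[of ?E] by linarith
  next
    case v1: True
    have x0: "0 < 64 * real J * y" using Jr y by simp
    have D8: "4 * real n * (2 * I0) / (64 * real J * y) \<le> 8 * (real n * I0 / y)"
    proof -
      have "4 * real n * (2 * I0) / (64 * real J * y) \<le> 4 * real n * (2 * I0) / y"
        using Jr y I0 by (intro divide_left_mono) (auto intro!: mult_pos_pos)
      then show ?thesis by simp
    qed
    have a20: "\<alpha> 2 0 = ennreal (1/2)" by (simp add: alpha_coeff_def)
    note Lp = L_fun_properties[where a="\<alpha> 2" and n=n, OF H less_imp_le[OF y] a20, folded \<alpha>2_def Q_def, folded L_def]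
    have RL: "ennreal_of_enat (min (\<alpha>2 L) (enat n)) * Q L \<le> ennreal y" using Lp(3) by (simp add: R_fun_def)
    \<comment> \<open>Both degenerate cases: the truncated sums stay below half of the level, so only the remainder counts.\<close>
    have zero_case: "prob ?E \<le> ?rhs"
      if K: "0 \<le> K" "2 * real n * K < 32 * real J * y" and D0: "0 \<le> D0" "D0 \<le> 2 * I0"
        "(\<integral>\<^sup>+u\<in>{0..1}. (quantile_fun H u - ennreal K) \<partial>lborel) \<le> ennreal D0" for K D0
    proof -
      have "prob ?E \<le> 0 + 4 * real n * D0 / (64 * real J * y)"
      proof (rule deviation_by_step_functions[OF H f n x0 K(1) D0(1,3)])
        fix P :: "(nat \<times> nat \<times> bool) set" and c B
        assume "step_sequence M F0 T Y0 P c B K (quantile_fun H)"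
        then interpret st: step_sequence M F0 T Y0 P c B K "quantile_fun H" .
        show "prob {\<omega>\<in>space M. \<exists>k\<in>{1..n}. \<bar>\<Sum>i=1..k. \<Sum>p\<in>P. c p * cind (B p) (int i) \<omega>\<bar> \<ge> 64 * real J * y / 2} \<le> 0"
          using st.no_deviation[of n "64 * real J * y / 2"] K(2) by (simp add: st.X_def)
      qed
      also have "\<dots> \<le> 4 * real n * (2 * I0) / (64 * real J * y)"
        unfolding add_0 by (rule divide_right_mono[OF mult_left_mono[OF D0(2)] less_imp_le[OF x0]]) simp
      also have "\<dots> \<le> 8 * (real n * I0 / y)" by (rule D8)
      also have "\<dots> \<le> ?rhs"
      proof -
        have "0 \<le> 2 * real J * (2 + 8 * real J) * (real n * I0 / y)" using nI Jr by (intro mult_nonneg_nonneg) auto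
        moreover have "0 \<le> 2 * (v / y\<^sup>2) powr (r / 2)" by simp
        ultimately show ?thesis by (simp only: distrib_right)
      qed
      finally show ?thesis .
    qed
    show ?thesis
    proof (cases "\<alpha>2 L = 0")
      case True
      have "\<alpha> 2 0 \<le> ennreal L"
        using True unfolding \<alpha>2_def by (intro coeff_inv_attained) (simp add: zero_enat_def)
      then have "ennreal (1/2) \<le> ennreal L" unfolding a20 .
      from this[unfolded ennreal_le_iff[OF Lp(1)]] have L: "1/2 \<le> L" .
      have "(\<integral>\<^sup>+u\<in>{0..1}. Q u \<partial>lborel) \<le> 2 * ennreal I0"
        unfolding I0(2)[symmetric] unfolding Q_def using L Lp(2) by (intro quantile_integral_half) auto
      then show ?thesis
        using I0 x0 y Jr by (intro zero_case[of 0 "2 * I0"]) (auto simp: Q_def ennreal_mult)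
    next
      case nz: False
      define K where "K = enn2real (Q L)"
      have K0: "0 \<le> K" by (simp add: K_def)
      have QL: "Q L = ennreal K"
      proof -
        have "1 \<le> min (\<alpha>2 L) (enat n)" using nz n
          by (cases "\<alpha>2 L") (auto simp: min_def one_enat_def zero_enat_def)
        then have "ennreal_of_enat 1 * Q L \<le> ennreal_of_enat (min (\<alpha>2 L) (enat n)) * Q L"
          by (intro mult_right_mono) (simp_all only: ennreal_of_enat_le_iff zero_le)
        then have "Q L \<le> ennreal y" using RL by (simp add: one_enat_def)
        then show ?thesis unfolding K_def by (intro ennreal_enn2real[symmetric]) (auto intro: le_less_trans)
      qed
      have exc: "(\<integral>\<^sup>+u\<in>{0..1}. (quantile_fun H u - ennreal K) \<partial>lborel) \<le> ennreal I0"
        unfolding I0(2)[symmetric] unfolding Q_def using QL Lp(1) by (intro quantile_excess_le) (auto simp: Q_def)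
      have KL: "K * L \<le> I0"
      proof -
        have "ennreal (K * L) \<le> ennreal I0"
          unfolding I0(2)[symmetric] using quantile_rectangle_le[OF Lp(1), of H] K0 Lp(1) QL
          by (simp add: Q_def ennreal_mult)
        then show ?thesis using I0 by (simp add: ennreal_le_iff)
      qed
      show ?thesis
      proof (cases "enat n \<le> \<alpha>2 L")
        case True
        then have "min (\<alpha>2 L) (enat n) = enat n" by (simp add: min_def)
        then have "ennreal (real n * K) \<le> ennreal y" using RL QL K0 by (simp add: ennreal_mult ennreal_of_nat_eq_real_of_nat)
        then have nK: "real n * K \<le> y" using y by (simp add: ennreal_le_iff)
        have "y \<le> real J * y" using Jr y by simp
        then have "2 * real n * K < 32 * real J * y" using nK y by linarith
        then show ?thesis using K0 I0 exc by (intro zero_case[of K I0]) auto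
      next
        case False
        then obtain q where q: "\<alpha>2 L = enat q" "q < n" by (cases "\<alpha>2 L") auto
        have q1: "q \<ge> 1" using q nz by (cases q) (auto simp: zero_enat_def)
        have aq: "\<alpha> 2 q \<le> ennreal L" using q(1) unfolding \<alpha>2_def by (rule coeff_inv_attained)
        have "min (\<alpha>2 L) (enat n) = enat q" using q by (simp add: min_def)
        then have "ennreal (real q * K) \<le> ennreal y" using RL QL K0 by (simp add: ennreal_mult ennreal_of_nat_eq_real_of_nat)
        then have qK: "real q * K \<le> y" using y by (simp add: ennreal_le_iff)
        define b where "b = 2 * ((v / y\<^sup>2) ^ J + real J * ((2 + 8 * real J) * (real n * K * L / y)))"
        have "prob ?E \<le> b + 4 * real n * I0 / (64 * real J * y)"
        proof (rule deviation_by_step_functions[OF H f n x0 K0 I0(1) exc])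
          fix P :: "(nat \<times> nat \<times> bool) set" and c B
          assume "step_sequence M F0 T Y0 P c B K (quantile_fun H)"
          then interpret st: step_sequence M F0 T Y0 P c B K "quantile_fun H" .
          let ?Is = "(\<integral>\<^sup>+u\<in>{L..1}. ennreal_of_enat (min (\<alpha>1 u) (enat n)) * (Q u)\<^sup>2 \<partial>lborel)"
          \<comment> \<open>Split at L: below it the integrand is at most \<open>q K\<^sup>2\<close>, above it at most the integrand of \<open>s_sq\<close>.\<close>
          have "st.V q \<le> (\<integral>\<^sup>+u. ennreal (real q * K\<^sup>2) * indicator {0..L} u
              + ennreal_of_enat (min (\<alpha>1 u) (enat n)) * (Q u)\<^sup>2 * indicator {L..1} u \<partial>lborel)"
            unfolding st.V_def
          proof (intro nn_integral_mono)
            fix u :: real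
            let ?m = "ennreal_of_enat (min (coeff_inv (\<alpha> 1) u) (enat q))"
            let ?mq = "?m * (min (quantile_fun H u) (ennreal K))\<^sup>2"
            show "?mq * indicator {0..1} u
              \<le> ennreal (real q * K\<^sup>2) * indicator {0..L} u + ennreal_of_enat (min (\<alpha>1 u) (enat n)) * (Q u)\<^sup>2 * indicator {L..1} u"
            proof (cases "u \<in> {0..L}")
              case True
              have "?m \<le> ennreal_of_enat (enat q)" by (simp only: ennreal_of_enat_le_iff min.cobounded2)
              then have "?mq \<le> ennreal_of_enat (enat q) * (ennreal K)\<^sup>2"
                by (intro mult_mono power_mono) auto
              also have "\<dots> = ennreal (real q * K\<^sup>2)"
                using K0 by (simp add: ennreal_mult ennreal_of_nat_eq_real_of_nat ennreal_power)
              finally have "?mq \<le> ennreal (real q * K\<^sup>2)" .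
              then have "?mq * indicator {0..1} u \<le> ennreal (real q * K\<^sup>2) * indicator {0..L} u"
                using True by (intro mult_mono) (auto simp: indicator_def)
              then show ?thesis by (rule order_trans) simp
            next
              case F: False
              show ?thesis
              proof (cases "u \<in> {L..1}")
                case True
                have "min (\<alpha>1 u) (enat q) \<le> min (\<alpha>1 u) (enat n)" using q(2) by (intro min.mono) auto
                then have "?m \<le> ennreal_of_enat (min (\<alpha>1 u) (enat n))"
                  unfolding \<alpha>1_def by (simp only: ennreal_of_enat_le_iff)
                then have "?mq \<le> ennreal_of_enat (min (\<alpha>1 u) (enat n)) * (Q u)\<^sup>2"
                  by (intro mult_mono power_mono) (auto simp: Q_def)
                then show ?thesis using True F Lp(1) by (simp add: indicator_def)
              next
                case False
                then have "indicator {0..1} u = (0::ennreal)" using F by (auto simp: indicator_def)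
                then show ?thesis by simp
              qed
            qed
          qed
          also have "\<dots> = ennreal (real q * K\<^sup>2) * ennreal L + ?Is"
            unfolding \<alpha>1_def Q_def using Lp(1)
            by (subst nn_integral_add) (auto simp: nn_integral_cmult_indicator)
          finally have "of_nat n * st.V q \<le> of_nat n * (ennreal (real q * K\<^sup>2) * ennreal L + ?Is)"
            by (rule mult_left_mono) simp
          also have "\<dots> = ennreal (real n * (real q * K\<^sup>2) * L) + ennreal v"
            unfolding v(2)[symmetric] s_sq_def L_def[symmetric] distrib_left
            using K0 Lp(1) by (simp add: ennreal_mult ennreal_of_nat_eq_real_of_nat mult.assoc)
          also have "\<dots> \<le> ennreal (real n * y * K * L) + ennreal v"
          proof (intro add_right_mono ennreal_leI)
            have "real n * (real q * K\<^sup>2) * L = real n * (real q * K) * (K * L)" by (simp add: power2_eq_square)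
            also have "\<dots> \<le> real n * y * (K * L)" using qK K0 Lp(1) by (intro mult_right_mono mult_left_mono) auto
            finally show "real n * (real q * K\<^sup>2) * L \<le> real n * y * K * L" by simp
          qed
          also have "\<dots> = ennreal (v + real n * y * K * L)"
            using v(1) y K0 Lp(1) by (simp add: add.commute)
          finally have V: "of_nat n * st.V q \<le> ennreal (v + real n * y * K * L)" .
          show "prob {\<omega>\<in>space M. \<exists>k\<in>{1..n}. \<bar>\<Sum>i=1..k. \<Sum>p\<in>P. c p * cind (B p) (int i) \<omega>\<bar> \<ge> 64 * real J * y / 2} \<le> b"
          proof -
            have "64 * real J * y / 2 = 32 * real J * y" by simp
            then show ?thesis
              using st.partial_sums_deviation[OF q1 aq Lp(1) y qK v(1) V v1 n J(1)] by (simp only: b_def st.X_def)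
          qed
        qed
        also have "\<dots> \<le> ?rhs"
        proof -
          have "4 * real n * I0 / (64 * real J * y) \<le> 4 * real n * (2 * I0) / (64 * real J * y)"
            using I0(1) by (intro divide_right_mono[OF mult_left_mono less_imp_le[OF x0]]) auto
          then have 1: "4 * real n * I0 / (64 * real J * y) \<le> 8 * (real n * I0 / y)" using D8 by linarith
          have 2: "(v / y\<^sup>2) ^ J \<le> (v / y\<^sup>2) powr (r / 2)"
          proof (cases "v = 0")
            case True
            then show ?thesis using J(1) by (cases J) simp_all
          next
            case False
            then have "0 < v / y\<^sup>2" using v(1) y by simp
            moreover from this have "(v / y\<^sup>2) ^ J = (v / y\<^sup>2) powr real J" by (simp add: powr_realpow)
            ultimately show ?thesis using v1 J(2) by (simp add: powr_mono')
          qed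
          have "real n * K * L / y \<le> real n * I0 / y"
            using KL y by (intro divide_right_mono) (auto simp: mult.assoc intro!: mult_left_mono)
          then have "real J * ((2 + 8 * real J) * (real n * K * L / y)) \<le> real J * ((2 + 8 * real J) * (real n * I0 / y))"
            by (intro mult_left_mono) auto
          then show ?thesis using 1 2 unfolding b_def by (simp only: distrib_right distrib_left mult.assoc)
        qed
        finally show ?thesis .
      qed
    qed
  qed
qed

end

theorem proposition5p1:
  fixes M F0 :: "'a measure" and T :: "'a \<Rightarrow> 'a" and Y0 :: "'a \<Rightarrow> real"
    and Y X :: "int \<Rightarrow> 'a \<Rightarrow> real" and S :: "nat \<Rightarrow> 'a \<Rightarrow> real"
    and H f :: "real \<Rightarrow> real" and Q :: "real \<Rightarrow> ennreal"
    and \<alpha>1 \<alpha>2 :: "real \<Rightarrow> enat" and r \<beta> :: real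
  assumes "prob_space M"
    and "bij_betw T (space M) (space M)"
    and "T \<in> measurable M M" and "the_inv_into (space M) T \<in> measurable M M"
    and "distr M M T = M"
    and "subalgebra M F0"
    and "sets F0 \<subseteq> (\<lambda>B. T -` B \<inter> space M) ` sets F0"
    and "Y0 \<in> borel_measurable F0" and "integrable M Y0"
    and "\<And>i. Y i = Y0 \<circ> int_iterate (space M) T i"
    and "tail_function H" and "Q = quantile_fun H"
    and "(\<integral>\<^sup>+u\<in>{0..1}. Q u \<partial>lborel) < \<infinity>"
    and "f \<in> F_class H (distr M borel Y0)"
    and "\<And>i \<omega>. X i \<omega> = f (Y i \<omega>) - (\<integral>\<omega>'. f (Y i \<omega>') \<partial>M)"
    and "\<And>n \<omega>. S n \<omega> = (\<Sum>k=1..n. X (int k) \<omega>)"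
    and "\<alpha>1 = coeff_inv (alpha_coeff M F0 Y 1)"
    and "\<alpha>2 = coeff_inv (alpha_coeff M F0 Y 2)"
    and "r > 2" and "\<beta> \<in> {r - 2<..<r}"
  shows "\<exists>C::real. C > 0 \<and> (\<forall>(n::nat) (x::real). n \<ge> 1 \<longrightarrow> x > 0 \<longrightarrow>
    emeasure M {\<omega> \<in> space M. (MAX k\<in>{1..n}. \<bar>S k \<omega>\<bar>) \<ge> x}
    \<le> ennreal C *
      (ennreal_powr (s_sq \<alpha>1 \<alpha>2 Q n x) (r / 2) / ennreal (x powr r)
       + ennreal (real n / x) * (\<integral>\<^sup>+u\<in>{0..L_fun \<alpha>2 Q n x}. Q u \<partial>lborel)
       + ennreal (real n / x powr (1 + \<beta> / 2)) *
           (\<integral>\<^sup>+u\<in>{0..L_fun \<alpha>2 Q n x}. ennreal_powr (R_fun \<alpha>2 Q n u) (\<beta> / 2) * Q u \<partial>lborel)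
       + ennreal (real n / x powr (1 + r / 2)) *
           (\<integral>\<^sup>+u\<in>{L_fun \<alpha>2 Q n x..1}. ennreal_powr (R_fun \<alpha>2 Q n u) (r / 2) * Q u \<partial>lborel)))"
proof -
  interpret prob_space M by fact
  interpret A: stationary_sequence M F0 T Y0 by unfold_locales (use assms in auto)
  have Yeq: "Y = A.Y" using assms(10) by (simp add: A.Y_def fun_eq_iff)
  \<comment> \<open>J level crossings produce the power J of the variance ratio, which has to be at least r / 2.\<close>
  define J where "J = nat \<lceil>r / 2\<rceil>"
  have J: "J \<ge> 1" "r / 2 \<le> real J" using assms(19) unfolding J_def by linarith+
  define \<kappa> where "\<kappa> = 64 * real J"
  have \<kappa>: "1 \<le> \<kappa>" using J by (simp add: \<kappa>_def)
  define C1 where "C1 = 2 * \<kappa> powr r"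
  define C2 where "C2 = (2 * real J * (2 + 8 * real J) + 8) * \<kappa>"
  define C where "C = C1 + C2 + C2 * \<kappa> powr (r / 2)"
  have C0: "0 < C1" "0 < C2" using \<kappa> J by (auto simp: C1_def C2_def intro!: mult_pos_pos add_nonneg_pos)
  have CC: "0 < C" "C1 \<le> C" "C2 \<le> C" "C2 * \<kappa> powr (r / 2) \<le> C"
    using C0 \<kappa> by (auto simp: C_def add_pos_nonneg add_nonneg_nonneg)
  have a20: "alpha_coeff M F0 Y 2 0 = ennreal (1/2)" by (simp add: alpha_coeff_def)
  have main: "emeasure M {\<omega> \<in> space M. (MAX k\<in>{1..n}. \<bar>S k \<omega>\<bar>) \<ge> x} \<le> ennreal C * (T1 + T2 + T3 + T4)"
    if n: "n \<ge> 1" and x: "x > 0"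
      and T1: "T1 = ennreal_powr (s_sq \<alpha>1 \<alpha>2 Q n x) (r / 2) / ennreal (x powr r)"
      and T2: "T2 = ennreal (real n / x) * (\<integral>\<^sup>+u\<in>{0..L_fun \<alpha>2 Q n x}. Q u \<partial>lborel)"
      and T4: "T4 = ennreal (real n / x powr (1 + r / 2)) *
           (\<integral>\<^sup>+u\<in>{L_fun \<alpha>2 Q n x..1}. ennreal_powr (R_fun \<alpha>2 Q n u) (r / 2) * Q u \<partial>lborel)"
    for n :: nat and x :: real and T1 T2 T3 T4 :: ennreal
  proof (cases "s_sq \<alpha>1 \<alpha>2 Q n x = \<infinity>")
    case True
    then have "T1 = \<infinity>" using T1 by (simp add: ennreal_powr_def ennreal_top_divide)
    then show ?thesis using CC(1) by (simp add: ennreal_mult_top)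
  next
    case False
    define y where "y = x / \<kappa>"
    have y: "0 < y" "y \<le> x" using x \<kappa> by (auto simp: y_def divide_le_eq)
    have xy: "x = \<kappa> * y" using \<kappa> by (simp add: y_def)
    define Lx where "Lx = L_fun \<alpha>2 Q n x"
    define Ly where "Ly = L_fun \<alpha>2 Q n y"
    note Lxp = L_fun_properties[where a="alpha_coeff M F0 Y 2" and n=n, OF assms(11) less_imp_le[OF x] a20, folded assms(18) assms(12), folded Lx_def]
    note Lyp = L_fun_properties[where a="alpha_coeff M F0 Y 2" and n=n, OF assms(11) less_imp_le[OF y(1)] a20, folded assms(18) assms(12), folded Ly_def]
    have LL: "Lx \<le> Ly"
      unfolding Lx_def Ly_def assms(18) using a20 y by (intro L_fun_antimono) auto
    have Qm [measurable]: "Q \<in> borel_measurable borel" unfolding assms(12) by (rule quantile_fun_measurable)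
    have Rm [measurable]: "R_fun \<alpha>2 Q n \<in> borel_measurable borel" unfolding assms(12,18) by (rule R_fun_measurable)
    have ss: "s_sq \<alpha>1 \<alpha>2 Q n y \<le> s_sq \<alpha>1 \<alpha>2 Q n x"
      unfolding s_sq_def Lx_def[symmetric] Ly_def[symmetric]
      using LL by (intro mult_left_mono nn_integral_mono) (auto simp: indicator_def)
    define v where "v = enn2real (s_sq \<alpha>1 \<alpha>2 Q n y)"
    have v: "0 \<le> v" "s_sq \<alpha>1 \<alpha>2 Q n y = ennreal v"
    proof -
      have "s_sq \<alpha>1 \<alpha>2 Q n y < top" using le_less_trans[OF ss] False by (simp add: less_top)
      then show "0 \<le> v" "s_sq \<alpha>1 \<alpha>2 Q n y = ennreal v" unfolding v_def by auto
    qed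
    define I0 where "I0 = enn2real (\<integral>\<^sup>+u\<in>{0..Ly}. Q u \<partial>lborel)"
    have I0: "0 \<le> I0" "(\<integral>\<^sup>+u\<in>{0..Ly}. Q u \<partial>lborel) = ennreal I0"
    proof -
      have "(\<integral>\<^sup>+u\<in>{0..Ly}. Q u \<partial>lborel) \<le> (\<integral>\<^sup>+u\<in>{0..1}. Q u \<partial>lborel)"
        using Lyp(2) by (intro nn_integral_mono) (auto simp: indicator_def)
      then show "0 \<le> I0" "(\<integral>\<^sup>+u\<in>{0..Ly}. Q u \<partial>lborel) = ennreal I0"
        using le_less_trans[OF _ assms(13)] unfolding I0_def by (auto simp: infinity_ennreal_def)
    qed
    define E where "E = {\<omega>\<in>space M. \<exists>k\<in>{1..n}. \<bar>\<Sum>i=1..k. f (A.Y (int i) \<omega>) - (\<integral>\<omega>'. f (A.Y (int i) \<omega>') \<partial>M)\<bar> \<ge> 64 * real J * y}"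
    have Eeq: "{\<omega> \<in> space M. (MAX k\<in>{1..n}. \<bar>S k \<omega>\<bar>) \<ge> x} = E"
    proof -
      have "(MAX k\<in>{1..n}. \<bar>S k \<omega>\<bar>) \<ge> x \<longleftrightarrow> (\<exists>k\<in>{1..n}. \<bar>S k \<omega>\<bar> \<ge> x)" for \<omega>
        using n by (subst Max_ge_iff) auto
      then show ?thesis unfolding E_def xy \<kappa>_def[symmetric] assms(16,15) Yeq by simp
    qed
    have "prob E \<le> 2 * (v / y\<^sup>2) powr (r / 2) + (2 * real J * (2 + 8 * real J) + 8) * (real n * I0 / y)"
      unfolding E_def
    proof (rule A.fuk_nagaev[OF assms(11,14) n y(1) J])
      show "0 < r" using assms(19) by simp
      show "(\<integral>\<^sup>+u\<in>{0..L_fun (coeff_inv (alpha_coeff M F0 A.Y 2)) (quantile_fun H) n y}. quantile_fun H u \<partial>lborel) = ennreal I0"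
        using I0(2) unfolding Ly_def assms(18) assms(12) Yeq .
      show "s_sq (coeff_inv (alpha_coeff M F0 A.Y 1)) (coeff_inv (alpha_coeff M F0 A.Y 2)) (quantile_fun H) n y = ennreal v"
        using v(2) unfolding assms(17,18) assms(12) Yeq .
    qed (use v I0 in auto)
    also have "2 * (v / y\<^sup>2) powr (r / 2) = C1 * (v powr (r / 2) / x powr r)"
    proof -
      have "(y\<^sup>2) powr (r / 2) = y powr r"
        using y(1) by (simp add: powr_powr powr_numeral[symmetric] del: powr_numeral)
      moreover have "x powr r = \<kappa> powr r * y powr r" unfolding xy using \<kappa> y by (simp add: powr_mult)
      ultimately show ?thesis using v(1) y(1) \<kappa> by (simp add: powr_divide C1_def)
    qed
    also have "(2 * real J * (2 + 8 * real J) + 8) * (real n * I0 / y) = C2 * (real n / x * I0)"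
      using \<kappa> y by (simp add: C2_def xy)
    finally have pE: "prob E \<le> C1 * (v powr (r / 2) / x powr r) + C2 * (real n / x * I0)" .
    have t1: "ennreal (v powr (r / 2) / x powr r) \<le> T1"
    proof -
      have "ennreal (v powr (r / 2)) = ennreal_powr (s_sq \<alpha>1 \<alpha>2 Q n y) (r / 2)"
        unfolding v(2) using v(1) by (simp add: ennreal_powr_def)
      also have "\<dots> \<le> ennreal_powr (s_sq \<alpha>1 \<alpha>2 Q n x) (r / 2)" using ss assms(19) by (intro ennreal_powr_mono) auto
      finally have "ennreal (v powr (r / 2)) / ennreal (x powr r) \<le> T1"
        unfolding T1 by (rule divide_right_mono_ennreal)
      then show ?thesis using x by (simp add: divide_ennreal)
    qed
    let ?y = "ennreal (y powr (- (r / 2)))"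
    let ?Rp = "\<lambda>u. ennreal_powr (R_fun \<alpha>2 Q n u) (r / 2)"
    let ?I4 = "(\<integral>\<^sup>+u\<in>{Lx..1}. ?Rp u * Q u \<partial>lborel)"
    \<comment> \<open>Between \<open>Lx\<close> and \<open>Ly\<close> the function R exceeds y, so Q is at most \<open>(R / y)^(r/2) Q\<close> there; the end point \<open>Ly\<close> is a null set.\<close>
    have t2: "ennreal (real n / x * I0) \<le> T2 + ennreal (\<kappa> powr (r / 2)) * T4"
    proof -
      have "ennreal I0 \<le> (\<integral>\<^sup>+u. Q u * indicator {0..Lx} u
          + ?y * (?Rp u * Q u * indicator {Lx..1} u) \<partial>lborel)"
        unfolding I0(2)[symmetric]
      proof (rule nn_integral_mono_AE)
        have "AE u in lborel. u \<noteq> Ly" by (rule AE_lborel_singleton)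
        then show "AE u in lborel. Q u * indicator {0..Ly} u \<le> Q u * indicator {0..Lx} u
          + ?y * (?Rp u * Q u * indicator {Lx..1} u)"
        proof eventually_elim
          case (elim u)
          show ?case
          proof (cases "Lx < u \<and> u < Ly")
            case True
            then have "ennreal y < R_fun \<alpha>2 Q n u" using Lyp(4)[of u] Lxp(1) by simp
            then have "ennreal_powr (ennreal y) (r / 2) \<le> ?Rp u"
              using assms(19) by (intro ennreal_powr_mono) auto
            then have "ennreal (y powr (r / 2)) \<le> ?Rp u"
              using y(1) by (simp add: ennreal_powr_def)
            then have "?y * ennreal (y powr (r / 2)) \<le> ?y * ?Rp u"
              by (rule mult_left_mono) simp
            moreover have "?y * ennreal (y powr (r / 2)) = 1"
              using y(1) by (simp add: ennreal_mult[symmetric] powr_add[symmetric])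
            ultimately have "1 * Q u \<le> ?y * ?Rp u * Q u"
              by (intro mult_right_mono) auto
            then show ?thesis using True Lxp(1) Lyp(2) by (auto simp: indicator_def mult.assoc)
          next
            case False
            then have "indicator {0..Ly} u \<le> (indicator {0..Lx} u :: ennreal)" using elim by (auto simp: indicator_def)
            then have "Q u * indicator {0..Ly} u \<le> Q u * indicator {0..Lx} u" by (rule mult_left_mono) simp
            then show ?thesis by (rule order_trans) simp
          qed
        qed
      qed
      also have "\<dots> = (\<integral>\<^sup>+u\<in>{0..Lx}. Q u \<partial>lborel) + ?y * ?I4"
        by (subst nn_integral_add, measurable, subst nn_integral_cmult, measurable)
      finally have "ennreal (real n / x) * ennreal I0 \<le> ennreal (real n / x) * ((\<integral>\<^sup>+u\<in>{0..Lx}. Q u \<partial>lborel)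
          + ?y * ?I4)"
        by (rule mult_left_mono) simp
      also have "\<dots> = T2 + ennreal (real n / x) * ?y * ?I4"
        unfolding T2 Lx_def by (simp only: distrib_left mult.assoc)
      also have "ennreal (real n / x) * ?y = ennreal (\<kappa> powr (r / 2)) * ennreal (real n / x powr (1 + r / 2))"
      proof -
        have "y powr (- (r / 2)) = \<kappa> powr (r / 2) / x powr (r / 2)"
          unfolding y_def using x \<kappa> by (simp add: powr_minus powr_divide field_simps)
        then have "real n / x * y powr (- (r / 2)) = \<kappa> powr (r / 2) * (real n / x powr (1 + r / 2))"
          using x by (simp add: powr_add)
        then show ?thesis using x by (simp add: ennreal_mult[symmetric])
      qed
      finally have le: "ennreal (real n / x) * ennreal I0 \<le> T2 + ennreal (\<kappa> powr (r / 2)) * ennreal (real n / x powr (1 + r / 2)) *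
          ?I4" .
      have "ennreal (real n / x * I0) = ennreal (real n / x) * ennreal I0"
        using x I0(1) by (intro ennreal_mult) auto
      then show ?thesis using le unfolding T4 Lx_def by (simp only: mult.assoc)
    qed
    have "emeasure M E = ennreal (prob E)" by (rule emeasure_eq_measure)
    also have "\<dots> \<le> ennreal (C1 * (v powr (r / 2) / x powr r) + C2 * (real n / x * I0))" by (rule ennreal_leI[OF pE])
    also have "\<dots> = ennreal C1 * ennreal (v powr (r / 2) / x powr r) + ennreal C2 * ennreal (real n / x * I0)"
    proof -
      have lin: "ennreal (C1 * s + C2 * t) = ennreal C1 * ennreal s + ennreal C2 * ennreal t" if "0 \<le> s" "0 \<le> t" for s t
        using that C0 by (simp add: ennreal_mult)
      show ?thesis by (rule lin) (use x I0(1) in simp_all)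
    qed
    also have "\<dots> \<le> ennreal C1 * T1 + ennreal C2 * (T2 + ennreal (\<kappa> powr (r / 2)) * T4)"
      by (intro add_mono mult_left_mono t1 t2) auto
    also have "\<dots> = ennreal C1 * T1 + ennreal C2 * T2 + ennreal (C2 * \<kappa> powr (r / 2)) * T4"
      using C0 by (simp add: distrib_left ennreal_mult mult.assoc add.assoc)
    also have "\<dots> \<le> ennreal C * T1 + ennreal C * T2 + ennreal C * T4"
      using CC by (intro add_mono mult_right_mono ennreal_leI) auto
    also have "\<dots> \<le> ennreal C * (T1 + T2 + T3 + T4)"
      by (simp add: distrib_left add_right_mono)
    finally show ?thesis unfolding Eeq .
  qed
  show ?thesis by (intro exI[of _ C] conjI allI impI main CC(1)) auto
qed

end
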